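(* Let $(\mathbb{G}^N)_{N\in\mathbb{N}}$ be a sequence of games as described in the context, with horizon $T\in\mathbb{N}\cup\{\infty\}$, satisfying conditions (A1)–(A3) and (B1)–(B3) listed in the context. Then, given $\epsilon>0$, there exists $\hat N_\epsilon\in\mathbb{N}$ such that, if $N\ge\hat N_\epsilon$, then $\mathbb{G}^N$ possesses an $\epsilon$-SEBEU in pure strategies, i.e. there exists $s=(s^1,\dots,s^N)\in\mathbb{S}^1\times\cdots\times\mathbb{S}^N$ such that, for all $i\in[1,N]$ and $\tilde\gamma^i\in\Gamma^1$, $$E^{\zeta_s}[J^i(s^i,\cdot)]\le E^{(\tilde\gamma^i,\zeta_s)}[J^i]+\epsilon .$$
   Context: Notation: $[1,N]=\{1,\dots,N\}$, $[0,T)=\{0,\dots,T-1\}$ if $T\in\mathbb{N}$ and $[0,T)=\mathbb{N}_0$ if $T=\infty$. $\mathcal{P}(\mathbb{T})$ is the set of Borel probability measures on $\mathbb{T}$; $m_{\mathbb{M}}$ is the metric of a metric space $\mathbb{M}$. Countable products of metric spaces carry the product metric $m(a,b)=\sum_t2^{-t}\frac{m_t(a_t,b_t)}{1+m_t(a_t,b_t)}$. Games: $\mathbb{G}^N$ has decision makers DM$^1,\dots,$DM$^N$. At time $t$, DM$^i$ has state $x_t^i\in\mathbb{X}^i$, control $u_t^i\in\mathbb{U}^i$, random disturbance $w_t^i\in\mathbb{W}^i$; there is an environment variable $y_t\in\mathbb{Y}$, an environment state $x_t^0\in\mathbb{X}^0$, and aggregate statistics $d_t^N=d_t^N(x_t,u_t)\in\mathbb{D}$,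 where $d_t^N:\mathbb{X}^1\times\cdots\times\mathbb{X}^N\times\mathbb{U}^1\times\cdots\times\mathbb{U}^N\to\mathbb{D}$, $x_t=(x_t^1,\dots,x_t^N)$, $u_t=(u_t^1,\dots,u_t^N)$, and $\mathbb{D}$ is a compact metric space. DM$^i$'s state evolves as $x_{t+1}^i=f_t^i(x_t^i,u_t^i,y_t,w_t^i)$, $t\in[0,T)$, from a possibly random initial state $x_0^i$; the environment variables are generated as in (B3) below. All games share $T,\mathbb{Y},\mathbb{X}^0,\mathbb{D}$ and the environment data $(f_t^0)_t,(g_t)_t,x_0^0$, and the data of DM$^i$, namely $\mathbb{X}^i,\mathbb{U}^i,\mathbb{W}^i,(f_t^i)_t,(c_t^i)_t,\beta^i,\mathbb{S}^i$ and the law of $\omega^i:=(x_0^i,(w_t^i)_{t\in[0,T)})$, is the same in all games $\mathbb{G}^i,\mathbb{G}^{i+1},\dots$; only the maps $d_t^N$ depend on $N$. Strategies: $I_t^i=((x_k^i)_{k\in[0,t]},(u_k^i)_{k\in[0,t)})\in\mathbb{I}_t^i:=(\mathbb{X}^i)^{[0,t]}\times(\mathbb{U}^i)^{[0,t)}$, $Y_{t-1}=(y_k)_{k\in[0,t)}$ ($Y_{-1}=\emptyset$). A pure strategy of DM$^i$ is $s^i=(s_t^i)_{t\in[0,T)}$, $s_t^i:\mathbb{I}_t^i\times\mathbb{Y}^{[0,t)}\to\mathbb{U}^i$, used as $u_t^i=s_t^i(I_t^i,Y_{t-1})$; $\mathbb{S}^i$ is the set of admissible pure strategies and $\Gamma^i=\mathcal{P}(\mathbb{S}^i)$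 the set of mixed strategies. For a joint pure strategy $s=(s^1,\dots,s^N)$, $\zeta_s\in\mathcal{P}(\mathbb{Y}^{[0,T)})$ is the distribution of $(y_t)_{t\in[0,T)}$ generated in $\mathbb{G}^N$ when each DM$^i$ uses $s^i$. Costs: DM$^i$ has discount factor $\beta^i\in(0,1]$ ($\beta^i\in(0,1)$ if $T=\infty$), stage costs $c_t^i:\mathbb{X}^i\times\mathbb{U}^i\times\mathbb{Y}\to\mathbb{R}$ ($t\in[0,T)$), terminal cost $c_T^i:\mathbb{X}^i\to\mathbb{R}$ ($c_T^i\equiv0$ if $T=\infty$). For $s^i\in\mathbb{S}^i$ and deterministic $\bar Z=(\bar z_t)_t\in\mathbb{Y}^{[0,T)}$, $J^i(s^i,\bar Z)=E[\sum_{t\in[0,T)}(\beta^i)^tc_t^i(x_t^i,u_t^i,\bar z_t)+(\beta^i)^Tc_T^i(x_T^i)]$ where $x_{t+1}^i=f_t^i(x_t^i,u_t^i,\bar z_t,w_t^i)$, $u_t^i=s_t^i(I_t^i,(\bar z_0,\dots,\bar z_{t-1}))$. For $\zeta\in\mathcal{P}(\mathbb{Y}^{[0,T)})$: $E^\zeta[J^i(s^i,\cdot)]=\int J^i(s^i,z)\zeta(dz)$, $E^{(\gamma^i,\zeta)}[J^i]=\int\int J^i(\tilde s^i,z)\gamma^i(d\tilde s^i)\zeta(dz)$, and $BR^i(\zeta)=\{\gamma^i\in\Gamma^i:E^{(\gamma^i,\zeta)}[J^i]\le E^{(\tilde\gamma^i,\zeta)}[J^i]\ \forall\tilde\gamma^i\in\Gamma^i\}$.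 DM$^i$ and DM$^j$ are called identical if $BR^i(\zeta)=BR^j(\zeta)$ for all $\zeta\in\mathcal{P}(\mathbb{Y}^{[0,T)})$. Conditions: (A1) The spaces $\mathbb{X}^0,\mathbb{Y}$ and $\mathbb{X}^i,\mathbb{U}^i,\mathbb{W}^i$ ($i\in\mathbb{N}$) are nonempty compact metric spaces; all $c_t^i,f_t^i$ ($i\in\mathbb{N}$), $f_t^0$, $g_t$ are continuous; for each $i\in\mathbb{N}$, $\mathbb{S}^i=\times_{t\in[0,T)}\mathbb{S}_t^i$ with each $\mathbb{S}_t^i$ a nonempty compact subset of the space of continuous functions $\mathbb{I}_t^i\times\mathbb{Y}^{[0,t)}\to\mathbb{U}^i$ with the supremum metric. Moreover: (a) for all $i\in\mathbb{N}$, $\mathbb{X}^i=\mathbb{X}^1$, $\mathbb{U}^i=\mathbb{U}^1$, $\mathbb{W}^i=\mathbb{W}^1$, $\mathbb{S}^i=\mathbb{S}^1$; (b) for each $t$, the families $(c_t^i)_{i\in\mathbb{N}}$ and $(f_t^i)_{i\in\mathbb{N}}$ are uniformly equi-continuous; (c) for some $\bar c<\infty$, $\bar\beta<1$: $\sup_{i\in\mathbb{N},t\in[0,T],x^i,u^i,y}|c_t^i(x^i,u^i,y)|<\bar c$ (for $t=T$ read $c_T^i(x^i)$) and $\sup_{i\in\mathbb{N}}\beta^i<\bar\beta$. (A2) For all $t\in[0,T)$ and $\epsilon>0$ there is $\delta_\epsilon>0$ such that, in all games $\mathbb{G}^N$, $N\in\mathbb{N}$: $\sup_{i\in[1,N]}m_{\mathbb{X}^i\times\mathbb{U}^i}((x^i,u^i),(\tilde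 x^i,\tilde u^i))<\delta_\epsilon$ implies $m_{\mathbb{D}}(d_t^N(x,u),d_t^N(\tilde x,\tilde u))<\epsilon$; and, for all $t\in[0,T)$, $\lim_{N\to\infty}\sup_{i\in[1,N]}\sup m_{\mathbb{D}}(d_t^N(x,u),d_t^N(\tilde x,\tilde u))=0$, the inner supremum being over all $(x,u),(\tilde x,\tilde u)$ with $(x^j,u^j)=(\tilde x^j,\tilde u^j)$ for all $j\ne i$. (Both properties hold for the averages in (B2).) (A3) The random variables $\omega^i=(x_0^i,(w_t^i)_{t\in[0,T)})$, $i\in\mathbb{N}$, are mutually independent. (B1) All DMs are identical, with $\mathbb{X}^1\subset\mathbb{R}^n$ and $\mathbb{U}^1\subset\mathbb{R}^m$ for some $n,m\in\mathbb{N}$ (with the Euclidean metrics). (B2) The aggregate statistics are the simple averages $d_t^N(x_t,u_t)=\frac1N\sum_{i\in[1,N]}\begin{bmatrix} x_t^i \\ u_t^i \end{bmatrix}$, $t\in[0,T)$, so $\mathbb{D}$ is a compact subset of $\mathbb{R}^{n+m}$ (Euclidean metric) containing all such averages. (B3) The environment variables are generated by deterministic dynamics driven by the (random) inputs $(d_t^N)_t$: the initial environment state $x_0^0\in\mathbb{X}^0$ is deterministic and $y_t=g_t(x_t^0,d_t^N)$, $x_{t+1}^0=f_t^0(x_t^0,d_t^N)$, $t\in[0,T)$, with $g_t:\mathbb{X}^0\times\mathbb{D}\to\mathbb{Y}$, $f_t^0:\mathbb{X}^0\times\mathbb{D}\to\mathbb{X}^0$. *)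

theory Defs
  imports "HOL-Probability.Probability"
begin

text \<open>
  A sequence of games. Decision makers are numbered from 1, and \<open>aggr N t\<close> is the aggregate
  statistic of the game with \<open>N\<close> decision makers. All primitive random variables live on one
  probability space \<open>sample\<close>. Functions are only relevant on the indicated carrier sets and, as far
  as time is concerned, on \<open>stages\<close>. Strategies are sequences of maps on pairs (private history,
  past environment variables); a private history is the pair of the state sequence on \<open>{..t}\<close>
  and the control sequence on \<open>{..<t}\<close>.
\<close>

type_synonym ('x, 'u) history = "(nat \<Rightarrow> 'x) \<times> (nat \<Rightarrow> 'u)"

type_synonym ('x, 'u, 'y) strategy = "nat \<Rightarrow> ('x, 'u) history \<times> (nat \<Rightarrow> 'y) \<Rightarrow> 'u"

record ('x, 'u, 'w, 'y, 'e, 'd, 'p) game_seq =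
  horizon :: enat
  env_vars :: "'y set"
  env_states :: "'e set"
  aggregates :: "'d set"
  env_step :: "nat \<Rightarrow> 'e \<times> 'd \<Rightarrow> 'e"
  env_out :: "nat \<Rightarrow> 'e \<times> 'd \<Rightarrow> 'y"
  env_init :: 'e
  states :: "nat \<Rightarrow> 'x set"
  controls :: "nat \<Rightarrow> 'u set"
  disturbances :: "nat \<Rightarrow> 'w set"
  dm_step :: "nat \<Rightarrow> nat \<Rightarrow> 'x \<times> 'u \<times> 'y \<times> 'w \<Rightarrow> 'x"
  stage_cost :: "nat \<Rightarrow> nat \<Rightarrow> 'x \<times> 'u \<times> 'y \<Rightarrow> real"
  final_cost :: "nat \<Rightarrow> 'x \<Rightarrow> real"
  disc :: "nat \<Rightarrow> real"
  strategies :: "nat \<Rightarrow> ('x, 'u, 'y) strategy set"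
  aggr :: "nat \<Rightarrow> nat \<Rightarrow> (nat \<Rightarrow> 'x) \<Rightarrow> (nat \<Rightarrow> 'u) \<Rightarrow> 'd"
  sample :: "'p measure"
  init_state :: "nat \<Rightarrow> 'p \<Rightarrow> 'x"
  noise :: "nat \<Rightarrow> nat \<Rightarrow> 'p \<Rightarrow> 'w"

definition stages :: "('x, 'u, 'w, 'y, 'e, 'd, 'p) game_seq \<Rightarrow> nat set" where
  "stages G = {t. enat t < horizon G}"


subsection \<open>Borel probability measures\<close>

definition borel_of :: "'a topology \<Rightarrow> 'a measure" where
  "borel_of \<tau> = sigma (topspace \<tau>) {A. openin \<tau> A}"

definition borel_probs :: "'a topology \<Rightarrow> 'a measure set" where
  "borel_probs \<tau> = {\<mu>. prob_space \<mu> \<and> sets \<mu> = sets (borel_of \<tau>)}"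


subsection \<open>Spaces of histories, paths and strategies\<close>

definition history_top ::
  "('x::topological_space, 'u::topological_space, 'w, 'y::topological_space, 'e, 'd, 'p) game_seq
    \<Rightarrow> nat \<Rightarrow> nat \<Rightarrow> (('x, 'u) history \<times> (nat \<Rightarrow> 'y)) topology" where
  "history_top G i t =
     prod_topology
       (prod_topology
         (product_topology (\<lambda>_. top_of_set (states G i)) {..t})
         (product_topology (\<lambda>_. top_of_set (controls G i)) {..<t}))
       (product_topology (\<lambda>_. top_of_set (env_vars G)) {..<t})"

definition path_top ::
  "('x, 'u, 'w, 'y::topological_space, 'e, 'd, 'p) game_seq \<Rightarrow> (nat \<Rightarrow> 'y) topology" where
  "path_top G = product_topology (\<lambda>_. top_of_set (env_vars G)) (stages G)"

text \<open>Continuous maps from histories to controls with the supremum metric; boundedness, which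
  \<^const>\<open>cfunspace\<close> also requires, is automatic for compact control sets.\<close>

definition decision_top ::
  "('x::topological_space, 'u::metric_space, 'w, 'y::topological_space, 'e, 'd, 'p) game_seq
    \<Rightarrow> nat \<Rightarrow> nat \<Rightarrow> (('x, 'u) history \<times> (nat \<Rightarrow> 'y) \<Rightarrow> 'u) topology" where
  "decision_top G i t =
     mtopology_of (cfunspace (history_top G i t) (submetric euclidean_metric (controls G i)))"

definition strategy_top ::
  "('x::topological_space, 'u::metric_space, 'w, 'y::topological_space, 'e, 'd, 'p) game_seq
    \<Rightarrow> nat \<Rightarrow> ('x, 'u, 'y) strategy topology" where
  "strategy_top G i =
     subtopology (product_topology (decision_top G i) (stages G)) (strategies G i)"

definition mixed_strategies ::
  "('x::topological_space, 'u::metric_space, 'w, 'y::topological_space, 'e, 'd, 'p) game_seq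
    \<Rightarrow> nat \<Rightarrow> ('x, 'u, 'y) strategy measure set" where
  "mixed_strategies G i = borel_probs (strategy_top G i)"


subsection \<open>Dynamics\<close>

text \<open>\<open>dm_history G i s a v z t\<close> is the private history of decision maker \<open>i\<close> at time \<open>t\<close> when
  it uses \<open>s\<close>, its initial state is \<open>a\<close>, its disturbances are \<open>v\<close> and the environment variables
  are \<open>z\<close>; it depends on \<open>z\<close> only before time \<open>t\<close>.\<close>

primrec dm_history ::
  "('x, 'u, 'w, 'y, 'e, 'd, 'p) game_seq \<Rightarrow> nat \<Rightarrow> ('x, 'u, 'y) strategy
    \<Rightarrow> 'x \<Rightarrow> (nat \<Rightarrow> 'w) \<Rightarrow> (nat \<Rightarrow> 'y) \<Rightarrow> nat \<Rightarrow> ('x, 'u) history" where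
  "dm_history G i s a v z 0 = ((\<lambda>_. undefined)(0 := a), \<lambda>_. undefined)"
| "dm_history G i s a v z (Suc t) =
     (let (xs, us) = dm_history G i s a v z t;
          u = s t ((xs, us), restrict z {..<t})
      in (xs(Suc t := dm_step G i t (xs t, u, z t, v t)), us(t := u)))"

definition dm_state ::
  "('x, 'u, 'w, 'y, 'e, 'd, 'p) game_seq \<Rightarrow> nat \<Rightarrow> ('x, 'u, 'y) strategy
    \<Rightarrow> 'x \<Rightarrow> (nat \<Rightarrow> 'w) \<Rightarrow> (nat \<Rightarrow> 'y) \<Rightarrow> nat \<Rightarrow> 'x" where
  "dm_state G i s a v z t = fst (dm_history G i s a v z t) t"

definition dm_control ::
  "('x, 'u, 'w, 'y, 'e, 'd, 'p) game_seq \<Rightarrow> nat \<Rightarrow> ('x, 'u, 'y) strategy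
    \<Rightarrow> 'x \<Rightarrow> (nat \<Rightarrow> 'w) \<Rightarrow> (nat \<Rightarrow> 'y) \<Rightarrow> nat \<Rightarrow> 'u" where
  "dm_control G i s a v z t = s t (dm_history G i s a v z t, restrict z {..<t})"

text \<open>The environment variables before time \<open>t\<close> and the environment state at time \<open>t\<close> that the
  joint strategy \<open>s\<close> generates, at the sample point \<open>\<omega>\<close>, in the game with \<open>N\<close> decision makers.\<close>

primrec env_history ::
  "('x, 'u, 'w, 'y, 'e, 'd, 'p) game_seq \<Rightarrow> nat \<Rightarrow> (nat \<Rightarrow> ('x, 'u, 'y) strategy)
    \<Rightarrow> 'p \<Rightarrow> nat \<Rightarrow> (nat \<Rightarrow> 'y) \<times> 'e" where
  "env_history G N s \<omega> 0 = (\<lambda>_. undefined, env_init G)"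
| "env_history G N s \<omega> (Suc t) =
     (let (ys, e) = env_history G N s \<omega> t;
          x = (\<lambda>j\<in>{1..N}. dm_state G j (s j) (init_state G j \<omega>) (\<lambda>k. noise G j k \<omega>) ys t);
          u = (\<lambda>j\<in>{1..N}. dm_control G j (s j) (init_state G j \<omega>) (\<lambda>k. noise G j k \<omega>) ys t);
          d = aggr G N t x u
      in (ys(t := env_out G t (e, d)), env_step G t (e, d)))"

definition env_path ::
  "('x, 'u, 'w, 'y, 'e, 'd, 'p) game_seq \<Rightarrow> nat \<Rightarrow> (nat \<Rightarrow> ('x, 'u, 'y) strategy)
    \<Rightarrow> 'p \<Rightarrow> nat \<Rightarrow> 'y" where
  "env_path G N s \<omega> = (\<lambda>t\<in>stages G. fst (env_history G N s \<omega> (Suc t)) t)"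

definition env_law ::
  "('x, 'u, 'w, 'y::topological_space, 'e, 'd, 'p) game_seq \<Rightarrow> nat
    \<Rightarrow> (nat \<Rightarrow> ('x, 'u, 'y) strategy) \<Rightarrow> (nat \<Rightarrow> 'y) measure" where
  "env_law G N s = distr (sample G) (borel_of (path_top G)) (env_path G N s)"


subsection \<open>Costs and best replies\<close>

definition path_cost ::
  "('x, 'u, 'w, 'y, 'e, 'd, 'p) game_seq \<Rightarrow> nat \<Rightarrow> ('x, 'u, 'y) strategy
    \<Rightarrow> 'x \<Rightarrow> (nat \<Rightarrow> 'w) \<Rightarrow> (nat \<Rightarrow> 'y) \<Rightarrow> real" where
  "path_cost G i s a v z =
     (let c = (\<lambda>t. disc G i ^ t *
                 stage_cost G i t (dm_state G i s a v z t, dm_control G i s a v z t, z t))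
      in case horizon G of
           enat n \<Rightarrow> (\<Sum>t<n. c t) + disc G i ^ n * final_cost G i (dm_state G i s a v z n)
         | \<infinity> \<Rightarrow> (\<Sum>t. c t))"

definition expected_cost ::
  "('x, 'u, 'w, 'y, 'e, 'd, 'p) game_seq \<Rightarrow> nat \<Rightarrow> ('x, 'u, 'y) strategy
    \<Rightarrow> (nat \<Rightarrow> 'y) \<Rightarrow> real" where
  "expected_cost G i s z =
     (LINT \<omega>|sample G. path_cost G i s (init_state G i \<omega>) (\<lambda>k. noise G i k \<omega>) z)"

definition mixed_cost ::
  "('x, 'u, 'w, 'y, 'e, 'd, 'p) game_seq \<Rightarrow> nat \<Rightarrow> ('x, 'u, 'y) strategy measure
    \<Rightarrow> (nat \<Rightarrow> 'y) measure \<Rightarrow> real" where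
  "mixed_cost G i \<gamma> \<zeta> = (LINT z|\<zeta>. LINT s|\<gamma>. expected_cost G i s z)"

definition best_replies ::
  "('x::topological_space, 'u::metric_space, 'w, 'y::topological_space, 'e, 'd, 'p) game_seq
    \<Rightarrow> nat \<Rightarrow> (nat \<Rightarrow> 'y) measure \<Rightarrow> ('x, 'u, 'y) strategy measure set" where
  "best_replies G i \<zeta> =
     {\<gamma> \<in> mixed_strategies G i.
        \<forall>\<gamma>'\<in>mixed_strategies G i. mixed_cost G i \<gamma> \<zeta> \<le> mixed_cost G i \<gamma>' \<zeta>}"

definition identical_dms ::
  "('x::topological_space, 'u::metric_space, 'w, 'y::topological_space, 'e, 'd, 'p) game_seq
    \<Rightarrow> nat \<Rightarrow> nat \<Rightarrow> bool" where
  "identical_dms G i j \<longleftrightarrow>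
     (\<forall>\<zeta>\<in>borel_probs (path_top G). best_replies G i \<zeta> = best_replies G j \<zeta>)"


subsection \<open>Assumptions\<close>

text \<open>The structural data of a sequence of games whose environment is driven deterministically by
  the aggregate statistics.\<close>

definition game_sequence ::
  "('x::topological_space, 'u, 'w::topological_space, 'y, 'e, 'd::topological_space, 'p) game_seq
    \<Rightarrow> bool" where
  "game_sequence G \<longleftrightarrow>
     0 < horizon G \<and>
     compact (aggregates G) \<and>
     env_init G \<in> env_states G \<and>
     (\<forall>t\<in>stages G.
        env_step G t \<in> env_states G \<times> aggregates G \<rightarrow> env_states G \<and>
        env_out G t \<in> env_states G \<times> aggregates G \<rightarrow> env_vars G) \<and>
     (\<forall>i\<ge>1. \<forall>t\<in>stages G.
        dm_step G i t \<in> states G i \<times> controls G i \<times> env_vars G \<times> disturbances G i \<rightarrow> states G i) \<and>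
     (\<forall>N\<ge>1. \<forall>t\<in>stages G. \<forall>x\<in>PiE {1..N} (states G). \<forall>u\<in>PiE {1..N} (controls G).
        aggr G N t x u \<in> aggregates G) \<and>
     (\<forall>i\<ge>1. 0 < disc G i \<and> disc G i \<le> 1 \<and> (horizon G = \<infinity> \<longrightarrow> disc G i < 1)) \<and>
     (\<forall>i\<ge>1. horizon G = \<infinity> \<longrightarrow> (\<forall>x\<in>states G i. final_cost G i x = 0)) \<and>
     prob_space (sample G) \<and>
     (\<forall>i\<ge>1. init_state G i \<in> sample G \<rightarrow>\<^sub>M restrict_space borel (states G i)) \<and>
     (\<forall>i\<ge>1. \<forall>t\<in>stages G. noise G i t \<in> sample G \<rightarrow>\<^sub>M restrict_space borel (disturbances G i))"

definition uniformly_equicontinuous ::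
  "'i set \<Rightarrow> ('i \<Rightarrow> 'a::metric_space set) \<Rightarrow> ('i \<Rightarrow> 'a \<Rightarrow> 'b::metric_space) \<Rightarrow> bool" where
  "uniformly_equicontinuous I A F \<longleftrightarrow>
     (\<forall>e>0. \<exists>\<delta>>0. \<forall>i\<in>I. \<forall>a\<in>A i. \<forall>b\<in>A i. dist a b < \<delta> \<longrightarrow> dist (F i a) (F i b) < e)"

definition cond_A1 ::
  "('x::metric_space, 'u::metric_space, 'w::metric_space, 'y::metric_space, 'e::metric_space,
    'd::metric_space, 'p) game_seq \<Rightarrow> bool" where
  "cond_A1 G \<longleftrightarrow>
     compact (env_states G) \<and> env_states G \<noteq> {} \<and>
     compact (env_vars G) \<and> env_vars G \<noteq> {} \<and>
     (\<forall>i\<ge>1.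
        compact (states G i) \<and> states G i \<noteq> {} \<and>
        compact (controls G i) \<and> controls G i \<noteq> {} \<and>
        compact (disturbances G i) \<and> disturbances G i \<noteq> {}) \<and>
     (\<forall>i\<ge>1. \<forall>t\<in>stages G.
        continuous_on (states G i \<times> controls G i \<times> env_vars G) (stage_cost G i t) \<and>
        continuous_on (states G i \<times> controls G i \<times> env_vars G \<times> disturbances G i) (dm_step G i t)) \<and>
     (\<forall>i\<ge>1. continuous_on (states G i) (final_cost G i)) \<and>
     (\<forall>t\<in>stages G.
        continuous_on (env_states G \<times> aggregates G) (env_step G t) \<and>
        continuous_on (env_states G \<times> aggregates G) (env_out G t)) \<and>
     (\<forall>i\<ge>1. \<exists>S. strategies G i = PiE (stages G) S \<and>
        (\<forall>t\<in>stages G. S t \<noteq> {} \<and> compactin (decision_top G i t) (S t))) \<and>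
     (\<forall>i\<ge>1. states G i = states G 1 \<and> controls G i = controls G 1 \<and>
        disturbances G i = disturbances G 1 \<and> strategies G i = strategies G 1) \<and>
     (\<forall>t\<in>stages G.
        uniformly_equicontinuous {1..} (\<lambda>i. states G i \<times> controls G i \<times> env_vars G)
          (\<lambda>i. stage_cost G i t) \<and>
        uniformly_equicontinuous {1..}
          (\<lambda>i. states G i \<times> controls G i \<times> env_vars G \<times> disturbances G i) (\<lambda>i. dm_step G i t)) \<and>
     uniformly_equicontinuous {1..} (states G) (final_cost G) \<and>
     (\<exists>C. (\<forall>i\<ge>1. \<forall>t\<in>stages G. \<forall>a\<in>states G i \<times> controls G i \<times> env_vars G.
             \<bar>stage_cost G i t a\<bar> \<le> C) \<and>
          (\<forall>i\<ge>1. \<forall>x\<in>states G i. \<bar>final_cost G i x\<bar> \<le> C)) \<and>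
     (\<exists>b<1. \<forall>i\<ge>1. disc G i \<le> b)"

definition profiles ::
  "('x, 'u, 'w, 'y, 'e, 'd, 'p) game_seq \<Rightarrow> nat \<Rightarrow> ((nat \<Rightarrow> 'x) \<times> (nat \<Rightarrow> 'u)) set" where
  "profiles G N = PiE {1..N} (states G) \<times> PiE {1..N} (controls G)"

definition unilateral_deviations ::
  "('x, 'u, 'w, 'y, 'e, 'd, 'p) game_seq \<Rightarrow> nat \<Rightarrow> nat
    \<Rightarrow> (((nat \<Rightarrow> 'x) \<times> (nat \<Rightarrow> 'u)) \<times> ((nat \<Rightarrow> 'x) \<times> (nat \<Rightarrow> 'u))) set" where
  "unilateral_deviations G N i =
     {((x, u), (x', u')). (x, u) \<in> profiles G N \<and> (x', u') \<in> profiles G N \<and>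
        (\<forall>j\<in>{1..N} - {i}. x j = x' j \<and> u j = u' j)}"

definition cond_A2 ::
  "('x::metric_space, 'u::metric_space, 'w, 'y, 'e, 'd::metric_space, 'p) game_seq \<Rightarrow> bool" where
  "cond_A2 G \<longleftrightarrow>
     (\<forall>t\<in>stages G. \<forall>e>0. \<exists>\<delta>>0. \<forall>N\<ge>1. \<forall>(x, u)\<in>profiles G N. \<forall>(x', u')\<in>profiles G N.
        (SUP i\<in>{1..N}. dist (x i, u i) (x' i, u' i)) < \<delta> \<longrightarrow>
        dist (aggr G N t x u) (aggr G N t x' u') < e) \<and>
     (\<forall>t\<in>stages G.
        (\<lambda>N. SUP i\<in>{1..N}. SUP ((x, u), (x', u'))\<in>unilateral_deviations G N i.
               dist (aggr G N t x u) (aggr G N t x' u')) \<longlonglongrightarrow> 0)"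

definition cond_A3 ::
  "('x::topological_space, 'u, 'w::topological_space, 'y, 'e, 'd, 'p) game_seq \<Rightarrow> bool" where
  "cond_A3 G \<longleftrightarrow>
     prob_space.indep_vars (sample G)
       (\<lambda>i. restrict_space borel (states G i) \<Otimes>\<^sub>M
            (\<Pi>\<^sub>M t\<in>stages G. restrict_space borel (disturbances G i)))
       (\<lambda>i \<omega>. (init_state G i \<omega>, \<lambda>t\<in>stages G. noise G i t \<omega>)) {1..}"

definition cond_B1 ::
  "(real ^ 'n, real ^ 'm, 'w, 'y::topological_space, 'e, 'd, 'p) game_seq \<Rightarrow> bool" where
  "cond_B1 G \<longleftrightarrow> (\<forall>i\<ge>1. \<forall>j\<ge>1. identical_dms G i j)"

text \<open>The product norm on \<^typ>\<open>(real ^ 'n) \<times> (real ^ 'm)\<close> is the Euclidean norm of the stacked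
  vector.\<close>

definition cond_B2 ::
  "(real ^ 'n, real ^ 'm, 'w, 'y, 'e, (real ^ 'n) \<times> (real ^ 'm), 'p) game_seq \<Rightarrow> bool" where
  "cond_B2 G \<longleftrightarrow>
     (\<forall>N\<ge>1. \<forall>t\<in>stages G. \<forall>(x, u)\<in>profiles G N.
        aggr G N t x u = (1 / real N) *\<^sub>R (\<Sum>i\<in>{1..N}. (x i, u i)))"

end

theory Submission
  imports Defs "HOL-Real_Asymp.Real_Asymp"
begin

text \<open>
  For large \<open>N\<close> the environment path is nearly deterministic, and path costs depend on it
  equicontinuously, so it suffices to find a deterministic path \<open>z\<close> and a pure profile of nearly
  best replies to \<open>z\<close> that generates a path near \<open>z\<close>. Take a finite net of paths \<open>z\<^sub>l\<close> and an exact
  pure best reply \<open>s\<^sub>l\<close> of the first decision maker to each \<open>z\<^sub>l\<close>; by (B1), applied to Dirac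
  measures, \<open>s\<^sub>l\<close> is a best reply of every decision maker. Weights \<open>lam\<close> on the net determine a
  mean-field path, in which the aggregate is replaced by its expectation when everybody mixes the
  \<open>s\<^sub>l\<close> with weights \<open>lam\<close>. Brouwer's theorem gives weights that are concentrated on those \<open>l\<close>
  whose \<open>z\<^sub>l\<close> is close to the path they generate. Finally the mixture is replaced by a pure profile
  with almost the same expected aggregates, and Hoeffding's inequality shows that the realized path
  is close to the mean-field path.
\<close>

subsection \<open>Analytic preliminaries\<close>

text \<open>Condition (B1) equates sets of exact best replies; the costs of two decision makers need
  not be comparable, so a nearly best reply of one says nothing about another. This is why exact
  best replies are computed at net points fixed in advance, and distance from the equilibrium path
  is paid for only afterwards, through a modulus of continuity of the costs that is uniform in the
  decision maker, the strategy and the path. Dynamics and laws of the primitives may still differ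
  between decision makers, so the mean-field path depends on \<open>N\<close>: the fixed point
  problem is solved anew for each \<open>N\<close>, while the net, the best replies and all
  tolerances are chosen before \<open>N\<close>. Independence is available only along a
  deterministic path, since along the realized one the decision makers interact. Concentration is
  therefore proved for averages computed along the mean-field path and carried over to the realized
  path by a deterministic stability argument. A single number \<open>n\<close> is both a time window
  and a precision, which reduces an infinite horizon to finitely many stages.\<close>

lemma tendsto_fun_iff:
  fixes f :: "'k \<Rightarrow> 'i \<Rightarrow> 'a::topological_space"
  shows "(f \<longlongrightarrow> l) F \<longleftrightarrow> (\<forall>i. ((\<lambda>k. f k i) \<longlongrightarrow> l i) F)"
  using limitin_componentwise[of "\<lambda>_. euclidean" UNIV f l F] by (simp add: euclidean_product_topology)

text \<open>The fixed point theorem of the library takes the dimension from a type; here it will be the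
  size of a net.\<close>

lemma Brouwer_finite_cube:
  fixes f :: "(nat \<Rightarrow> real) \<Rightarrow> nat \<Rightarrow> real" and n :: nat
  defines "Q \<equiv> {x. (\<forall>i<n. 0 \<le> x i \<and> x i \<le> 1) \<and> (\<forall>i\<ge>n. x i = 0)}"
  assumes cont: "\<And>i. i < n \<Longrightarrow> continuous_on Q (\<lambda>x. f x i)"
    and maps: "\<And>x i. x \<in> Q \<Longrightarrow> i < n \<Longrightarrow> 0 \<le> f x i \<and> f x i \<le> 1"
  obtains x where "x \<in> Q" "\<And>i. i < n \<Longrightarrow> f x i = x i"
proof -
  have Q_PiE: "Q = PiE UNIV (\<lambda>i. if i < n then {0..1} else {0})"
  proof (intro set_eqI iffI)
    show "x \<in> PiE UNIV (\<lambda>i. if i < n then {0..1} else {0})" if "x \<in> Q" for x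
      using that by (simp add: Q_def PiE_UNIV_domain Pi_iff)
    fix x :: "nat \<Rightarrow> real"
    assume "x \<in> PiE UNIV (\<lambda>i. if i < n then {0..1} else {0})"
    then have *: "x i \<in> (if i < n then {0..1} else {0})" for i by blast
    have "0 \<le> x i \<and> x i \<le> 1" if "i < n" for i using *[of i] that by simp
    moreover have "x i = 0" if "n \<le> i" for i using *[of i] that by simp
    ultimately show "x \<in> Q" by (simp add: Q_def)
  qed
  have "compactin (product_topology (\<lambda>_. euclidean) UNIV) Q"
    unfolding Q_PiE compactin_PiE by auto
  then have "compact Q"
    by (simp add: euclidean_product_topology)
  \<comment> \<open>Integer vectors label the points of mesh \<open>1 / p\<close> in the cube;
    coordinates from \<open>n\<close> on stay 0, as membership in \<open>Q\<close> demands.\<close>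
  define grid where "grid p q = (\<lambda>i. if i < n then real (q i) / real p else 0)" for p q
  have grid_Q: "grid p q \<in> Q" if "\<And>i. i < n \<Longrightarrow> q i \<le> p" for p q
    using that by (auto simp: grid_def Q_def divide_le_eq_1)
  have "\<exists>q. (\<forall>i<n. q i < Suc k) \<and>
     (\<forall>i<n. \<exists>r s. (\<forall>j<n. q j \<le> r j \<and> r j \<le> q j + 1) \<and> (\<forall>j<n. q j \<le> s j \<and> s j \<le> q j + 1) \<and>
        grid (Suc k) r i \<le> f (grid (Suc k) r) i \<and> f (grid (Suc k) s) i \<le> grid (Suc k) s i)" for k
  proof -
    \<comment> \<open>Label 1 marks coordinates that \<open>f\<close> does not increase, label 0
      those that it does not decrease. The clauses on \<open>x i\<close> fix the labels on opposite
      faces, as Kuhn's lemma requires; there the inequalities hold because \<open>f\<close> maps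
      into the cube.\<close>
    define label where "label = (\<lambda>x i. if x i = Suc k \<or> (x i \<noteq> 0 \<and> f (grid (Suc k) x) i < grid
        (Suc k) x i)
       then 1 else 0 :: nat)"
    obtain q where q: "\<forall>i<n. q i < Suc k"
      "\<forall>i<n. \<exists>r s. (\<forall>j<n. q j \<le> r j \<and> r j \<le> q j + 1) \<and> (\<forall>j<n. q j \<le> s j \<and> s j \<le> q j + 1) \<and> label r
          i \<noteq> label s i"
      by (rule kuhn_lemma[of "Suc k" n label]) (auto simp: label_def)
    have lab1: "f (grid (Suc k) x) i \<le> grid (Suc k) x i" if "label x i = 1" "i < n" "\<forall>j<n. x j \<le>
        Suc k" for x i
    proof (cases "x i = Suc k")
      case True
      then have "grid (Suc k) x i = 1" using that by (simp add: grid_def)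
      then show ?thesis using maps[OF grid_Q, of x "Suc k" i] that by auto
    next
      case False then show ?thesis using that by (auto simp: label_def split: if_splits)
    qed
    have lab0: "grid (Suc k) x i \<le> f (grid (Suc k) x) i" if "label x i = 0" "i < n" "\<forall>j<n. x j \<le>
        Suc k" for x i
    proof (cases "x i = 0")
      case True
      then have "grid (Suc k) x i = 0" using that by (simp add: grid_def)
      then show ?thesis using maps[OF grid_Q, of x "Suc k" i] that by auto
    next
      case False then show ?thesis using that by (auto simp: label_def split: if_splits)
    qed
    have "\<exists>r s. (\<forall>j<n. q j \<le> r j \<and> r j \<le> q j + 1) \<and> (\<forall>j<n. q j \<le> s j \<and> s j \<le> q j + 1) \<and>
        grid (Suc k) r i \<le> f (grid (Suc k) r) i \<and> f (grid (Suc k) s) i \<le> grid (Suc k) s i" if i: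
            "i < n" for i
    proof -
      obtain r s where rs: "\<forall>j<n. q j \<le> r j \<and> r j \<le> q j + 1" "\<forall>j<n. q j \<le> s j \<and> s j \<le> q j + 1"
        "label r i \<noteq> label s i" using q(2) i by blast
      have le: "\<forall>j<n. r j \<le> Suc k" "\<forall>j<n. s j \<le> Suc k"
      proof safe
        fix j assume "j < n"
        then show "r j \<le> Suc k" "s j \<le> Suc k"
          using spec[OF rs(1), of j] spec[OF rs(2), of j] spec[OF q(1), of j] by simp_all
      qed
      have "label r i = 0 \<and> label s i = 1 \<or> label r i = 1 \<and> label s i = 0"
        using rs(3) by (auto simp: label_def split: if_splits)
      then show ?thesis
      proof (elim disjE conjE)
        assume "label r i = 0" "label s i = 1"
        then show ?thesis using lab0[OF _ i le(1)] lab1[OF _ i le(2)] rs(1,2) by blast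
      next
        assume "label r i = 1" "label s i = 0"
        then show ?thesis using lab1[OF _ i le(1)] lab0[OF _ i le(2)] rs(1,2) by blast
      qed
    qed
    then show ?thesis using q(1) by blast
  qed
  then obtain q where q: "\<And>k i. i < n \<Longrightarrow> q k i < Suc k"
    "\<And>k i. i < n \<Longrightarrow> \<exists>r s. (\<forall>j<n. q k j \<le> r j \<and> r j \<le> q k j + 1) \<and> (\<forall>j<n. q k j \<le> s j \<and> s j \<le> q k j + 1) \<and>
        grid (Suc k) r i \<le> f (grid (Suc k) r) i \<and> f (grid (Suc k) s) i \<le> grid (Suc k) s i"
    by metis
  define adj where "adj k x \<longleftrightarrow> (\<forall>j<n. q k j \<le> x j \<and> x j \<le> q k j + 1)" for k and x :: "nat \<Rightarrow> nat"
  define below where "below k i x \<longleftrightarrow> grid (Suc k) x i \<le> f (grid (Suc k) x) i" for k i x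
  define above where "above k i x \<longleftrightarrow> f (grid (Suc k) x) i \<le> grid (Suc k) x i" for k i x
  have "\<forall>k i. \<exists>r s. i < n \<longrightarrow> adj k r \<and> adj k s \<and> below k i r \<and> above k i s"
    using q(2) unfolding adj_def below_def above_def by blast
  then obtain r s where "\<forall>k i. i < n \<longrightarrow> adj k (r k i) \<and> adj k (s k i) \<and> below k i (r k i) \<and> above k
      i (s k i)"
    by metis
  then have rs: "\<And>k i j. i < n \<Longrightarrow> j < n \<Longrightarrow> q k j \<le> r k i j \<and> r k i j \<le> q k j + 1"
     "\<And>k i j. i < n \<Longrightarrow> j < n \<Longrightarrow> q k j \<le> s k i j \<and> s k i j \<le> q k j + 1"
     "\<And>k i. i < n \<Longrightarrow> grid (Suc k) (r k i) i \<le> f (grid (Suc k) (r k i)) i"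
     "\<And>k i. i < n \<Longrightarrow> f (grid (Suc k) (s k i)) i \<le> grid (Suc k) (s k i) i"
    unfolding adj_def below_def above_def by blast+
  have "\<forall>k. grid (Suc k) (q k) \<in> Q" using q(1) by (intro allI grid_Q) (simp add: less_imp_le)
  then obtain x \<phi> where x: "x \<in> Q" "strict_mono \<phi>" "((\<lambda>k. grid (Suc k) (q k)) \<circ> \<phi>) \<longlonglongrightarrow> x"
    by (rule seq_compactE[OF compact_imp_seq_compact[OF \<open>compact Q\<close>]])
  have xi: "(\<lambda>k. grid (Suc (\<phi> k)) (q (\<phi> k)) i) \<longlonglongrightarrow> x i" for i
    using x(3) by (simp add: tendsto_fun_iff o_def)
  \<comment> \<open>All corners of the cell at \<open>q (\<phi> k)\<close> lie within
    \<open>1 / Suc (\<phi> k)\<close> of the base point in every coordinate, so they share its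
    limit.\<close>
  have near: "(\<lambda>k. grid (Suc (\<phi> k)) (p k)) \<longlonglongrightarrow> x"
    if p: "\<And>k j. j < n \<Longrightarrow> q (\<phi> k) j \<le> p k j \<and> p k j \<le> q (\<phi> k) j + 1" for p
  proof -
    have "(\<lambda>k. grid (Suc (\<phi> k)) (p k) i) \<longlonglongrightarrow> x i" for i
    proof (cases "i < n")
      case True
      have "(\<lambda>k. 1 / real (Suc (\<phi> k))) \<longlonglongrightarrow> 0"
        using LIMSEQ_subseq_LIMSEQ[OF LIMSEQ_inverse_real_of_nat x(2)]
        by (simp add: o_def inverse_eq_divide)
      from tendsto_add[OF xi[of i] this]
      have lim: "(\<lambda>k. grid (Suc (\<phi> k)) (q (\<phi> k)) i + 1 / real (Suc (\<phi> k))) \<longlonglongrightarrow> x i" by simp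
      show ?thesis
      proof (rule tendsto_sandwich[OF _ _ xi lim])
        show "\<forall>\<^sub>F k in sequentially. grid (Suc (\<phi> k)) (q (\<phi> k)) i \<le> grid (Suc (\<phi> k)) (p k) i"
          using p True by (intro always_eventually) (auto simp: grid_def divide_right_mono)
        have "real (p k i) \<le> real (q (\<phi> k) i) + 1" for k using p[OF True, of k] by linarith
        then show "\<forall>\<^sub>F k in sequentially. grid (Suc (\<phi> k)) (p k) i \<le> grid (Suc (\<phi> k)) (q (\<phi> k)) i
            + 1 / real (Suc (\<phi> k))"
          using True by (intro always_eventually)
            (auto simp: grid_def add_divide_distrib[symmetric] intro!: divide_right_mono)
      qed
    next
      case False then show ?thesis using x(1) by (simp add: grid_def Q_def)
    qed
    then show ?thesis by (simp add: tendsto_fun_iff)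
  qed
  \<comment> \<open>The corners \<open>r\<close> and \<open>s\<close> depend on \<open>i\<close> and
    carry opposite inequalities; both pass to the limit at the common point
    \<open>x\<close>.\<close>
  have "f x i = x i" if i: "i < n" for i
  proof (rule antisym)
    have memb: "grid (Suc (\<phi> k)) (r (\<phi> k) i) \<in> Q" "grid (Suc (\<phi> k)) (s (\<phi> k) i) \<in> Q" for k
    proof -
      have "r (\<phi> k) i j \<le> Suc (\<phi> k)" "s (\<phi> k) i j \<le> Suc (\<phi> k)" if "j < n" for j
        using rs(1,2)[OF i that, of "\<phi> k"] q(1)[OF that, of "\<phi> k"] by simp_all
      then show "grid (Suc (\<phi> k)) (r (\<phi> k) i) \<in> Q" "grid (Suc (\<phi> k)) (s (\<phi> k) i) \<in> Q"
        by (auto intro: grid_Q)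
    qed
    have lr: "(\<lambda>k. grid (Suc (\<phi> k)) (r (\<phi> k) i)) \<longlonglongrightarrow> x" "(\<lambda>k. grid (Suc (\<phi> k)) (s (\<phi> k) i)) \<longlonglongrightarrow> x"
      using rs(1,2)[OF i] by (auto intro: near)
    have fl: "(\<lambda>k. f (grid (Suc (\<phi> k)) (r (\<phi> k) i)) i) \<longlonglongrightarrow> f x i" "(\<lambda>k. f (grid (Suc (\<phi> k)) (s (\<phi> k)
        i)) i) \<longlonglongrightarrow> f x i"
      using continuous_on_tendsto_compose[OF cont[OF i] lr(1) x(1)]
          continuous_on_tendsto_compose[OF cont[OF i] lr(2) x(1)]
        memb by auto
    have xl: "(\<lambda>k. grid (Suc (\<phi> k)) (r (\<phi> k) i) i) \<longlonglongrightarrow> x i" "(\<lambda>k. grid (Suc (\<phi> k)) (s (\<phi> k) i) i) \<longlonglongrightarrow> x i"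
      using lr by (simp_all add: tendsto_fun_iff)
    show "x i \<le> f x i" using LIMSEQ_le[OF xl(1) fl(1)] rs(3)[OF i] by blast
    show "f x i \<le> x i" using LIMSEQ_le[OF fl(2) xl(2)] rs(4)[OF i] by blast
  qed
  with x(1) show ?thesis by (rule that)
qed

text \<open>The identity is continuous both ways: off \<open>I\<close> every member of
  \<open>PiE I S\<close> has the constant value \<open>undefined\<close>, so these coordinates add
  no open sets. This moves spaces of histories and paths into a function type, where
  \<open>dist\<close> and uniform continuity are available.\<close>

lemma product_topology_top_of_set:
  fixes S :: "'i \<Rightarrow> 'a::topological_space set"
  shows "product_topology (\<lambda>i. top_of_set (S i)) I = top_of_set (PiE I S)"
proof -
  have 1: "continuous_map (top_of_set (PiE I S)) (product_topology (\<lambda>i. top_of_set (S i)) I) (\<lambda>x. x)"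
    unfolding continuous_map_componentwise
    by (auto intro!: continuous_on_subset[OF continuous_on_product_coordinates]
        simp: continuous_map_in_subtopology PiE_def)
  have "continuous_map (product_topology (\<lambda>i. top_of_set (S i)) I) (product_topology (\<lambda>_.
      euclidean) UNIV) (\<lambda>x. x)"
    unfolding continuous_map_componentwise
  proof (intro conjI ballI)
    fix k
    show "continuous_map (product_topology (\<lambda>i. top_of_set (S i)) I) euclidean (\<lambda>x. x k)"
    proof (cases "k \<in> I")
      case True
      from continuous_map_product_projection[OF this, of "\<lambda>i. top_of_set (S i)"] show ?thesis
        by (rule continuous_map_into_fulltopology)
    next
      case False
      have "continuous_map (product_topology (\<lambda>i. top_of_set (S i)) I) euclidean (\<lambda>x. undefined ::
          'a)" by simp
      then show ?thesis by (rule continuous_map_eq) (use False in \<open>auto simp: PiE_def extensional_def\<close>)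
    qed
  qed auto
  then have 2: "continuous_map (product_topology (\<lambda>i. top_of_set (S i)) I) (top_of_set (PiE I S))
      (\<lambda>x. x)"
    by (auto simp: euclidean_product_topology continuous_map_in_subtopology)
  show ?thesis
    unfolding topology_eq
  proof (intro allI iffI)
    fix U
    have sub: "U \<subseteq> PiE I S \<Longrightarrow> {x \<in> PiE I S. x \<in> U} = U" by blast
    show "openin (top_of_set (PiE I S)) U" if "openin (product_topology (\<lambda>i. top_of_set (S i)) I) U"
      using openin_continuous_map_preimage[OF 1 that] openin_subset[OF that] sub by simp
    show "openin (product_topology (\<lambda>i. top_of_set (S i)) I) U" if "openin (top_of_set (PiE I S)) U"
      using openin_continuous_map_preimage[OF 2 that] openin_subset[OF that] sub by simp
  qed
qed

lemma compact_PiE_fun: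
  fixes S :: "'i \<Rightarrow> 'a::topological_space set"
  assumes "\<And>i. i \<in> I \<Longrightarrow> compact (S i)"
  shows "compact (PiE I S)"
proof -
  have "compact_space (product_topology (\<lambda>i. top_of_set (S i)) I)"
    using assms by (auto simp: compact_space_product_topology compact_space_subtopology)
  then show ?thesis by (metis compactin_euclidean_iff compactin_subspace
      product_topology_top_of_set subset_UNIV topspace_euclidean)
qed

text \<open>\<open>dist\<close> on this type is a series of truncated coordinate distances with
  weights \<open>(1/2)^n\<close>; the weights dominate, so Tannery's theorem exchanges limit and
  sum.\<close>

lemma tendsto_dist_fun:
  fixes f g :: "'k \<Rightarrow> 'i::countable \<Rightarrow> 'a::metric_space"
  assumes "\<And>j. ((\<lambda>k. dist (f k j) (g k j)) \<longlongrightarrow> 0) F"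
  shows "((\<lambda>k. dist (f k) (g k)) \<longlongrightarrow> 0) F"
proof (cases "F = bot")
  case False
  have "((\<lambda>k. suminf (\<lambda>n. (1/2)^n * min (dist (f k (from_nat n)) (g k (from_nat n))) 1)) \<longlongrightarrow> suminf
      (\<lambda>n. 0)) F"
  proof (rule tannerys_theorem[where M = "\<lambda>n. (1/2)^n", THEN conjunct2, THEN conjunct2])
    show "((\<lambda>k. (1/2)^n * min (dist (f k (from_nat n)) (g k (from_nat n))) 1) \<longlongrightarrow> (0::real)) F" for n
      using tendsto_mult[OF tendsto_const[of "(1/2)^n"] tendsto_min[OF assms tendsto_const[of 1]]]
          by simp
  qed (use False in \<open>auto intro!: always_eventually\<close>)
  then show ?thesis by (simp add: dist_fun_def)
qed auto

lemma tendsto_dist_Pair: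
  assumes "((\<lambda>k. dist (a k) (b k)) \<longlongrightarrow> 0) F" "((\<lambda>k. dist (c k) (d k)) \<longlongrightarrow> 0) F"
  shows "((\<lambda>k. dist (a k, c k) (b k, d k)) \<longlongrightarrow> 0) F"
proof -
  have "((\<lambda>k. sqrt ((dist (a k) (b k))\<^sup>2 + (dist (c k) (d k))\<^sup>2)) \<longlongrightarrow> sqrt (0\<^sup>2 + 0\<^sup>2)) F"
    by (intro tendsto_intros assms)
  then show ?thesis by (simp add: dist_Pair_Pair)
qed

section \<open>Limits under equicontinuous families\<close>

text \<open>The index \<open>i k\<close> may move with \<open>k\<close>. This is how uniformity over
  decision makers, or over strategies, enters the later limits.\<close>

lemma uniformly_equicontinuous_tendsto:
  assumes "uniformly_equicontinuous I A f"
    and "\<forall>\<^sub>F k in F. i k \<in> I \<and> a k \<in> A (i k) \<and> b k \<in> A (i k)"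
    and "((\<lambda>k. dist (a k) (b k)) \<longlongrightarrow> 0) F"
  shows "((\<lambda>k. dist (f (i k) (a k)) (f (i k) (b k))) \<longlongrightarrow> 0) F"
proof (rule tendstoI)
  fix e :: real assume "e > 0"
  then obtain \<delta> where \<delta>: "\<delta> > 0" "\<forall>i\<in>I. \<forall>a\<in>A i. \<forall>b\<in>A i. dist a b < \<delta> \<longrightarrow> dist (f i a) (f i b) < e"
    using assms(1) unfolding uniformly_equicontinuous_def by blast
  from tendstoD[OF assms(3) \<delta>(1)] assms(2)
  show "\<forall>\<^sub>F k in F. dist (dist (f (i k) (a k)) (f (i k) (b k))) 0 < e"
    by eventually_elim (use \<delta>(2) in auto)
qed

lemma uniformly_equicontinuous_compact:
  assumes "compact K" "continuous_on K f"
  shows "uniformly_equicontinuous I (\<lambda>_. K) (\<lambda>_. f)"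
  using compact_uniformly_continuous[OF assms(2,1)]
  unfolding uniformly_equicontinuous_def uniformly_continuous_on_def by (metis dist_commute)

lemma compact_continuous_tendsto:
  assumes "compact K" "continuous_on K f"
    and "\<forall>\<^sub>F k in F. a k \<in> K \<and> b k \<in> K"
    and "((\<lambda>k. dist (a k) (b k)) \<longlongrightarrow> 0) F"
  shows "((\<lambda>k. dist (f (a k)) (f (b k))) \<longlongrightarrow> 0) F"
  using uniformly_equicontinuous_tendsto[OF uniformly_equicontinuous_compact[OF assms(1,2), of
      "{()}"], of "\<lambda>_. ()" a b F]
    assms(3,4) by auto

text \<open>Greedy selection: some index in the support increases the squared error by at most the
  average increase, in which the cross terms cancel.\<close>

lemma Maurey_selection:
  fixes v :: "'i \<Rightarrow> 'l \<Rightarrow> 't \<Rightarrow> 'a::real_inner" and R :: real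
  assumes "finite I" "finite L" "finite T"
    and lam: "\<And>l. l \<in> L \<Longrightarrow> 0 \<le> lam l" "sum lam L = 1"
    and R: "\<And>i l t. i \<in> I \<Longrightarrow> l \<in> L \<Longrightarrow> t \<in> T \<Longrightarrow> norm (v i l t) \<le> R"
  shows "\<exists>\<kappa>. (\<forall>i\<in>I. \<kappa> i \<in> L \<and> 0 < lam (\<kappa> i)) \<and>
    (\<Sum>t\<in>T. (norm (\<Sum>i\<in>I. v i (\<kappa> i) t - (\<Sum>l\<in>L. lam l *\<^sub>R v i l t)))\<^sup>2) \<le> card I * card T * (2 * R)\<^sup>2"
  using \<open>finite I\<close> R
proof (induction I)
  case empty
  then show ?case by simp
next
  case (insert i I)
  then obtain \<kappa> where \<kappa>: "\<forall>i\<in>I. \<kappa> i \<in> L \<and> 0 < lam (\<kappa> i)"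
    "(\<Sum>t\<in>T. (norm (\<Sum>i\<in>I. v i (\<kappa> i) t - (\<Sum>l\<in>L. lam l *\<^sub>R v i l t)))\<^sup>2) \<le> card I * card T * (2 * R)\<^sup>2"
    by auto
  define S where "S t = (\<Sum>i\<in>I. v i (\<kappa> i) t - (\<Sum>l\<in>L. lam l *\<^sub>R v i l t))" for t
  define m where "m t = (\<Sum>l\<in>L. lam l *\<^sub>R v i l t)" for t
  define q where "q l = (\<Sum>t\<in>T. (norm (S t + (v i l t - m t)))\<^sup>2)" for l
  have norm_m: "norm (m t) \<le> R" if "t \<in> T" for t
  proof -
    have "norm (m t) \<le> (\<Sum>l\<in>L. lam l * R)" unfolding m_def
      using lam(1) insert.prems that by (intro sum_norm_le) (auto intro!: mult_left_mono)
    then show ?thesis using lam(2) by (simp flip: sum_distrib_right)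
  qed
  have mean: "(\<Sum>l\<in>L. lam l *\<^sub>R (v i l t - m t)) = 0" for t
    using lam(2) by (simp add: m_def scaleR_right_diff_distrib sum_subtractf flip: scaleR_sum_left)
  have "(\<Sum>l\<in>L. lam l * q l) \<le> (\<Sum>t\<in>T. (norm (S t))\<^sup>2) + card T * (2 * R)\<^sup>2"
  proof -
    have "(\<Sum>l\<in>L. lam l * q l) = (\<Sum>t\<in>T. \<Sum>l\<in>L. lam l * (norm (S t + (v i l t - m t)))\<^sup>2)"
      unfolding q_def sum_distrib_left by (rule sum.swap)
    also have "\<dots> = (\<Sum>t\<in>T. (norm (S t))\<^sup>2 + (\<Sum>l\<in>L. lam l * (norm (v i l t - m t))\<^sup>2))"
    proof (rule sum.cong[OF refl])
      fix t
      have "(\<Sum>l\<in>L. lam l * (norm (S t + (v i l t - m t)))\<^sup>2)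
        = (\<Sum>l\<in>L. lam l * (norm (S t))\<^sup>2 + 2 * (S t \<bullet> (lam l *\<^sub>R (v i l t - m t))) + lam l * (norm
            (v i l t - m t))\<^sup>2)"
        by (rule sum.cong[OF refl]) (simp add: power2_norm_eq_inner inner_add_left inner_add_right
            inner_commute algebra_simps)
      also have "\<dots> = (\<Sum>l\<in>L. lam l) * (norm (S t))\<^sup>2 + 2 * (S t \<bullet> (\<Sum>l\<in>L. lam l *\<^sub>R (v i l t - m t)))
         + (\<Sum>l\<in>L. lam l * (norm (v i l t - m t))\<^sup>2)"
        by (simp only: sum.distrib sum_distrib_right inner_sum_right sum_distrib_left)
      finally show "(\<Sum>l\<in>L. lam l * (norm (S t + (v i l t - m t)))\<^sup>2) = (norm (S t))\<^sup>2 + (\<Sum>l\<in>L. lam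
          l * (norm (v i l t - m t))\<^sup>2)"
        by (simp add: mean lam(2))
    qed
    also have "\<dots> \<le> (\<Sum>t\<in>T. (norm (S t))\<^sup>2 + (2 * R)\<^sup>2)"
    proof (intro sum_mono add_left_mono)
      fix t assume t: "t \<in> T"
      have "(\<Sum>l\<in>L. lam l * (norm (v i l t - m t))\<^sup>2) \<le> (\<Sum>l\<in>L. lam l * (2 * R)\<^sup>2)"
      proof (intro sum_mono mult_left_mono power_mono)
        fix l assume "l \<in> L"
        then show "norm (v i l t - m t) \<le> 2 * R"
          using norm_m[OF t] insert.prems[of i l t] t norm_triangle_ineq4[of "v i l t" "m t"] by simp
      qed (use lam in auto)
      then show "(\<Sum>l\<in>L. lam l * (norm (v i l t - m t))\<^sup>2) \<le> (2 * R)\<^sup>2"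
        using lam(2) by (simp flip: sum_distrib_right)
    qed
    finally show ?thesis by (simp add: sum.distrib)
  qed
  also have "\<dots> \<le> card I * card T * (2 * R)\<^sup>2 + card T * (2 * R)\<^sup>2" using \<kappa>(2) by (simp add: S_def)
  finally have avg: "(\<Sum>l\<in>L. lam l * q l) \<le> card (insert i I) * card T * (2 * R)\<^sup>2"
    using insert.hyps by (simp add: algebra_simps)
  \<comment> \<open>Were \<open>q\<close> above the bound on the whole support, its average would be
    too. Confining the choice to the support matters later, where only strategies of positive weight
    are known to be nearly optimal.\<close>
  have "\<exists>l\<in>L. 0 < lam l \<and> q l \<le> card (insert i I) * card T * (2 * R)\<^sup>2"
  proof (rule ccontr)
    let ?B = "card (insert i I) * card T * (2 * R)\<^sup>2"
    assume "\<not> ?thesis"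
    then have le: "0 < lam l \<Longrightarrow> ?B < q l" if "l \<in> L" for l using that by (meson not_le)
    obtain l0 where l0: "l0 \<in> L" "0 < lam l0"
      using lam by (metis less_eq_real_def sum.neutral zero_neq_one)
    have "(\<Sum>l\<in>L. lam l * ?B) < (\<Sum>l\<in>L. lam l * q l)"
    proof (rule sum_strict_mono_ex1[OF \<open>finite L\<close>])
      show "\<forall>l\<in>L. lam l * ?B \<le> lam l * q l"
        using le lam(1) by (metis less_eq_real_def mult_left_mono mult_zero_left order_refl)
      show "\<exists>l\<in>L. lam l * ?B < lam l * q l"
        using l0 le by (intro bexI[of _ l0] mult_strict_left_mono)
    qed
    then show False using avg lam(2) by (simp flip: sum_distrib_right)
  qed
  then obtain l where l: "l \<in> L" "0 < lam l" "q l \<le> card (insert i I) * card T * (2 * R)\<^sup>2" by blast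
  have upd: "(\<Sum>j\<in>insert i I. v j ((\<kappa>(i := l)) j) t - (\<Sum>l\<in>L. lam l *\<^sub>R v j l t)) = S t + (v i l t -
      m t)" for t
  proof -
    have "(\<Sum>j\<in>I. v j ((\<kappa>(i := l)) j) t - (\<Sum>l\<in>L. lam l *\<^sub>R v j l t)) = S t"
      unfolding S_def using insert.hyps(2) by (intro sum.cong) auto
    then show ?thesis using insert.hyps by (simp add: m_def)
  qed
  show ?case
  proof (intro exI[of _ "\<kappa>(i := l)"] conjI)
    show "\<forall>j\<in>insert i I. (\<kappa>(i := l)) j \<in> L \<and> 0 < lam ((\<kappa>(i := l)) j)" using \<kappa>(1) l by simp
    show "(\<Sum>t\<in>T. (norm (\<Sum>j\<in>insert i I. v j ((\<kappa>(i := l)) j) t - (\<Sum>l\<in>L. lam l *\<^sub>R v j l t)))\<^sup>2)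
      \<le> card (insert i I) * card T * (2 * R)\<^sup>2"
      unfolding upd using l(3) by (simp only: q_def)
  qed
qed

subsection \<open>Dynamics\<close>

lemma dm_state_0 [simp]: "dm_state G i s a v z 0 = a"
  by (simp add: dm_state_def)

text \<open>Replaces the recursively updated pair by restrictions of two trajectories, so that later
  inductions concern states and controls only. The value \<open>undefined\<close> off the recorded
  times is exactly what \<open>restrict\<close> gives.\<close>

lemma dm_history_eq:
  "dm_history G i s a v z t =
     (restrict (dm_state G i s a v z) {..t}, restrict (dm_control G i s a v z) {..<t})"
proof (induction t)
  case 0
  show ?case by (auto simp: restrict_def)
next
  case (Suc t)
  let ?h = "dm_history G i s a v z t"
  have "dm_history G i s a v z (Suc t) =
      ((fst ?h)(Suc t := dm_step G i t (fst ?h t, dm_control G i s a v z t, z t, v t)),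
       (snd ?h)(t := dm_control G i s a v z t))"
    by (simp add: dm_control_def Let_def split: prod.split)
  moreover from this have "dm_state G i s a v z (Suc t) =
      dm_step G i t (fst ?h t, dm_control G i s a v z t, z t, v t)"
    by (simp add: dm_state_def)
  ultimately show ?case
    by (auto simp: Suc restrict_def fun_eq_iff)
qed

lemma dm_state_Suc:
  "dm_state G i s a v z (Suc t) =
     dm_step G i t (dm_state G i s a v z t, dm_control G i s a v z t, z t, v t)"
  by (simp add: dm_state_def[of _ _ _ _ _ _ "Suc t"] Let_def dm_control_def split: prod.split)
     (simp add: dm_history_eq)

lemma dm_control_eq:
  "dm_control G i s a v z t =
     s t ((restrict (dm_state G i s a v z) {..t}, restrict (dm_control G i s a v z) {..<t}),
         restrict z {..<t})"
  by (simp add: dm_control_def[of _ _ _ _ _ _ t] dm_history_eq)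

text \<open>Non-anticipation. It yields the fixed point form of the environment path and allows
  disturbances to be altered off \<open>stages G\<close>.\<close>

lemma dm_history_cong:
  assumes "\<And>k. k < t \<Longrightarrow> z k = z' k \<and> v k = v' k"
  shows "dm_history G i s a v z t = dm_history G i s a v' z' t"
  using assms
proof (induction t)
  case (Suc t)
  have "restrict z {..<t} = restrict z' {..<t}" using Suc.prems by (intro restrict_ext) auto
  then show ?case using Suc by simp
qed simp

lemma dm_state_cong:
  assumes "\<And>k. k < t \<Longrightarrow> z k = z' k \<and> v k = v' k"
  shows "dm_state G i s a v z t = dm_state G i s a v' z' t"
proof -
  have "dm_history G i s a v z t = dm_history G i s a v' z' t" using assms by (rule dm_history_cong)
  then show ?thesis by (simp add: dm_state_def)
qed

lemma dm_control_cong: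
  assumes "\<And>k. k < t \<Longrightarrow> z k = z' k \<and> v k = v' k"
  shows "dm_control G i s a v z t = dm_control G i s a v' z' t"
proof -
  have "restrict z {..<t} = restrict z' {..<t}" using assms by (intro restrict_ext) auto
  moreover have "dm_history G i s a v z t = dm_history G i s a v' z' t" using assms by (rule
      dm_history_cong)
  ultimately show ?thesis by (simp add: dm_control_def)
qed

lemma stages_downward: "t \<in> stages G \<Longrightarrow> j \<le> t \<Longrightarrow> j \<in> stages G"
  by (auto simp: stages_def) (meson enat_ord_simps(1) order_le_less_trans)


text \<open>A feedback rule \<open>A\<close> prescribes the aggregate at time \<open>t\<close> given the environment variables before
  \<open>t\<close>. Both the realized and the mean-field environment arise from such a rule.\<close>

primrec feedback_orbit where
  "feedback_orbit G A 0 = (\<lambda>_. undefined, env_init G)"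
| "feedback_orbit G A (Suc t) =
     (let (ys, e) = feedback_orbit G A t; d = A t ys
      in (ys(t := env_out G t (e, d)), env_step G t (e, d)))"

definition feedback_path where
  "feedback_path G A = (\<lambda>t\<in>stages G. fst (feedback_orbit G A (Suc t)) t)"

text \<open>Open-loop counterpart of \<open>feedback_orbit\<close>: the aggregates \<open>d\<close>
  are prescribed, so that two environments can be compared through their inputs alone.\<close>

primrec driven_state where
  "driven_state G d 0 = env_init G"
| "driven_state G d (Suc t) = env_step G t (driven_state G d t, d t)"

definition driven_path where
  "driven_path G d = (\<lambda>t\<in>stages G. env_out G t (driven_state G d t, d t))"

text \<open>Entries of the orbit are never overwritten, so a non-anticipating rule returns the same
  aggregate on the partial path as on the complete one. The recursion thus becomes a fixed point
  equation for the path.\<close>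

lemma feedback_path_eq_driven_path:
  assumes "\<And>t z z'. (\<And>j. j < t \<Longrightarrow> z j = z' j) \<Longrightarrow> A t z = A t z'"
  shows "feedback_path G A = driven_path G (\<lambda>t. A t (feedback_path G A))"
proof -
  define P where "P = feedback_path G A"
  have *: "snd (feedback_orbit G A t) = driven_state G (\<lambda>t. A t P) t \<and>
      (\<forall>j<t. fst (feedback_orbit G A t) j = P j)" if "{..<t} \<subseteq> stages G" for t
    using that
  proof (induction t)
    case (Suc t)
    then have sub: "{..<t} \<subseteq> stages G" and t: "t \<in> stages G" by auto
    have IH: "snd (feedback_orbit G A t) = driven_state G (\<lambda>t. A t P) t"
      "\<And>j. j < t \<Longrightarrow> fst (feedback_orbit G A t) j = P j"
      using Suc.IH[OF sub] by simp_all
    have A: "A t (fst (feedback_orbit G A t)) = A t P" using IH(2) by (rule assms)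
    have "P t = fst (feedback_orbit G A (Suc t)) t" using t by (simp add: P_def feedback_path_def)
    then show ?case using IH A by (auto simp: Let_def less_Suc_eq split: prod.split)
  qed simp
  have "P t = env_out G t (driven_state G (\<lambda>t. A t P) t, A t P)" if t: "t \<in> stages G" for t
  proof -
    have "{..<t} \<subseteq> stages G" using stages_downward[OF t] by auto
    note * = *[OF this]
    then have "A t (fst (feedback_orbit G A t)) = A t P" by (intro assms) simp
    moreover have "P t = fst (feedback_orbit G A (Suc t)) t" using t by (simp add: P_def
        feedback_path_def)
    ultimately show ?thesis using * by (auto simp: Let_def split: prod.split)
  qed
  moreover have "P \<in> extensional (stages G)" by (simp add: P_def feedback_path_def)
  ultimately have "P = driven_path G (\<lambda>t. A t P)"
    by (auto simp: driven_path_def extensional_def fun_eq_iff)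
  then show ?thesis by (simp add: P_def)
qed

definition population_aggregate where
  "population_aggregate G N s \<omega> t z =
     aggr G N t
      (\<lambda>j\<in>{1..N}. dm_state G j (s j) (init_state G j \<omega>) (\<lambda>k. noise G j k \<omega>) z t)
      (\<lambda>j\<in>{1..N}. dm_control G j (s j) (init_state G j \<omega>) (\<lambda>k. noise G j k \<omega>) z t)"

lemma env_path_eq_feedback_path: "env_path G N s \<omega> = feedback_path G (population_aggregate G N s \<omega>)"
proof -
  have "env_history G N s \<omega> t = feedback_orbit G (population_aggregate G N s \<omega>) t" for t
    by (induction t) (simp_all add: population_aggregate_def Let_def split: prod.split)
  then show ?thesis by (simp only: env_path_def feedback_path_def)
qed

lemma population_aggregate_cong:
  assumes "\<And>j. j < t \<Longrightarrow> z j = z' j"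
  shows "population_aggregate G N s \<omega> t z = population_aggregate G N s \<omega> t z'"
proof -
  have "dm_state G j (s j) (init_state G j \<omega>) (\<lambda>k. noise G j k \<omega>) z t =
        dm_state G j (s j) (init_state G j \<omega>) (\<lambda>k. noise G j k \<omega>) z' t"
    "dm_control G j (s j) (init_state G j \<omega>) (\<lambda>k. noise G j k \<omega>) z t =
        dm_control G j (s j) (init_state G j \<omega>) (\<lambda>k. noise G j k \<omega>) z' t" for j
    by (intro dm_state_cong dm_control_cong; simp add: assms)+
  then show ?thesis unfolding population_aggregate_def by presburger
qed

lemma env_path_eq_driven_path:
  "env_path G N s \<omega> = driven_path G (\<lambda>t. population_aggregate G N s \<omega> t (env_path G N s \<omega>))"
  unfolding env_path_eq_feedback_path
  by (rule feedback_path_eq_driven_path) (rule population_aggregate_cong)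

section \<open>Measurability and averages\<close>

lemma borel_measurable_continuous_on_compose:
  assumes "continuous_on K f" "g \<in> borel_measurable N" "\<And>\<omega>. \<omega> \<in> space N \<Longrightarrow> g \<omega> \<in> K"
  shows "(\<lambda>\<omega>. f (g \<omega>)) \<in> borel_measurable N"
proof (rule measurable_compose[OF _ borel_measurable_continuous_on_restrict[OF assms(1)]])
  show "g \<in> N \<rightarrow>\<^sub>M restrict_space borel K"
    using assms(2,3) by (intro measurable_restrict_space2) auto
qed

lemma space_borel_of [simp]: "space (borel_of \<tau>) = topspace \<tau>"
  and sets_borel_of: "sets (borel_of \<tau>) = sigma_sets (topspace \<tau>) {A. openin \<tau> A}"
  unfolding borel_of_def by (auto intro!: space_measure_of sets_measure_of dest: openin_subset)

lemma borel_measurable_borel_of: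
  fixes f :: "'a \<Rightarrow> 'b::topological_space"
  assumes "continuous_map \<tau> euclidean f"
  shows "f \<in> borel_measurable (borel_of \<tau>)"
proof (rule borel_measurableI)
  fix A :: "'b set" assume "open A"
  then have "openin \<tau> {x \<in> topspace \<tau>. f x \<in> A}"
    using openin_continuous_map_preimage[OF assms, of A] by simp
  moreover have "f -` A \<inter> space (borel_of \<tau>) = {x \<in> topspace \<tau>. f x \<in> A}" by auto
  ultimately show "f -` A \<inter> space (borel_of \<tau>) \<in> sets (borel_of \<tau>)"
    by (simp add: sets_borel_of)
qed

lemma measurable_borel_of_top_of_set:
  assumes "g \<in> borel_measurable N" "\<And>\<omega>. \<omega> \<in> space N \<Longrightarrow> g \<omega> \<in> K"
  shows "g \<in> N \<rightarrow>\<^sub>M borel_of (top_of_set K)"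
  unfolding borel_of_def
proof (rule measurable_sigma_sets)
  show "sets (sigma (topspace (top_of_set K)) {A. openin (top_of_set K) A}) =
      sigma_sets (topspace (top_of_set K)) {A. openin (top_of_set K) A}"
    by (rule sets_measure_of) (auto dest: openin_imp_subset)
  show "{A. openin (top_of_set K) A} \<subseteq> Pow (topspace (top_of_set K))" by (auto dest: openin_imp_subset)
  show "g \<in> space N \<rightarrow> topspace (top_of_set K)" using assms(2) by simp
  fix A assume "A \<in> {A. openin (top_of_set K) A}"
  then obtain B where B: "open B" "A = K \<inter> B" unfolding openin_open by blast
  then have "g -` A \<inter> space N = g -` B \<inter> space N" using assms(2) by blast
  then show "g -` A \<inter> space N \<in> sets N" using measurable_sets[OF assms(1), of B] B(1) by simp
qed

text \<open>A hyperplane strictly separating the mean from \<open>C\<close> would contradict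
  monotonicity of the integral of its functional.\<close>

lemma (in prob_space) expectation_in_closed_convex:
  fixes f :: "'a \<Rightarrow> 'b::euclidean_space"
  assumes int: "integrable M f" and C: "convex C" "closed C" and f: "\<And>\<omega>. \<omega> \<in> space M \<Longrightarrow> f \<omega> \<in> C"
  shows "(LINT \<omega>|M. f \<omega>) \<in> C"
proof (rule ccontr)
  assume "(LINT \<omega>|M. f \<omega>) \<notin> C"
  from separating_hyperplane_closed_point[OF C this] obtain a b where
    ab: "a \<bullet> (LINT \<omega>|M. f \<omega>) < b" "\<forall>x\<in>C. b < a \<bullet> x" by blast
  have "(LINT \<omega>|M. b) \<le> (LINT \<omega>|M. a \<bullet> f \<omega>)"
    using int ab(2) f by (intro integral_mono) (auto intro: less_imp_le)
  then show False using ab(1) int by (simp add: prob_space)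
qed

lemma dist_average_le:
  fixes a b :: "nat \<Rightarrow> 'a::real_normed_vector"
  assumes "1 \<le> N" "\<And>i. i \<in> {1..N} \<Longrightarrow> dist (a i) (b i) \<le> e"
  shows "dist ((1 / real N) *\<^sub>R (\<Sum>i\<in>{1..N}. a i)) ((1 / real N) *\<^sub>R (\<Sum>i\<in>{1..N}. b i)) \<le> e"
proof -
  have "norm (\<Sum>i\<in>{1..N}. a i - b i) \<le> real N * e"
    using sum_norm_le[of "{1..N}" "\<lambda>i. a i - b i" "\<lambda>_. e"] assms(2) by (simp add: dist_norm)
  then have "norm (\<Sum>i\<in>{1..N}. a i - b i) / real N \<le> e"
    using assms(1) by (simp add: field_simps)
  moreover have "(1 / real N) *\<^sub>R (\<Sum>i\<in>{1..N}. a i) - (1 / real N) *\<^sub>R (\<Sum>i\<in>{1..N}. b i)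
      = (1 / real N) *\<^sub>R (\<Sum>i\<in>{1..N}. a i - b i)"
    by (simp add: sum_subtractf scaleR_right_diff_distrib)
  ultimately show ?thesis by (simp add: dist_norm)
qed

lemma uniformly_equicontinuous_cong:
  assumes "\<And>i. i \<in> I \<Longrightarrow> A i = B i"
  shows "uniformly_equicontinuous I A f = uniformly_equicontinuous I B f"
  using assms unfolding uniformly_equicontinuous_def by (simp cong: ball_cong)

lemma tendsto_diff_zero_iff_dist: "((\<lambda>k. f k - g k) \<longlongrightarrow> (0::real)) F \<longleftrightarrow> ((\<lambda>k. dist (f k) (g k)) \<longlongrightarrow> 0) F"
  using tendsto_rabs_zero_iff[of "\<lambda>k. f k - g k" F] by (simp add: dist_real_def)

lemma eventually_inverse_less: "e > 0 \<Longrightarrow> \<forall>\<^sub>F n in sequentially. j < n \<and> 1 / real (Suc n) < e"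
  using order_tendstoD(2)[OF LIMSEQ_inverse_real_of_nat, of e]
  by (auto intro!: eventually_conj eventually_gt_at_top simp: inverse_eq_divide)

subsection \<open>Compactness and equicontinuity\<close>

text \<open>Second countability makes Borel measurability of tuples and of sequences a matter of
  coordinates.\<close>

locale mean_field_game =
  fixes G :: "(real ^ 'n, real ^ 'm, 'w::{metric_space, second_countable_topology},
      'y::{metric_space, second_countable_topology},
      'e::{metric_space, second_countable_topology},
      (real ^ 'n) \<times> (real ^ 'm), 'p) game_seq"
  assumes game_seq: "game_sequence G" and A1: "cond_A1 G" and A3: "cond_A3 G"
    and B1: "cond_B1 G" and B2: "cond_B2 G"
begin

definition "X = states G 1"
definition "U = controls G 1"
definition "W = disturbances G 1"
abbreviation "Y \<equiv> env_vars G"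
definition "S = strategies G 1"
abbreviation "T \<equiv> stages G"
abbreviation "Z \<equiv> PiE T (\<lambda>_. Y)"
abbreviation "M \<equiv> sample G"
abbreviation "D \<equiv> aggregates G"
abbreviation "E \<equiv> env_states G"
abbreviation "dtop \<equiv> decision_top G 1"
abbreviation "hist t \<equiv> (PiE {..t} (\<lambda>_. X) \<times> PiE {..<t} (\<lambda>_. U)) \<times> PiE {..<t} (\<lambda>_. Y)"

lemma A1_parts:
  "compact E" "E \<noteq> {}" "compact Y" "Y \<noteq> {}"
  "\<forall>i\<ge>1. compact (states G i) \<and> states G i \<noteq> {} \<and> compact (controls G i) \<and> controls G i \<noteq> {} \<and>
     compact (disturbances G i) \<and> disturbances G i \<noteq> {}"
  "\<forall>i\<ge>1. \<forall>t\<in>T. continuous_on (states G i \<times> controls G i \<times> Y) (stage_cost G i t) \<and>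
     continuous_on (states G i \<times> controls G i \<times> Y \<times> disturbances G i) (dm_step G i t)"
  "\<forall>i\<ge>1. continuous_on (states G i) (final_cost G i)"
  "\<forall>t\<in>T. continuous_on (E \<times> D) (env_step G t) \<and> continuous_on (E \<times> D) (env_out G t)"
  "\<forall>i\<ge>1. \<exists>St. strategies G i = PiE T St \<and>
     (\<forall>t\<in>T. St t \<noteq> {} \<and> compactin (decision_top G i t) (St t))"
  "\<forall>i\<ge>1. states G i = states G 1 \<and> controls G i = controls G 1 \<and>
     disturbances G i = disturbances G 1 \<and> strategies G i = strategies G 1"
  "\<forall>t\<in>T. uniformly_equicontinuous {1..} (\<lambda>i. states G i \<times> controls G i \<times> Y) (\<lambda>i. stage_cost G i t) \<and>
     uniformly_equicontinuous {1..} (\<lambda>i. states G i \<times> controls G i \<times> Y \<times> disturbances G i) (\<lambda>i.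
         dm_step G i t)"
  "uniformly_equicontinuous {1..} (states G) (final_cost G)"
  "\<exists>C. (\<forall>i\<ge>1. \<forall>t\<in>T. \<forall>a\<in>states G i \<times> controls G i \<times> Y. \<bar>stage_cost G i t a\<bar> \<le> C) \<and>
     (\<forall>i\<ge>1. \<forall>x\<in>states G i. \<bar>final_cost G i x\<bar> \<le> C)"
  "\<exists>b<1. \<forall>i\<ge>1. disc G i \<le> b"
  using A1 unfolding cond_A1_def by - (elim conjE, assumption)+

lemma game_parts:
  "compact D" "env_init G \<in> E"
  "\<forall>t\<in>T. env_step G t \<in> E \<times> D \<rightarrow> E \<and> env_out G t \<in> E \<times> D \<rightarrow> Y"
  "\<forall>i\<ge>1. \<forall>t\<in>T. dm_step G i t \<in> states G i \<times> controls G i \<times> Y \<times> disturbances G i \<rightarrow> states G i"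
  "\<forall>N\<ge>1. \<forall>t\<in>T. \<forall>x\<in>PiE {1..N} (states G). \<forall>u\<in>PiE {1..N} (controls G). aggr G N t x u \<in> D"
  "\<forall>i\<ge>1. 0 < disc G i \<and> disc G i \<le> 1 \<and> (horizon G = \<infinity> \<longrightarrow> disc G i < 1)"
  "prob_space M"
  "\<forall>i\<ge>1. init_state G i \<in> M \<rightarrow>\<^sub>M restrict_space borel (states G i)"
  "\<forall>i\<ge>1. \<forall>t\<in>T. noise G i t \<in> M \<rightarrow>\<^sub>M restrict_space borel (disturbances G i)"
  using game_seq unfolding game_sequence_def by - (elim conjE, assumption)+

lemma same_spaces [simp]:
  assumes "1 \<le> i"
  shows "states G i = X" "controls G i = U" "disturbances G i = W" "strategies G i = S"
  unfolding X_def U_def W_def S_def using A1_parts(10) assms by blast+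

lemma compact_spaces:
  "compact X" "compact U" "compact W" "compact Y" "compact E" "compact D"
  "X \<noteq> {}" "U \<noteq> {}" "W \<noteq> {}" "Y \<noteq> {}" "E \<noteq> {}"
  using A1_parts(1-4) spec[OF A1_parts(5), of 1] game_parts(1) by simp_all

lemma env_maps:
  assumes "t \<in> T"
  shows "continuous_on (E \<times> D) (env_step G t)" "continuous_on (E \<times> D) (env_out G t)"
    "env_step G t \<in> E \<times> D \<rightarrow> E" "env_out G t \<in> E \<times> D \<rightarrow> Y"
  using A1_parts(8) game_parts(3) assms by blast+

lemma dm_maps:
  assumes "1 \<le> i" "t \<in> T"
  shows "continuous_on (X \<times> U \<times> Y) (stage_cost G i t)"
    "continuous_on (X \<times> U \<times> Y \<times> W) (dm_step G i t)"
    "dm_step G i t \<in> X \<times> U \<times> Y \<times> W \<rightarrow> X"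
  using A1_parts(6)[rule_format, OF assms] game_parts(4)[rule_format, OF assms] assms(1) by simp_all

lemma final_cost_cont: "1 \<le> i \<Longrightarrow> continuous_on X (final_cost G i)"
  using A1_parts(7)[rule_format, of i] by simp

lemma dm_equicontinuous:
  shows "t \<in> T \<Longrightarrow> uniformly_equicontinuous {1..} (\<lambda>_. X \<times> U \<times> Y) (\<lambda>i. stage_cost G i t)"
    and "t \<in> T \<Longrightarrow> uniformly_equicontinuous {1..} (\<lambda>_. X \<times> U \<times> Y \<times> W) (\<lambda>i. dm_step G i t)"
    and "uniformly_equicontinuous {1..} (\<lambda>_. X) (final_cost G)"
proof -
  show "t \<in> T \<Longrightarrow> uniformly_equicontinuous {1..} (\<lambda>_. X \<times> U \<times> Y) (\<lambda>i. stage_cost G i t)"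
    using A1_parts(11) by (subst uniformly_equicontinuous_cong[of _ _ "\<lambda>i. states G i \<times> controls G
        i \<times> Y"]) auto
  show "t \<in> T \<Longrightarrow> uniformly_equicontinuous {1..} (\<lambda>_. X \<times> U \<times> Y \<times> W) (\<lambda>i. dm_step G i t)"
    using A1_parts(11)
    by (subst uniformly_equicontinuous_cong[of _ _ "\<lambda>i. states G i \<times> controls G i \<times> Y \<times>
        disturbances G i"]) auto
  show "uniformly_equicontinuous {1..} (\<lambda>_. X) (final_cost G)"
    using A1_parts(12) by (subst uniformly_equicontinuous_cong[of _ _ "states G"]) auto
qed

lemma cost_bounds:
  obtains C where "0 \<le> C"
    "\<And>i t a. 1 \<le> i \<Longrightarrow> t \<in> T \<Longrightarrow> a \<in> X \<times> U \<times> Y \<Longrightarrow> \<bar>stage_cost G i t a\<bar> \<le> C"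
    "\<And>i x. 1 \<le> i \<Longrightarrow> x \<in> X \<Longrightarrow> \<bar>final_cost G i x\<bar> \<le> C"
proof -
  obtain C where C: "\<forall>i\<ge>1. \<forall>t\<in>T. \<forall>a\<in>states G i \<times> controls G i \<times> Y. \<bar>stage_cost G i t a\<bar> \<le> C"
    "\<forall>i\<ge>1. \<forall>x\<in>states G i. \<bar>final_cost G i x\<bar> \<le> C"
    using A1_parts(13) by blast
  have le: "\<bar>stage_cost G i t a\<bar> \<le> \<bar>C\<bar>" if "1 \<le> i" "t \<in> T" "a \<in> X \<times> U \<times> Y" for i t a
  proof -
    have "a \<in> states G i \<times> controls G i \<times> Y" using that by simp
    then have "\<bar>stage_cost G i t a\<bar> \<le> C" using C(1) that(1,2) by blast
    then show ?thesis by simp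
  qed
  have le': "\<bar>final_cost G i x\<bar> \<le> \<bar>C\<bar>" if "1 \<le> i" "x \<in> X" for i x
  proof -
    have "x \<in> states G i" using that by simp
    then have "\<bar>final_cost G i x\<bar> \<le> C" using C(2) that(1) by blast
    then show ?thesis by simp
  qed
  show ?thesis by (rule that[OF abs_ge_zero le le'])
qed

lemma disc_bounds:
  obtains b where "b < 1" "0 < b" "\<And>i. 1 \<le> i \<Longrightarrow> 0 < disc G i \<and> disc G i \<le> b"
proof -
  obtain b where "b < 1" "\<forall>i\<ge>1. disc G i \<le> b" using A1_parts(14) by blast
  moreover have pos: "\<forall>i\<ge>1. 0 < disc G i" using game_parts(6) by blast
  moreover from calculation have "0 < b" by (meson order_less_le_trans order_refl)
  ultimately show ?thesis using that[of b] by blast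
qed

lemma compact_hist: "compact (hist t)"
  by (intro compact_Times compact_PiE_fun compact_spaces)

lemma history_top_eq: "1 \<le> i \<Longrightarrow> history_top G i t = top_of_set (hist t)"
  by (simp add: history_top_def product_topology_top_of_set)

lemma path_top_eq: "path_top G = top_of_set Z"
  by (simp add: path_top_def product_topology_top_of_set)

lemma strategies_product:
  obtains St where "S = PiE T St" "\<And>t. t \<in> T \<Longrightarrow> St t \<noteq> {}"
    "\<And>t. t \<in> T \<Longrightarrow> compactin (dtop t) (St t)"
proof -
  have "\<exists>St. S = PiE T St \<and> (\<forall>t\<in>T. St t \<noteq> {} \<and> compactin (dtop t) (St t))"
    unfolding S_def by (rule A1_parts(9)[rule_format, OF order_refl])
  then obtain St where "S = PiE T St" "\<forall>t\<in>T. St t \<noteq> {} \<and> compactin (dtop t) (St t)" by (elim exE conjE)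
  then show ?thesis by (intro that[of St]) simp_all
qed

abbreviation "decision_metric t \<equiv> cfunspace (history_top G 1 t) (submetric euclidean_metric U)"

lemma decision_metric_dist:
  assumes "f \<in> mspace (decision_metric t)" "g \<in> mspace (decision_metric t)" "h \<in> hist t"
  shows "dist (f h) (g h) \<le> mdist (decision_metric t) f g"
  using mdist_cfunspace_imp_mdist_le[OF assms(1,2) order_refl, of h] assms(3)
  by (simp add: history_top_eq del: mspace_cfunspace)

lemma decision_metricD:
  assumes "f \<in> mspace (decision_metric t)"
  shows "continuous_on (hist t) f" "f \<in> hist t \<rightarrow> U"
proof -
  have "mtopology_of (submetric euclidean_metric U) = top_of_set U"
    by (simp add: mtopology_of_submetric)
  then show "continuous_on (hist t) f" "f \<in> hist t \<rightarrow> U"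
    using assms by (auto simp: history_top_eq continuous_map_in_subtopology)
qed

lemma topspace_dtop: "topspace (dtop t) = mspace (decision_metric t)"
  unfolding decision_top_def U_def by (rule topspace_mtopology_of)

lemma strategy_in_decision_metric:
  assumes "s \<in> S" "t \<in> T"
  shows "s t \<in> mspace (decision_metric t)"
proof -
  obtain St where St: "S = PiE T St" "compactin (dtop t) (St t)"
    using strategies_product assms(2) by metis
  then have "s t \<in> St t" using assms by auto
  then show ?thesis using compactin_subset_topspace[OF St(2)] unfolding topspace_dtop by blast
qed

lemmas strategy_cont = decision_metricD(1)[OF strategy_in_decision_metric]
lemmas strategy_range = decision_metricD(2)[OF strategy_in_decision_metric]

text \<open>A compact set of continuous functions is equicontinuous.\<close>

lemma strategies_equicontinuous:
  assumes t: "t \<in> T"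
  shows "uniformly_equicontinuous S (\<lambda>_. hist t) (\<lambda>s. s t)"
  unfolding uniformly_equicontinuous_def
proof (intro allI impI)
  fix e :: real assume e: "e > 0"
  interpret d: Metric_space "mspace (decision_metric t)" "mdist (decision_metric t)"
    by (rule Metric_space_mspace_mdist)
  obtain St where St: "S = PiE T St" "compactin (dtop t) (St t)"
    using strategies_product t by metis
  have "dtop t = d.mtopology" unfolding decision_top_def U_def mtopology_of_def ..
  then have "d.mtotally_bounded (St t)"
    using d.compactin_imp_mtotally_bounded St(2) by (simp del: mspace_cfunspace)
  \<comment> \<open>Finitely many decision rules approximate the whole family within
    \<open>e / 3\<close>; their moduli pass to it by the three-way triangle inequality.\<close>
  then obtain K where K: "finite K" "K \<subseteq> St t" "St t \<subseteq> (\<Union>x\<in>K. d.mball x (e/3))"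
    using e unfolding d.mtotally_bounded_def by (meson divide_pos_pos zero_less_numeral)
  have Kd: "f \<in> mspace (decision_metric t)" if "f \<in> K" for f
    using compactin_subset_topspace[OF St(2)] K(2) that unfolding topspace_dtop by blast
  have "\<exists>\<delta>>0. \<forall>a\<in>hist t. \<forall>b\<in>hist t. dist a b < \<delta> \<longrightarrow> dist (f a) (f b) < e/3" if "f \<in> K" for f
    using compact_uniformly_continuous[OF decision_metricD(1)[OF Kd[OF that]] compact_hist] e
    unfolding uniformly_continuous_on_def by (metis dist_commute divide_pos_pos zero_less_numeral)
  then obtain \<delta> where \<delta>: "\<And>f. f \<in> K \<Longrightarrow> \<delta> f > 0"
    "\<And>f a b. f \<in> K \<Longrightarrow> a \<in> hist t \<Longrightarrow> b \<in> hist t \<Longrightarrow> dist a b < \<delta> f \<Longrightarrow> dist (f a) (f b) < e/3"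
    by metis
  \<comment> \<open>The extra 1 keeps the minimum defined and positive for an empty net.\<close>
  define \<delta>0 where "\<delta>0 = Min (insert 1 (\<delta> ` K))"
  have \<delta>0_le: "\<And>f. f \<in> K \<Longrightarrow> \<delta>0 \<le> \<delta> f" using K(1) by (simp add: \<delta>0_def)
  have "\<delta>0 > 0" using K(1) \<delta>(1) by (auto simp: \<delta>0_def)
  have "dist (s t a) (s t b) < e"
    if s: "s \<in> S" and ab: "a \<in> hist t" "b \<in> hist t" "dist a b < \<delta>0" for s a b
  proof -
    have "s t \<in> St t" using s St(1) t by auto
    then obtain f where f: "f \<in> K" "mdist (decision_metric t) f (s t) < e/3"
      using K(3) unfolding d.mball_def by blast
    have "dist (f h) (s t h) < e/3" if "h \<in> hist t" for h
      using decision_metric_dist[OF Kd[OF f(1)] strategy_in_decision_metric[OF s t] that] f(2) by simp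
    from this[OF ab(1)] this[OF ab(2)] \<delta>(2)[OF f(1) ab(1,2)] ab(3) \<delta>0_le[OF f(1)]
    have "dist (s t a) (f a) < e/3" "dist (f a) (f b) < e/3" "dist (f b) (s t b) < e/3"
      by (simp_all add: dist_commute)
    then show ?thesis by (rule dist_triangle_third)
  qed
  with \<open>\<delta>0 > 0\<close>
  show "\<exists>\<delta>>0. \<forall>s\<in>S. \<forall>a\<in>hist t. \<forall>b\<in>hist t. dist a b < \<delta> \<longrightarrow> dist (s t a) (s t b) < e"
    by (intro exI[of _ \<delta>0] conjI ballI impI)
qed

text \<open>Assuming \<open>{..<t} \<subseteq> T\<close> instead of \<open>t \<in> T\<close> admits
  the terminal time of a finite horizon, where only the state is constrained. States, histories and
  controls feed each other, hence the joint induction.\<close>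

lemma dm_ranges:
  assumes "1 \<le> i" "s \<in> S" "a \<in> X" "{..<t} \<subseteq> T" "\<And>k. k < t \<Longrightarrow> v k \<in> W \<and> z k \<in> Y"
  shows "dm_state G i s a v z t \<in> X"
    and "((restrict (dm_state G i s a v z) {..t}, restrict (dm_control G i s a v z) {..<t}),
        restrict z {..<t}) \<in> hist t"
    and "t \<in> T \<Longrightarrow> dm_control G i s a v z t \<in> U"
proof -
  let ?x = "dm_state G i s a v z" and ?u = "dm_control G i s a v z"
  have "?x t \<in> X \<and> ((restrict ?x {..t}, restrict ?u {..<t}), restrict z {..<t}) \<in> hist t \<and> (t \<in> T
      \<longrightarrow> ?u t \<in> U)"
    using assms(4,5)
  proof (induction t rule: less_induct)
    case (less t)
    have IH: "?x j \<in> X" "?u j \<in> U" if "j < t" for j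
      using less.IH[OF that] less.prems that by (auto simp: subset_iff)
    have xt: "?x t \<in> X"
    proof (cases t)
      case 0
      then show ?thesis by (simp add: assms(3))
    next
      case (Suc r)
      then have "(?x r, ?u r, z r, v r) \<in> X \<times> U \<times> Y \<times> W" "r \<in> T"
        using IH[of r] less.prems by auto
      then show ?thesis using dm_maps(3)[OF assms(1), of r] by (auto simp: Suc dm_state_Suc)
    qed
    have h: "((restrict ?x {..t}, restrict ?u {..<t}), restrict z {..<t}) \<in> hist t"
      using IH xt less.prems(2) by (auto simp: PiE_iff le_less)
    have "?u t \<in> U" if "t \<in> T"
      using strategy_range[OF assms(2) that] h unfolding dm_control_eq[of G i s a v z t] by blast
    then show ?case using xt h by blast
  qed
  then show "?x t \<in> X" "((restrict ?x {..t}, restrict ?u {..<t}), restrict z {..<t}) \<in> hist t"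
    "t \<in> T \<Longrightarrow> ?u t \<in> U" by blast+
qed

text \<open>Concerns fixed realizations, without reference to \<open>sample G\<close>; pathwise
  estimates for admissible inputs are therefore uniform over sample points.\<close>

definition "admissible i s a v z \<longleftrightarrow>
  1 \<le> i \<and> s \<in> S \<and> a \<in> X \<and> (\<forall>k\<in>T. v k \<in> W \<and> z k \<in> Y)"

lemma admissible_ranges:
  assumes "admissible i s a v z" "{..<t} \<subseteq> T"
  shows "dm_state G i s a v z t \<in> X"
    and "((restrict (dm_state G i s a v z) {..t}, restrict (dm_control G i s a v z) {..<t}),
        restrict z {..<t}) \<in> hist t"
    and "t \<in> T \<Longrightarrow> dm_control G i s a v z t \<in> U"
  using dm_ranges[of i s a t v z] assms unfolding admissible_def by (meson lessThan_iff subsetD)+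

text \<open>Induction over time. Converging histories change the value of one strategy little
  because \<open>S\<close> is equicontinuous, and replacing \<open>s k\<close> by
  \<open>s' k\<close> costs little by \<open>strat\<close>; the next states follow from
  equicontinuity of the dynamics. Decision makers, strategies and primitives may all vary with
  \<open>k\<close>, so arguing by contradiction along sequences turns this into uniform
  moduli.\<close>

lemma tendsto_dist_trajectories:
  fixes F :: "'k filter"
  assumes adm: "\<forall>\<^sub>F k in F. admissible (i k) (s k) (a k) (v k) (z k) \<and> admissible (i k) (s' k) (a
      k) (v k) (z' k)"
    and strat: "\<And>j e. j \<in> T \<Longrightarrow> e > 0 \<Longrightarrow> \<forall>\<^sub>F k in F. \<forall>h\<in>hist j. dist (s k j h) (s' k j h) < e"
    and T: "{..<t} \<subseteq> T"
    and env: "\<And>j. j < t \<Longrightarrow> ((\<lambda>k. dist (z k j) (z' k j)) \<longlongrightarrow> 0) F"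
  shows "((\<lambda>k. dist (dm_state G (i k) (s k) (a k) (v k) (z k) t) (dm_state G (i k) (s' k) (a k) (v
      k) (z' k) t)) \<longlongrightarrow> 0) F"
      (is "((\<lambda>k. dist (?x k t) (?x' k t)) \<longlongrightarrow> 0) F")
    and "t \<in> T \<Longrightarrow> ((\<lambda>k. dist (dm_control G (i k) (s k) (a k) (v k) (z k) t) (dm_control G (i k) (s'
        k) (a k) (v k) (z' k) t)) \<longlongrightarrow> 0) F"
      (is "_ \<Longrightarrow> ((\<lambda>k. dist (?u k t) (?u' k t)) \<longlongrightarrow> 0) F")
proof -
  have "((\<lambda>k. dist (?x k t) (?x' k t)) \<longlongrightarrow> 0) F \<and> (t \<in> T \<longrightarrow> ((\<lambda>k. dist (?u k t) (?u' k t)) \<longlongrightarrow> 0) F)"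
    using T env
  proof (induction t rule: less_induct)
    case (less t)
    have IH: "((\<lambda>k. dist (?x k j) (?x' k j)) \<longlongrightarrow> 0) F" "((\<lambda>k. dist (?u k j) (?u' k j)) \<longlongrightarrow> 0) F" if "j
        < t" for j
      using less.IH[OF that] less.prems that by (auto simp: subset_iff)
    have xt: "((\<lambda>k. dist (?x k t) (?x' k t)) \<longlongrightarrow> 0) F"
    proof (cases t)
      case 0
      then show ?thesis by simp
    next
      case (Suc r)
      then have r: "r \<in> T" "{..<r} \<subseteq> T" "r < t" using less.prems(1) by auto
      have "\<forall>\<^sub>F k in F. i k \<in> {1..} \<and> (?x k r, ?u k r, z k r, v k r) \<in> X \<times> U \<times> Y \<times> W
          \<and> (?x' k r, ?u' k r, z' k r, v k r) \<in> X \<times> U \<times> Y \<times> W"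
        using adm by eventually_elim
          (use r admissible_ranges in \<open>auto simp: admissible_def\<close>)
      then have "((\<lambda>k. dist (dm_step G (i k) r (?x k r, ?u k r, z k r, v k r)) (dm_step G (i k) r
          (?x' k r, ?u' k r, z' k r, v k r))) \<longlongrightarrow> 0) F"
        by (rule uniformly_equicontinuous_tendsto[OF dm_equicontinuous(2)[OF r(1)]])
          (intro tendsto_dist_Pair IH r less.prems(2), simp)
      then show ?thesis by (simp add: Suc dm_state_Suc)
    qed
    have "((\<lambda>k. dist (?u k t) (?u' k t)) \<longlongrightarrow> 0) F" if t: "t \<in> T"
    proof -
      define h where "h k = ((restrict (?x k) {..t}, restrict (?u k) {..<t}), restrict (z k)
          {..<t})" for k
      define h' where "h' k = ((restrict (?x' k) {..t}, restrict (?u' k) {..<t}), restrict (z' k)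
          {..<t})" for k
      have hist: "\<forall>\<^sub>F k in F. s k \<in> S \<and> h k \<in> hist t \<and> h' k \<in> hist t"
        using adm
      proof eventually_elim
        case (elim k)
        then have "s k \<in> S" by (simp add: admissible_def)
        then show ?case
          unfolding h_def h'_def
          using admissible_ranges(2)[OF conjunct1[OF elim] less.prems(1)]
            admissible_ranges(2)[OF conjunct2[OF elim] less.prems(1)] by (intro conjI)
      qed
      have "((\<lambda>k. dist (h k) (h' k)) \<longlongrightarrow> 0) F"
        unfolding h_def h'_def
      proof (intro tendsto_dist_Pair tendsto_dist_fun)
        show "((\<lambda>k. dist (restrict (?x k) {..t} j) (restrict (?x' k) {..t} j)) \<longlongrightarrow> 0) F" for j
          using IH(1)[of j] xt by (cases "j < t"; cases "j = t") (auto simp: restrict_def)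
        show "((\<lambda>k. dist (restrict (?u k) {..<t} j) (restrict (?u' k) {..<t} j)) \<longlongrightarrow> 0) F" for j
          using IH(2)[of j] by (cases "j < t") (auto simp: restrict_def)
        show "((\<lambda>k. dist (restrict (z k) {..<t} j) (restrict (z' k) {..<t} j)) \<longlongrightarrow> 0) F" for j
          using less.prems(2)[of j] by (cases "j < t") (auto simp: restrict_def)
      qed
      with hist have 1: "((\<lambda>k. dist (s k t (h k)) (s k t (h' k))) \<longlongrightarrow> 0) F"
        by (rule uniformly_equicontinuous_tendsto[OF strategies_equicontinuous[OF t]])
      have 2: "((\<lambda>k. dist (s k t (h' k)) (s' k t (h' k))) \<longlongrightarrow> 0) F"
      proof (rule tendstoI)
        fix e :: real assume "e > 0"
        from strat[OF t this] hist
        show "\<forall>\<^sub>F k in F. dist (dist (s k t (h' k)) (s' k t (h' k))) 0 < e"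
          by eventually_elim (simp only: dist_real_def diff_zero abs_of_nonneg[OF zero_le_dist])
      qed
      have "((\<lambda>k. dist (s k t (h k)) (s' k t (h' k))) \<longlongrightarrow> 0) F"
        by (rule tendsto_sandwich[OF _ _ tendsto_const])
          (use tendsto_add[OF 1 2] in \<open>auto intro!: always_eventually dist_triangle\<close>)
      then show ?thesis unfolding h_def h'_def dm_control_eq[symmetric] .
    qed
    with xt show ?case by blast
  qed
  then show "((\<lambda>k. dist (?x k t) (?x' k t)) \<longlongrightarrow> 0) F"
    "t \<in> T \<Longrightarrow> ((\<lambda>k. dist (?u k t) (?u' k t)) \<longlongrightarrow> 0) F" by blast+
qed

section \<open>Dependence of path costs on strategies and environment\<close>

definition stage_term where
  "stage_term i s a v z t =
     disc G i ^ t * stage_cost G i t (dm_state G i s a v z t, dm_control G i s a v z t, z t)"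

lemma path_cost_finite:
  "horizon G = enat n \<Longrightarrow> path_cost G i s a v z =
     (\<Sum>t<n. stage_term i s a v z t) + disc G i ^ n * final_cost G i (dm_state G i s a v z n)"
  by (simp add: path_cost_def stage_term_def Let_def)

lemma path_cost_infinite:
  "horizon G = \<infinity> \<Longrightarrow> path_cost G i s a v z = (\<Sum>t. stage_term i s a v z t)"
  by (simp add: path_cost_def stage_term_def Let_def)

text \<open>The common bound \<open>b < 1\<close> on the discount factors gives one geometric
  majorant for all decision makers.\<close>

lemma stage_term_bound:
  obtains b C where "0 < b" "b < 1" "0 \<le> C"
    "\<And>i s a v z t. admissible i s a v z \<Longrightarrow> t \<in> T \<Longrightarrow> \<bar>stage_term i s a v z t\<bar> \<le> C * b ^ t"
    "\<And>i x n. 1 \<le> i \<Longrightarrow> x \<in> X \<Longrightarrow> \<bar>disc G i ^ n * final_cost G i x\<bar> \<le> C"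
proof -
  obtain b where b: "b < 1" "0 < b" "\<And>i. 1 \<le> i \<Longrightarrow> 0 < disc G i \<and> disc G i \<le> b"
    using disc_bounds by metis
  obtain C where C: "0 \<le> C"
    "\<And>i t a. 1 \<le> i \<Longrightarrow> t \<in> T \<Longrightarrow> a \<in> X \<times> U \<times> Y \<Longrightarrow> \<bar>stage_cost G i t a\<bar> \<le> C"
    "\<And>i x. 1 \<le> i \<Longrightarrow> x \<in> X \<Longrightarrow> \<bar>final_cost G i x\<bar> \<le> C"
    using cost_bounds by metis
  show ?thesis
  proof (rule that[OF b(2,1) C(1)])
    fix i :: nat and s a v z t assume adm: "admissible i s a v z" and t: "t \<in> T"
    then have i: "1 \<le> i" by (simp add: admissible_def)
    have sub: "{..<t} \<subseteq> T" using stages_downward[OF t] by auto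
    have "(dm_state G i s a v z t, dm_control G i s a v z t, z t) \<in> X \<times> U \<times> Y"
      using admissible_ranges(1,3)[OF adm sub] adm t by (auto simp: admissible_def)
    then have 1: "\<bar>stage_cost G i t (dm_state G i s a v z t, dm_control G i s a v z t, z t)\<bar> \<le> C"
      by (rule C(2)[OF i t])
    have 2: "disc G i ^ t \<le> b ^ t" "0 \<le> disc G i ^ t" using b(3)[OF i] by (auto intro: power_mono)
    show "\<bar>stage_term i s a v z t\<bar> \<le> C * b ^ t"
      using mult_mono[OF 2(1) 1] 2 b(2) by (simp add: stage_term_def abs_mult mult.commute)
  next
    fix i x n assume i: "1 \<le> (i::nat)" and x: "x \<in> X"
    have "\<bar>disc G i ^ n * final_cost G i x\<bar> \<le> 1 * C"
      unfolding abs_mult using b(1) b(3)[OF i] C(1) C(3)[OF i x]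
      by (intro mult_mono) (auto intro: power_le_one)
    then show "\<bar>disc G i ^ n * final_cost G i x\<bar> \<le> C" by simp
  qed
qed

text \<open>A finite horizon leaves finitely many terms. For an infinite one every single term tends
  to 0 and \<open>2 * C * b ^ t\<close> dominates, so Tannery's theorem applies.\<close>

lemma tendsto_path_cost_diff:
  fixes F :: "'k filter"
  assumes adm: "\<forall>\<^sub>F k in F. admissible (i k) (s k) (a k) (v k) (z k) \<and> admissible (i k) (s' k) (a
      k) (v k) (z' k)"
    and strat: "\<And>j e. j \<in> T \<Longrightarrow> e > 0 \<Longrightarrow> \<forall>\<^sub>F k in F. \<forall>h\<in>hist j. dist (s k j h) (s' k j h) < e"
    and env: "\<And>j. j \<in> T \<Longrightarrow> ((\<lambda>k. dist (z k j) (z' k j)) \<longlongrightarrow> 0) F"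
  shows "((\<lambda>k. path_cost G (i k) (s k) (a k) (v k) (z k) - path_cost G (i k) (s' k) (a k) (v k)
      (z' k)) \<longlongrightarrow> 0) F"
proof (cases "F = bot")
  case False
  obtain b C where bC: "0 < b" "b < 1" "0 \<le> C"
    "\<And>i s a v z t. admissible i s a v z \<Longrightarrow> t \<in> T \<Longrightarrow> \<bar>stage_term i s a v z t\<bar> \<le> C * b ^ t"
    using stage_term_bound by metis
  obtain b' where b': "b' < 1" "\<And>i. 1 \<le> i \<Longrightarrow> 0 < disc G i \<and> disc G i \<le> b'"
    using disc_bounds by metis
  \<comment> \<open>\<open>i k\<close> may vary, so the discount power need not converge; being at
    most 1 in modulus, it preserves convergence to 0.\<close>
  have disc_mult: "((\<lambda>k. disc G (i k) ^ n * f k) \<longlongrightarrow> 0) F" if "(f \<longlongrightarrow> 0) F" for n f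
  proof (rule Lim_null_comparison[OF _ tendsto_norm_zero[OF that]])
    have "\<bar>disc G i ^ n * f k\<bar> \<le> \<bar>f k\<bar>" if "1 \<le> i" for i k
      using b'(2)[OF that] b'(1) mult_right_mono[of "disc G i ^ n" 1 "\<bar>f k\<bar>"]
      by (simp add: abs_mult power_le_one)
    then show "\<forall>\<^sub>F k in F. norm (disc G (i k) ^ n * f k) \<le> norm (f k)"
      using adm by (auto elim!: eventually_mono simp: admissible_def)
  qed
  have state: "((\<lambda>k. dist (dm_state G (i k) (s k) (a k) (v k) (z k) t) (dm_state G (i k) (s' k) (a
      k) (v k) (z' k) t)) \<longlongrightarrow> 0) F"
    if "{..<t} \<subseteq> T" for t
    using that env by (intro tendsto_dist_trajectories(1)[OF adm strat]) auto
  define w where "w t k = stage_term (i k) (s k) (a k) (v k) (z k) t - stage_term (i k) (s' k) (a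
      k) (v k) (z' k) t" for t k
  have w0: "(w t \<longlongrightarrow> 0) F" if t: "t \<in> T" for t
  proof -
    have sub: "{..<t} \<subseteq> T" using stages_downward[OF t] by auto
    have control: "((\<lambda>k. dist (dm_control G (i k) (s k) (a k) (v k) (z k) t) (dm_control G (i k)
        (s' k) (a k) (v k) (z' k) t)) \<longlongrightarrow> 0) F"
      using sub env by (intro tendsto_dist_trajectories(2)[OF adm strat _ _ t]) auto
    have "\<forall>\<^sub>F k in F. i k \<in> {1..} \<and>
        (dm_state G (i k) (s k) (a k) (v k) (z k) t, dm_control G (i k) (s k) (a k) (v k) (z k) t,
            z k t) \<in> X \<times> U \<times> Y \<and>
        (dm_state G (i k) (s' k) (a k) (v k) (z' k) t, dm_control G (i k) (s' k) (a k) (v k) (z'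
            k) t, z' k t) \<in> X \<times> U \<times> Y"
      using adm by eventually_elim (use sub t admissible_ranges(1,3) in \<open>auto simp: admissible_def\<close>)
    then have "((\<lambda>k. dist (stage_cost G (i k) t (dm_state G (i k) (s k) (a k) (v k) (z k) t,
        dm_control G (i k) (s k) (a k) (v k) (z k) t, z k t))
        (stage_cost G (i k) t (dm_state G (i k) (s' k) (a k) (v k) (z' k) t, dm_control G (i k)
            (s' k) (a k) (v k) (z' k) t, z' k t))) \<longlongrightarrow> 0) F"
      by (rule uniformly_equicontinuous_tendsto[OF dm_equicontinuous(1)[OF t]])
        (intro tendsto_dist_Pair state[OF sub] control env t)
    from disc_mult[OF this[folded tendsto_diff_zero_iff_dist], of t]
    show ?thesis unfolding w_def stage_term_def by (simp add: right_diff_distrib)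
  qed
  have wb: "\<forall>\<^sub>F k in F. \<forall>t\<in>T. \<bar>w t k\<bar> \<le> 2 * C * b ^ t"
    using adm
  proof eventually_elim
    case (elim k)
    show ?case
    proof
      fix t assume "t \<in> T"
      from bC(4)[OF conjunct1[OF elim] this] bC(4)[OF conjunct2[OF elim] this]
      show "\<bar>w t k\<bar> \<le> 2 * C * b ^ t" unfolding w_def by linarith
    qed
  qed
  show ?thesis
  proof (cases "horizon G")
    case (enat n)
    have T: "t \<in> T \<longleftrightarrow> t < n" for t by (simp add: stages_def enat)
    have "\<forall>\<^sub>F k in F. i k \<in> {1..} \<and> dm_state G (i k) (s k) (a k) (v k) (z k) n \<in> X \<and> dm_state G (i
        k) (s' k) (a k) (v k) (z' k) n \<in> X"
      using adm by eventually_elim (use T admissible_ranges(1)[where t = n] in \<open>auto simp: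
          admissible_def subset_iff\<close>)
    then have fin: "((\<lambda>k. dist (final_cost G (i k) (dm_state G (i k) (s k) (a k) (v k) (z k) n))
        (final_cost G (i k) (dm_state G (i k) (s' k) (a k) (v k) (z' k) n))) \<longlongrightarrow> 0) F"
      by (rule uniformly_equicontinuous_tendsto[OF dm_equicontinuous(3)]) (rule state, auto simp: T)
    have "((\<lambda>k. (\<Sum>t<n. w t k) + disc G (i k) ^ n * (final_cost G (i k) (dm_state G (i k) (s k) (a
        k) (v k) (z k) n) -
        final_cost G (i k) (dm_state G (i k) (s' k) (a k) (v k) (z' k) n))) \<longlongrightarrow> (\<Sum>t<n. 0) + 0) F"
      by (intro tendsto_add tendsto_sum disc_mult w0 fin[folded tendsto_diff_zero_iff_dist]) (simp
          add: T)
    then show ?thesis by (simp add: path_cost_finite[OF enat] w_def sum_subtractf algebra_simps)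
  next
    case infinity
    have T: "t \<in> T" for t by (simp add: stages_def infinity)
    have sumC: "summable (\<lambda>t. K * b ^ t)" for K
      using bC by (intro summable_mult summable_geometric) simp
    have "((\<lambda>k. \<Sum>t. w t k) \<longlongrightarrow> (\<Sum>t. 0)) F"
    proof (rule tannerys_theorem[THEN conjunct2, THEN conjunct2])
      show "\<forall>\<^sub>F (t, k) in at_top \<times>\<^sub>F F. norm (w t k) \<le> 2 * C * b ^ t"
        unfolding eventually_prod_filter
        by (intro exI[of _ "\<lambda>_. True"] exI[of _ "\<lambda>k. \<forall>t\<in>T. \<bar>w t k\<bar> \<le> 2 * C * b ^ t"]) (use wb T in auto)
    qed (use w0 T sumC False in auto)
    moreover have "\<forall>\<^sub>F k in F. path_cost G (i k) (s k) (a k) (v k) (z k) - path_cost G (i k) (s'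
        k) (a k) (v k) (z' k) = (\<Sum>t. w t k)"
      using adm
    proof eventually_elim
      case (elim k)
      have "summable (stage_term (i k) (s k) (a k) (v k) (z k))" "summable (stage_term (i k) (s'
          k) (a k) (v k) (z' k))"
        using elim bC(4) T by (auto intro!: summable_comparison_test'[OF sumC[of C]])
      then show ?case by (simp add: path_cost_infinite[OF infinity] w_def suminf_diff)
    qed
    ultimately show ?thesis by (simp add: tendsto_cong)
  qed
qed auto

lemma path_cost_bounded:
  "\<exists>B>0. \<forall>i s a v z. admissible i s a v z \<longrightarrow> \<bar>path_cost G i s a v z\<bar> \<le> B"
proof -
  obtain b C where bC: "0 < b" "b < 1" "0 \<le> C"
    "\<And>i s a v z t. admissible i s a v z \<Longrightarrow> t \<in> T \<Longrightarrow> \<bar>stage_term i s a v z t\<bar> \<le> C * b ^ t"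
    "\<And>i x n. 1 \<le> i \<Longrightarrow> x \<in> X \<Longrightarrow> \<bar>disc G i ^ n * final_cost G i x\<bar> \<le> C"
    using stage_term_bound by metis
  have sumC: "summable (\<lambda>t. C * b ^ t)"
    using bC by (intro summable_mult summable_geometric) simp
  \<comment> \<open>The summand 1 only serves to make \<open>B\<close> positive.\<close>
  define B where "B = (\<Sum>t. C * b ^ t) + C + 1"
  have pos: "0 \<le> (\<Sum>t. C * b ^ t)" using bC sumC by (intro suminf_nonneg) auto
  have "\<bar>path_cost G i s a v z\<bar> \<le> B" if adm: "admissible i s a v z" for i s a v z
  proof (cases "horizon G")
    case (enat n)
    have T: "t \<in> T \<longleftrightarrow> t < n" for t by (simp add: stages_def enat)
    have "\<bar>\<Sum>t<n. stage_term i s a v z t\<bar> \<le> (\<Sum>t<n. C * b ^ t)"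
      by (rule order_trans[OF sum_abs sum_mono]) (use bC(4)[OF adm] T in auto)
    also have "\<dots> \<le> (\<Sum>t. C * b ^ t)" using bC sumC by (intro sum_le_suminf) auto
    finally have "\<bar>\<Sum>t<n. stage_term i s a v z t\<bar> \<le> (\<Sum>t. C * b ^ t)" .
    moreover have "\<bar>disc G i ^ n * final_cost G i (dm_state G i s a v z n)\<bar> \<le> C"
      using adm admissible_ranges(1)[OF adm, of n] T by (intro bC(5)) (auto simp: admissible_def)
    ultimately show ?thesis unfolding path_cost_finite[OF enat] B_def by linarith
  next
    case infinity
    have "\<bar>\<Sum>t. stage_term i s a v z t\<bar> \<le> (\<Sum>t. C * b ^ t)"
    proof -
      have le: "norm (stage_term i s a v z t) \<le> C * b ^ t" for t
        using bC(4)[OF adm, of t] by (simp add: stages_def infinity)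
      have "summable (\<lambda>t. norm (stage_term i s a v z t))"
        by (rule summable_comparison_test'[OF sumC]) (use le in simp)
      then show ?thesis using summable_norm[of "stage_term i s a v z"] suminf_le[OF le _ sumC] by force
    qed
    then show ?thesis unfolding path_cost_infinite[OF infinity] B_def using bC by linarith
  qed
  moreover have "0 < B" using pos bC(3) by (simp add: B_def)
  ultimately show ?thesis by blast
qed

subsection \<open>Moduli of continuity and measurability\<close>

text \<open>One index measures both the window and the precision. These relations form a base of the
  product uniformity, so a counterexample for every \<open>n\<close> is a pair of sequences that
  approach each other in each coordinate.\<close>

definition "near n z z' \<longleftrightarrow> (\<forall>j\<in>T. j < n \<longrightarrow> dist (z j) (z' j) < 1 / real (Suc n))"

definition "strategies_near n s s' \<longleftrightarrow>
  (\<forall>j\<in>T. j < n \<longrightarrow> (\<forall>h\<in>hist j. dist (s j h) (s' j h) < 1 / real (Suc n)))"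

lemma strategies_near_refl [simp]: "strategies_near n s s"
  by (simp add: strategies_near_def)

lemma near_sequences:
  assumes "\<And>n. near n (z n) (z' n)" "j \<in> T"
  shows "(\<lambda>n. dist (z n j) (z' n j)) \<longlonglongrightarrow> 0"
proof (rule tendstoI)
  fix e :: real assume "e > 0"
  from eventually_inverse_less[OF this, of j]
  show "\<forall>\<^sub>F n in sequentially. dist (dist (z n j) (z' n j)) 0 < e"
  proof eventually_elim
    case (elim n)
    then have "dist (z n j) (z' n j) < 1 / real (Suc n)" using assms(1)[of n] assms(2) unfolding
        near_def by blast
    then show ?case using elim by simp
  qed
qed

lemma strategies_near_sequences:
  assumes "\<And>n. strategies_near n (s n) (s' n)" "j \<in> T" "e > 0"
  shows "\<forall>\<^sub>F n in sequentially. \<forall>h\<in>hist j. dist (s n j h) (s' n j h) < e"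
  using eventually_inverse_less[OF assms(3), of j]
proof eventually_elim
  case (elim n)
  show ?case
  proof
    fix h assume "h \<in> hist j"
    then have "dist (s n j h) (s' n j h) < 1 / real (Suc n)"
      using assms(1)[of n] assms(2) elim unfolding strategies_near_def by blast
    then show "dist (s n j h) (s' n j h) < e" using elim by simp
  qed
qed

text \<open>Counterexamples for all \<open>n\<close> would form sequences to which
  \<open>tendsto_path_cost_diff\<close> applies. Since they may differ in decision maker, initial
  state and disturbances, one \<open>n\<close> serves all of these.\<close>

lemma path_cost_modulus:
  assumes "e > 0"
  shows "\<exists>n. \<forall>i s s' a v z z'. admissible i s a v z \<longrightarrow> admissible i s' a v z' \<longrightarrow>
      strategies_near n s s' \<longrightarrow> near n z z' \<longrightarrow> \<bar>path_cost G i s a v z - path_cost G i s' a v z'\<bar> < e"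
proof (rule ccontr)
  define bad where "bad n i s s' a v z z' \<longleftrightarrow> admissible i s a v z \<and> admissible i s' a v z' \<and>
    strategies_near n s s' \<and> near n z z' \<and> \<not> \<bar>path_cost G i s a v z - path_cost G i s' a v z'\<bar> < e"
    for n i s s' a v z z'
  assume "\<not> ?thesis"
  then have "\<forall>n. \<exists>i s s' a v z z'. bad n i s s' a v z z'" unfolding bad_def by blast
  then obtain i s s' a v z z' where "\<And>n. bad n (i n) (s n) (s' n) (a n) (v n) (z n) (z' n)" by metis
  then have seq: "\<And>n. admissible (i n) (s n) (a n) (v n) (z n)" "\<And>n. admissible (i n) (s' n) (a n)
      (v n) (z' n)"
    "\<And>n. strategies_near n (s n) (s' n)" "\<And>n. near n (z n) (z' n)"
    "\<And>n. \<not> \<bar>path_cost G (i n) (s n) (a n) (v n) (z n) - path_cost G (i n) (s' n) (a n) (v n) (z'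
        n)\<bar> < e"
    unfolding bad_def by blast+
  have "(\<lambda>n. path_cost G (i n) (s n) (a n) (v n) (z n) - path_cost G (i n) (s' n) (a n) (v n) (z'
      n)) \<longlonglongrightarrow> 0"
    by (rule tendsto_path_cost_diff)
      (use seq(1,2) strategies_near_sequences[OF seq(3)] near_sequences[OF seq(4)] in \<open>auto
          intro!: always_eventually\<close>)
  from tendstoD[OF this assms] obtain n where
    "\<bar>path_cost G (i n) (s n) (a n) (v n) (z n) - path_cost G (i n) (s' n) (a n) (v n) (z' n)\<bar> < e"
    by (auto simp: dist_real_def eventually_sequentially)
  with seq(5) show False by blast
qed

text \<open>The same argument at a single time. Only the environment before \<open>t\<close> is
  controlled, which is the form that an induction over time needs.\<close>

lemma trajectory_modulus:
  assumes t: "t \<in> T" and "e > 0"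
  shows "\<exists>n. \<forall>i s a v z z'. admissible i s a v z \<longrightarrow> admissible i s a v z' \<longrightarrow>
      (\<forall>j<t. dist (z j) (z' j) < 1 / real (Suc n)) \<longrightarrow>
      dist (dm_state G i s a v z t) (dm_state G i s a v z' t) < e \<and>
      dist (dm_control G i s a v z t) (dm_control G i s a v z' t) < e"
proof (rule ccontr)
  define good where "good i s a v z z' \<longleftrightarrow> dist (dm_state G i s a v z t) (dm_state G i s a v z' t) < e \<and>
      dist (dm_control G i s a v z t) (dm_control G i s a v z' t) < e" for i s a v z z'
  define bad where "bad n i s a v z z' \<longleftrightarrow> admissible i s a v z \<and> admissible i s a v z' \<and>
    (\<forall>j<t. dist (z j) (z' j) < 1 / real (Suc n)) \<and> \<not> good i s a v z z'"
    for n i s a v z z'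
  assume "\<not> ?thesis"
  then have "\<forall>n. \<exists>i s a v z z'. bad n i s a v z z'" unfolding bad_def good_def by blast
  then obtain i s a v z z' where "\<And>n. bad n (i n) (s n) (a n) (v n) (z n) (z' n)" by metis
  then have seq: "\<And>n. admissible (i n) (s n) (a n) (v n) (z n)" "\<And>n. admissible (i n) (s n) (a n)
      (v n) (z' n)"
    "\<And>n j. j < t \<Longrightarrow> dist (z n j) (z' n j) < 1 / real (Suc n)"
    "\<And>n. \<not> good (i n) (s n) (a n) (v n) (z n) (z' n)"
    unfolding bad_def by blast+
  have env: "(\<lambda>n. dist (z n j) (z' n j)) \<longlonglongrightarrow> 0" if "j < t" for j
    by (rule tendsto_sandwich[OF _ _ tendsto_const LIMSEQ_inverse_real_of_nat])
      (use less_imp_le[OF seq(3)[OF that]] in \<open>auto simp: inverse_eq_divide\<close>)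
  have sub: "{..<t} \<subseteq> T" using stages_downward[OF t] by auto
  have adm: "\<forall>\<^sub>F n in sequentially. admissible (i n) (s n) (a n) (v n) (z n) \<and> admissible (i n) (s
      n) (a n) (v n) (z' n)"
    using seq(1,2) by (auto intro!: always_eventually)
  have "(\<lambda>n. dist (dm_state G (i n) (s n) (a n) (v n) (z n) t) (dm_state G (i n) (s n) (a n) (v n)
      (z' n) t)) \<longlonglongrightarrow> 0"
    by (rule tendsto_dist_trajectories(1)[OF adm]) (use sub env in auto)
  moreover have "(\<lambda>n. dist (dm_control G (i n) (s n) (a n) (v n) (z n) t) (dm_control G (i n) (s
      n) (a n) (v n) (z' n) t)) \<longlonglongrightarrow> 0"
    by (rule tendsto_dist_trajectories(2)[OF adm _ _ _ t]) (use sub env in auto)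
  ultimately have "\<forall>\<^sub>F n in sequentially. good (i n) (s n) (a n) (v n) (z n) (z' n)"
    unfolding good_def using \<open>e > 0\<close> by (auto intro!: eventually_conj dest: order_tendstoD(2))
  then show False using seq(4) by simp
qed

text \<open>Stated over an arbitrary measure \<open>N\<close> with random \<open>z\<close>: it
  serves for fixed and for random environments on \<open>M\<close>, and on the product space
  carrying the primitives of one decision maker.\<close>

lemma measurable_trajectory:
  fixes N :: "'q measure"
  assumes i: "1 \<le> i" and s: "s \<in> S"
    and a: "a \<in> borel_measurable N" "\<And>\<omega>. \<omega> \<in> space N \<Longrightarrow> a \<omega> \<in> X"
    and T: "{..<t} \<subseteq> T"
    and v: "\<And>k. k < t \<Longrightarrow> (\<lambda>\<omega>. v \<omega> k) \<in> borel_measurable N" "\<And>k \<omega>. k < t \<Longrightarrow> \<omega> \<in> space N \<Longrightarrow> v \<omega> k \<in> W"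
    and z: "\<And>k. k < t \<Longrightarrow> (\<lambda>\<omega>. z \<omega> k) \<in> borel_measurable N" "\<And>k \<omega>. k < t \<Longrightarrow> \<omega> \<in> space N \<Longrightarrow> z \<omega> k \<in> Y"
  shows "(\<lambda>\<omega>. dm_state G i s (a \<omega>) (v \<omega>) (z \<omega>) t) \<in> borel_measurable N"
    and "t \<in> T \<Longrightarrow> (\<lambda>\<omega>. dm_control G i s (a \<omega>) (v \<omega>) (z \<omega>) t) \<in> borel_measurable N"
proof -
  let ?x = "\<lambda>\<omega>. dm_state G i s (a \<omega>) (v \<omega>) (z \<omega>)" and ?u = "\<lambda>\<omega>. dm_control G i s (a \<omega>) (v \<omega>) (z \<omega>)"
  have "(\<lambda>\<omega>. ?x \<omega> t) \<in> borel_measurable N \<and> (t \<in> T \<longrightarrow> (\<lambda>\<omega>. ?u \<omega> t) \<in> borel_measurable N)"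
    using T v z
  proof (induction t rule: less_induct)
    case (less t)
    have IH: "(\<lambda>\<omega>. ?x \<omega> j) \<in> borel_measurable N" "(\<lambda>\<omega>. ?u \<omega> j) \<in> borel_measurable N" if "j < t" for j
      using less.IH[OF that] less.prems that by (auto simp: subset_iff)
    have ranges: "?x \<omega> j \<in> X" "((restrict (?x \<omega>) {..j}, restrict (?u \<omega>) {..<j}), restrict (z \<omega>)
        {..<j}) \<in> hist j"
      "j \<in> T \<Longrightarrow> ?u \<omega> j \<in> U" if "\<omega> \<in> space N" "j \<le> t" for \<omega> j
      using dm_ranges[OF i s a(2)[OF that(1)], of j "v \<omega>" "z \<omega>"] less.prems that by (auto simp:
          subset_iff)
    have xt: "(\<lambda>\<omega>. ?x \<omega> t) \<in> borel_measurable N"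
    proof (cases t)
      case 0
      then show ?thesis by (simp add: a(1))
    next
      case (Suc r)
      then have r: "r \<in> T" "r < t" using less.prems(1) by auto
      have "(\<lambda>\<omega>. dm_step G i r (?x \<omega> r, ?u \<omega> r, z \<omega> r, v \<omega> r)) \<in> borel_measurable N"
      proof (rule borel_measurable_continuous_on_compose[OF dm_maps(2)[OF i r(1)]])
        show "(\<lambda>\<omega>. (?x \<omega> r, ?u \<omega> r, z \<omega> r, v \<omega> r)) \<in> borel_measurable N"
          using r IH less.prems(2,4) by (intro borel_measurable_Pair) auto
        show "(?x \<omega> r, ?u \<omega> r, z \<omega> r, v \<omega> r) \<in> X \<times> U \<times> Y \<times> W" if "\<omega> \<in> space N" for \<omega>
          using ranges[OF that, of r] less.prems(3,5) that r by auto
      qed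
      then show ?thesis by (simp add: Suc dm_state_Suc)
    qed
    have "(\<lambda>\<omega>. ?u \<omega> t) \<in> borel_measurable N" if t: "t \<in> T"
      unfolding dm_control_eq[of _ _ _ _ _ _ t]
    proof (rule borel_measurable_continuous_on_compose[OF strategy_cont[OF s t]])
      show "(\<lambda>\<omega>. ((restrict (?x \<omega>) {..t}, restrict (?u \<omega>) {..<t}), restrict (z \<omega>) {..<t})) \<in>
          borel_measurable N"
      proof (intro borel_measurable_Pair measurable_coordinatewise_then_product)
        show "(\<lambda>\<omega>. restrict (?x \<omega>) {..t} j) \<in> borel_measurable N" for j
          using IH(1)[of j] xt by (cases "j < t"; cases "j = t") (auto simp: restrict_def)
        show "(\<lambda>\<omega>. restrict (?u \<omega>) {..<t} j) \<in> borel_measurable N" for j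
          using IH(2)[of j] by (cases "j < t") (auto simp: restrict_def)
        show "(\<lambda>\<omega>. restrict (z \<omega>) {..<t} j) \<in> borel_measurable N" for j
          using less.prems(4)[of j] by (cases "j < t") (auto simp: restrict_def)
      qed
      show "((restrict (?x \<omega>) {..t}, restrict (?u \<omega>) {..<t}), restrict (z \<omega>) {..<t}) \<in> hist t"
        if "\<omega> \<in> space N" for \<omega>
        by (rule ranges(2)[OF that order_refl])
    qed
    with xt show ?case by blast
  qed
  then show "(\<lambda>\<omega>. ?x \<omega> t) \<in> borel_measurable N" "t \<in> T \<Longrightarrow> (\<lambda>\<omega>. ?u \<omega> t) \<in> borel_measurable N"
    by blast+
qed

abbreviation "noise_path i \<omega> \<equiv> (\<lambda>k. noise G i k \<omega>)"

lemma prob_space_sample: "prob_space M"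
  by (rule game_parts(7))

lemma primitives:
  assumes "1 \<le> i"
  shows "init_state G i \<in> borel_measurable M" "\<And>\<omega>. \<omega> \<in> space M \<Longrightarrow> init_state G i \<omega> \<in> X"
    "\<And>k. k \<in> T \<Longrightarrow> noise G i k \<in> borel_measurable M"
    "\<And>k \<omega>. k \<in> T \<Longrightarrow> \<omega> \<in> space M \<Longrightarrow> noise G i k \<omega> \<in> W"
proof -
  have 1: "init_state G i \<in> M \<rightarrow>\<^sub>M restrict_space borel X"
    using game_parts(8)[rule_format, OF assms] assms by simp
  have 2: "noise G i k \<in> M \<rightarrow>\<^sub>M restrict_space borel W" if "k \<in> T" for k
    using game_parts(9)[rule_format, OF assms that] assms by simp
  show "init_state G i \<in> borel_measurable M" "\<And>k. k \<in> T \<Longrightarrow> noise G i k \<in> borel_measurable M"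
    using 1 2 unfolding measurable_restrict_space2_iff by blast+
  show "\<And>\<omega>. \<omega> \<in> space M \<Longrightarrow> init_state G i \<omega> \<in> X"
    "\<And>k \<omega>. k \<in> T \<Longrightarrow> \<omega> \<in> space M \<Longrightarrow> noise G i k \<omega> \<in> W"
    using measurable_space[OF 1] measurable_space[OF 2] by (auto simp: space_restrict_space)
qed

lemma admissible_sample:
  assumes "1 \<le> i" "s \<in> S" "z \<in> Z" "\<omega> \<in> space M"
  shows "admissible i s (init_state G i \<omega>) (noise_path i \<omega>) z"
  using assms primitives[OF assms(1)] by (auto simp: admissible_def)

lemma measurable_sample_trajectory:
  assumes "1 \<le> i" "s \<in> S" "z \<in> Z" "{..<t} \<subseteq> T"
  shows "(\<lambda>\<omega>. dm_state G i s (init_state G i \<omega>) (noise_path i \<omega>) z t) \<in> borel_measurable M"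
    and "t \<in> T \<Longrightarrow> (\<lambda>\<omega>. dm_control G i s (init_state G i \<omega>) (noise_path i \<omega>) z t) \<in> borel_measurable M"
  using assms primitives[OF assms(1)] by (auto intro!: measurable_trajectory simp: subset_iff)

lemma measurable_path_cost:
  assumes "1 \<le> i" "s \<in> S" "z \<in> Z"
  shows "(\<lambda>\<omega>. path_cost G i s (init_state G i \<omega>) (noise_path i \<omega>) z) \<in> borel_measurable M"
proof -
  have st: "(\<lambda>\<omega>. stage_term i s (init_state G i \<omega>) (noise_path i \<omega>) z t) \<in> borel_measurable M" if
      t: "t \<in> T" for t
  proof -
    have sub: "{..<t} \<subseteq> T" using stages_downward[OF t] by auto
    have "(\<lambda>\<omega>. stage_cost G i t (dm_state G i s (init_state G i \<omega>) (noise_path i \<omega>) z t,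
        dm_control G i s (init_state G i \<omega>) (noise_path i \<omega>) z t, z t)) \<in> borel_measurable M"
    proof (rule borel_measurable_continuous_on_compose[OF dm_maps(1)[OF assms(1) t]])
      show "(\<lambda>\<omega>. (dm_state G i s (init_state G i \<omega>) (noise_path i \<omega>) z t,
          dm_control G i s (init_state G i \<omega>) (noise_path i \<omega>) z t, z t)) \<in> borel_measurable M"
        by (intro borel_measurable_Pair measurable_sample_trajectory[OF assms sub] t) simp
    qed (use admissible_ranges(1,3)[OF admissible_sample[OF assms] sub] t assms(3) in auto)
    then show ?thesis unfolding stage_term_def by (intro borel_measurable_times) auto
  qed
  show ?thesis
  proof (cases "horizon G")
    case (enat n)
    have T: "t \<in> T \<longleftrightarrow> t < n" for t by (simp add: stages_def enat)
    have sub: "{..<n} \<subseteq> T" using T by auto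
    have "(\<lambda>\<omega>. final_cost G i (dm_state G i s (init_state G i \<omega>) (noise_path i \<omega>) z n)) \<in>
        borel_measurable M"
      by (rule borel_measurable_continuous_on_compose[OF final_cost_cont[OF assms(1)]
          measurable_sample_trajectory(1)[OF assms sub]])
        (rule admissible_ranges(1)[OF admissible_sample[OF assms] sub])
    then show ?thesis
      unfolding path_cost_finite[OF enat] using st T by (intro borel_measurable_add
          borel_measurable_sum borel_measurable_times) auto
  next
    case infinity
    then show ?thesis unfolding path_cost_infinite[OF infinity]
      using st by (intro borel_measurable_suminf) (simp add: stages_def)
  qed
qed

abbreviation "J \<equiv> expected_cost G"

lemma integrable_path_cost:
  assumes "1 \<le> i" "s \<in> S" "z \<in> Z"
  shows "integrable M (\<lambda>\<omega>. path_cost G i s (init_state G i \<omega>) (noise_path i \<omega>) z)"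
proof -
  interpret prob_space M by (rule prob_space_sample)
  obtain B where "\<forall>i s a v z. admissible i s a v z \<longrightarrow> \<bar>path_cost G i s a v z\<bar> \<le> B"
    using path_cost_bounded by blast
  then show ?thesis using admissible_sample[OF assms]
    by (intro integrable_const_bound[where B = B] measurable_path_cost assms) auto
qed

text \<open>Both costs are expectations over the same primitives, so the pathwise modulus
  integrates. The index does not depend on \<open>i\<close>; the net of paths can therefore be fixed
  for all decision makers together.\<close>

lemma expected_cost_modulus:
  assumes "e > 0"
  shows "\<exists>n. \<forall>i\<ge>1. \<forall>s\<in>S. \<forall>s'\<in>S. \<forall>z\<in>Z. \<forall>z'\<in>Z.
      strategies_near n s s' \<longrightarrow> near n z z' \<longrightarrow> \<bar>J i s z - J i s' z'\<bar> \<le> e"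
proof -
  interpret prob_space M by (rule prob_space_sample)
  obtain n where n: "\<forall>i s s' a v z z'. admissible i s a v z \<longrightarrow> admissible i s' a v z' \<longrightarrow>
      strategies_near n s s' \<longrightarrow> near n z z' \<longrightarrow> \<bar>path_cost G i s a v z - path_cost G i s' a v z'\<bar> < e"
    using path_cost_modulus[OF assms] ..
  show ?thesis
  proof (intro exI[of _ n] allI ballI impI)
    fix i :: nat and s s' z z'
    assume i: "1 \<le> i" and s: "s \<in> S" "s' \<in> S" and z: "z \<in> Z" "z' \<in> Z" and near: "strategies_near n
        s s'" "near n z z'"
    let ?c = "\<lambda>s z \<omega>. path_cost G i s (init_state G i \<omega>) (noise_path i \<omega>) z"
    have "\<bar>J i s z - J i s' z'\<bar> = \<bar>LINT \<omega>|M. ?c s z \<omega> - ?c s' z' \<omega>\<bar>"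
      unfolding expected_cost_def using integrable_path_cost[OF i] s z by simp
    also have "\<dots> \<le> (LINT \<omega>|M. \<bar>?c s z \<omega> - ?c s' z' \<omega>\<bar>)"
      by (rule integral_abs_bound)
    also have "\<dots> \<le> (LINT \<omega>|M. e)"
      using n[rule_format, OF admissible_sample[OF i s(1) z(1)] admissible_sample[OF i s(2) z(2)] near]
      by (intro integral_mono integrable_abs Bochner_Integration.integrable_diff
          integrable_path_cost i s z) (auto intro: less_imp_le)
    finally show "\<bar>J i s z - J i s' z'\<bar> \<le> e" by (simp add: prob_space)
  qed
qed

lemma expected_cost_bounded:
  "\<exists>B>0. \<forall>i\<ge>1. \<forall>s\<in>S. \<forall>z\<in>Z. \<bar>J i s z\<bar> \<le> B"
proof -
  interpret prob_space M by (rule prob_space_sample)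
  obtain B where B: "0 < B" "\<forall>i s a v z. admissible i s a v z \<longrightarrow> \<bar>path_cost G i s a v z\<bar> \<le> B"
    using path_cost_bounded by blast
  have "\<bar>J i s z\<bar> \<le> B" if "1 \<le> i" "s \<in> S" "z \<in> Z" for i s z
  proof -
    have "\<bar>J i s z\<bar> \<le> (LINT \<omega>|M. \<bar>path_cost G i s (init_state G i \<omega>) (noise_path i \<omega>) z\<bar>)"
      unfolding expected_cost_def by (rule integral_abs_bound)
    also have "\<dots> \<le> (LINT \<omega>|M. B)"
      using B(2)[rule_format, OF admissible_sample[OF that]] by (intro integral_mono
          integrable_abs integrable_path_cost that) auto
    finally show ?thesis by (simp add: prob_space)
  qed
  with B(1) show ?thesis by blast
qed

subsection \<open>Best replies\<close>

text \<open>\<open>near n\<close> restricts finitely many coordinates only, hence contains a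
  neighbourhood in the product topology.\<close>

lemma continuous_on_paths:
  fixes f :: "(nat \<Rightarrow> 'y) \<Rightarrow> real"
  assumes "\<And>e. e > 0 \<Longrightarrow> \<exists>n. \<forall>z\<in>Z. \<forall>z'\<in>Z. near n z z' \<longrightarrow> \<bar>f z - f z'\<bar> \<le> e"
  shows "continuous_on Z f"
  unfolding continuous_on_def
proof (intro ballI tendstoI)
  fix z and e :: real assume z: "z \<in> Z" and "e > 0"
  then obtain n where n: "\<forall>z\<in>Z. \<forall>z'\<in>Z. near n z z' \<longrightarrow> \<bar>f z - f z'\<bar> \<le> e / 2"
    using assms[of "e/2"] by auto
  have "\<forall>\<^sub>F z' in at z within Z. dist (z' j) (z j) < 1 / real (Suc n)" for j
  proof -
    have "((\<lambda>z'. z' j) \<longlongrightarrow> z j) (at z within Z)"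
      using continuous_on_product_coordinates[of j] z unfolding continuous_on_def by (metis UNIV_I
          tendsto_within_subset subset_UNIV)
    then show ?thesis by (rule tendstoD) simp
  qed
  then have "\<forall>\<^sub>F z' in at z within Z. \<forall>j\<in>{..<n}. dist (z' j) (z j) < 1 / real (Suc n)"
    by (intro eventually_ball_finite) auto
  moreover have "\<forall>\<^sub>F z' in at z within Z. z' \<in> Z" by (simp add: eventually_at_filter)
  ultimately show "\<forall>\<^sub>F z' in at z within Z. dist (f z') (f z) < e"
  proof eventually_elim
    case (elim z')
    then have "near n z' z" by (simp add: near_def)
    then have "\<bar>f z' - f z\<bar> \<le> e / 2" using n elim(2) z by blast
    then show ?case using \<open>e > 0\<close> by (simp add: dist_real_def)
  qed
qed

lemma continuous_expected_cost_path:
  assumes "1 \<le> i" "s \<in> S"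
  shows "continuous_on Z (J i s)"
proof (rule continuous_on_paths)
  fix e :: real assume "e > 0"
  from expected_cost_modulus[OF this] obtain n where "\<forall>i\<ge>1. \<forall>s\<in>S. \<forall>s'\<in>S. \<forall>z\<in>Z. \<forall>z'\<in>Z.
      strategies_near n s s' \<longrightarrow> near n z z' \<longrightarrow> \<bar>J i s z - J i s' z'\<bar> \<le> e" ..
  then show "\<exists>n. \<forall>z\<in>Z. \<forall>z'\<in>Z. near n z z' \<longrightarrow> \<bar>J i s z - J i s z'\<bar> \<le> e"
    using assms by (intro exI[of _ n]) simp
qed

text \<open>By (A1) all decision makers share spaces and strategy sets, so this single topology
  serves for all of them, and mixed strategies of different decision makers are literally the same
  measures.\<close>

definition "stop = subtopology (product_topology dtop T) S"

abbreviation "\<Gamma> \<equiv> borel_probs stop"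

lemma strategy_top_eq:
  assumes "1 \<le> i"
  shows "strategy_top G i = stop"
proof -
  have "decision_top G i = dtop"
    by (rule ext) (simp only: decision_top_def history_top_eq[OF assms] history_top_eq[OF
        order_refl] same_spaces[OF assms] same_spaces[OF order_refl])
  then show ?thesis by (simp only: strategy_top_def stop_def same_spaces[OF assms])
qed

lemma mixed_strategies_eq: "1 \<le> i \<Longrightarrow> mixed_strategies G i = \<Gamma>"
  unfolding mixed_strategies_def by (simp only: strategy_top_eq)

lemma topspace_stop: "topspace stop = S"
proof -
  obtain St where St: "S = PiE T St" "\<And>t. t \<in> T \<Longrightarrow> compactin (dtop t) (St t)"
    using strategies_product by metis
  have "S \<subseteq> PiE T (\<lambda>t. topspace (dtop t))"
    unfolding St(1) by (intro PiE_mono compactin_subset_topspace St(2))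
  then show ?thesis unfolding stop_def topspace_subtopology topspace_product_topology o_def by blast
qed

lemma compact_space_stop: "compact_space stop"
proof -
  obtain St where St: "S = PiE T St" "\<And>t. t \<in> T \<Longrightarrow> compactin (dtop t) (St t)"
    using strategies_product by metis
  have "compactin (product_topology dtop T) S"
    unfolding St(1) compactin_PiE using St(2) by blast
  then show ?thesis unfolding stop_def by (rule compact_space_subtopology)
qed

lemma S_nonempty: "S \<noteq> {}"
proof -
  obtain St where "S = PiE T St" "\<And>t. t \<in> T \<Longrightarrow> St t \<noteq> {}"
    using strategies_product by metis
  then show ?thesis by (simp add: PiE_eq_empty_iff)
qed

text \<open>Projections to single stages are continuous into the supremum metric, and
  \<open>strategies_near n\<close> involves only stages below \<open>n\<close>.\<close>

lemma eventually_strategies_near: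
  assumes s: "s \<in> S"
  shows "\<forall>\<^sub>F s' in atin stop s. s' \<in> S \<and> strategies_near n s' s"
proof -
  have ev: "\<forall>\<^sub>F s' in atin stop s. s' \<in> S"
    using s by (auto simp: eventually_atin topspace_stop intro!: exI[of _ S] simp flip: topspace_stop)
  have close: "\<forall>\<^sub>F s' in atin stop s. \<forall>h\<in>hist j. dist (s' j h) (s j h) < 1 / real (Suc n)" if j:
      "j \<in> T" for j
  proof -
    interpret d: Metric_space "mspace (decision_metric j)" "mdist (decision_metric j)"
      by (rule Metric_space_mspace_mdist)
    have top: "dtop j = d.mtopology" unfolding decision_top_def U_def mtopology_of_def ..
    have "continuous_map stop (dtop j) (\<lambda>s. s j)"
      unfolding stop_def by (intro continuous_map_from_subtopology continuous_map_product_projection j)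
    then have "limitin d.mtopology (\<lambda>s. s j) (s j) (atin stop s)"
      using s unfolding continuous_map_atin topspace_stop top by blast
    then have "\<forall>\<^sub>F s' in atin stop s. s' j \<in> mspace (decision_metric j) \<and>
        mdist (decision_metric j) (s' j) (s j) < 1 / real (Suc n)"
      unfolding d.limitin_metric by (simp del: mspace_cfunspace of_nat_Suc)
    then show ?thesis
    proof eventually_elim
      case (elim s')
      show ?case
        using decision_metric_dist[OF conjunct1[OF elim] strategy_in_decision_metric[OF s j]]
            conjunct2[OF elim]
        by (meson order_le_less_trans)
    qed
  qed
  have "\<forall>\<^sub>F s' in atin stop s. \<forall>j\<in>T \<inter> {..<n}. \<forall>h\<in>hist j. dist (s' j h) (s j h) < 1 / real (Suc n)"
  proof (rule eventually_ball_finite)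
    show "\<forall>j\<in>T \<inter> {..<n}. \<forall>\<^sub>F s' in atin stop s. \<forall>h\<in>hist j. dist (s' j h) (s j h) < 1 / real (Suc n)"
      using close by (intro ballI) (simp only: Int_iff)
  qed simp
  with ev show ?thesis
  proof eventually_elim
    case (elim s')
    have "dist (s' j h) (s j h) < 1 / real (Suc n)" if "j \<in> T" "j < n" "h \<in> hist j" for j h
      by (rule bspec[OF bspec[OF elim(2) IntI[OF that(1) lessThan_iff[THEN iffD2, OF that(2)]]]
          that(3)])
    then show ?case unfolding strategies_near_def by (intro conjI elim(1) ballI impI)
  qed
qed

lemma continuous_expected_cost_strategy:
  assumes "1 \<le> i" "z \<in> Z"
  shows "continuous_map stop euclideanreal (\<lambda>s. J i s z)"
  unfolding continuous_map_atin topspace_stop limitin_canonical_iff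
proof (intro ballI tendstoI)
  fix s and e :: real assume s: "s \<in> S" and e: "e > 0"
  then have "e / 2 > 0" by simp
  from expected_cost_modulus[OF this] obtain n where n: "\<forall>i\<ge>1. \<forall>s\<in>S. \<forall>s'\<in>S. \<forall>z\<in>Z. \<forall>z'\<in>Z.
      strategies_near n s s' \<longrightarrow> near n z z' \<longrightarrow> \<bar>J i s z - J i s' z'\<bar> \<le> e / 2" ..
  have nz: "near n z z" by (simp add: near_def)
  from eventually_strategies_near[OF s, of n]
  show "\<forall>\<^sub>F s' in atin stop s. dist (J i s' z) (J i s z) < e"
  proof eventually_elim
    case (elim s')
    then have "\<bar>J i s' z - J i s z\<bar> \<le> e / 2" using n assms s nz by blast
    then show ?case using e by (simp add: dist_real_def)
  qed
qed

lemma measurable_expected_cost_strategy: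
  assumes "1 \<le> i" "z \<in> Z" "\<gamma> \<in> \<Gamma>"
  shows "(\<lambda>s. J i s z) \<in> borel_measurable \<gamma>"
proof -
  have "sets \<gamma> = sets (borel_of stop)" using assms(3) by (simp add: borel_probs_def)
  then show ?thesis
    using borel_measurable_borel_of[OF continuous_expected_cost_strategy[OF assms(1,2)]]
        measurable_cong_sets by blast
qed

lemma mixed_strategiesD:
  assumes "\<gamma> \<in> \<Gamma>"
  shows "prob_space \<gamma>" "space \<gamma> = S"
proof -
  have "sets \<gamma> = sets (borel_of stop)" "prob_space \<gamma>"
    using assms by (auto simp: borel_probs_def)
  then show "prob_space \<gamma>" "space \<gamma> = S"
    using sets_eq_imp_space_eq[of \<gamma> "borel_of stop"] by (simp_all add: topspace_stop)
qed

lemma integrable_expected_cost_strategy: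
  assumes "1 \<le> i" "z \<in> Z" "\<gamma> \<in> \<Gamma>"
  shows "integrable \<gamma> (\<lambda>s. J i s z)"
proof -
  interpret prob_space \<gamma> by (rule mixed_strategiesD[OF assms(3)])
  obtain B where "\<forall>i\<ge>1. \<forall>s\<in>S. \<forall>z\<in>Z. \<bar>J i s z\<bar> \<le> B" using expected_cost_bounded by blast
  then show ?thesis
    using assms mixed_strategiesD(2)[OF assms(3)]
    by (intro integrable_const_bound[where B = B] measurable_expected_cost_strategy) auto
qed

text \<open>Reduces deviations to mixed strategies to deviations to pure ones.\<close>

lemma mixed_lower_bound:
  assumes "1 \<le> i" "z \<in> Z" "\<gamma> \<in> \<Gamma>" "\<And>s. s \<in> S \<Longrightarrow> c \<le> J i s z"
  shows "c \<le> (LINT s|\<gamma>. J i s z)"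
proof -
  interpret prob_space \<gamma> by (rule mixed_strategiesD[OF assms(3)])
  have "(LINT s|\<gamma>. c) \<le> (LINT s|\<gamma>. J i s z)"
    using assms(4) mixed_strategiesD(2)[OF assms(3)]
    by (intro integral_mono integrable_expected_cost_strategy assms(1-3)) auto
  then show ?thesis by (simp add: prob_space)
qed

text \<open>Provides Borel measurability in the path, for integrals against Dirac measures and
  against the law of the environment.\<close>

lemma continuous_mixed_cost_path:
  assumes i: "1 \<le> i" and \<gamma>: "\<gamma> \<in> \<Gamma>"
  shows "continuous_on Z (\<lambda>z. LINT s|\<gamma>. J i s z)"
proof (rule continuous_on_paths)
  interpret prob_space \<gamma> by (rule mixed_strategiesD[OF \<gamma>])
  fix e :: real assume "e > 0"
  from expected_cost_modulus[OF this] obtain n where n: "\<forall>i\<ge>1. \<forall>s\<in>S. \<forall>s'\<in>S. \<forall>z\<in>Z. \<forall>z'\<in>Z.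
      strategies_near n s s' \<longrightarrow> near n z z' \<longrightarrow> \<bar>J i s z - J i s' z'\<bar> \<le> e" ..
  have "\<bar>(LINT s|\<gamma>. J i s z) - (LINT s|\<gamma>. J i s z')\<bar> \<le> e" if z: "z \<in> Z" "z' \<in> Z" "near n z z'" for z z'
  proof -
    have "\<bar>(LINT s|\<gamma>. J i s z) - (LINT s|\<gamma>. J i s z')\<bar> = \<bar>LINT s|\<gamma>. J i s z - J i s z'\<bar>"
      using integrable_expected_cost_strategy[OF i _ \<gamma>] z by simp
    also have "\<dots> \<le> (LINT s|\<gamma>. \<bar>J i s z - J i s z'\<bar>)" by (rule integral_abs_bound)
    also have "\<dots> \<le> (LINT s|\<gamma>. e)"
      using n i z mixed_strategiesD(2)[OF \<gamma>]
      by (intro integral_mono integrable_abs Bochner_Integration.integrable_diff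
          integrable_expected_cost_strategy \<gamma>) auto
    finally show ?thesis by (simp add: prob_space)
  qed
  then show "\<exists>n. \<forall>z\<in>Z. \<forall>z'\<in>Z. near n z z' \<longrightarrow> \<bar>(LINT s|\<gamma>. J i s z) - (LINT s|\<gamma>. J i s z')\<bar> \<le> e"
    by blast
qed

lemma expected_cost_minimizer:
  assumes "1 \<le> i" "z \<in> Z"
  obtains s where "s \<in> S" "\<And>s'. s' \<in> S \<Longrightarrow> J i s z \<le> J i s' z"
proof -
  have "compactin euclideanreal ((\<lambda>s. J i s z) ` S)"
    using image_compactin[OF _ continuous_expected_cost_strategy[OF assms]] compact_space_stop
    by (simp add: compact_space_def topspace_stop)
  then have "compact ((\<lambda>s. J i s z) ` S)" by simp
  then show ?thesis using compact_attains_inf[of "(\<lambda>s. J i s z) ` S"] S_nonempty that by auto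
qed

text \<open>Pure best replies to a deterministic path are seen by \<^const>\<open>best_replies\<close> through Dirac
  measures, which is how condition (B1) is used.\<close>

lemma mixed_cost_Dirac:
  assumes i: "1 \<le> i" and s: "s \<in> S" and z: "z \<in> Z"
  shows "mixed_cost G i (return (borel_of stop) s) (return (borel_of (path_top G)) z) = J i s z"
proof -
  have inner: "(LINT s'|return (borel_of stop) s. J i s' z') = J i s z'" if "z' \<in> Z" for z'
    using s by (intro integral_return borel_measurable_borel_of
        continuous_expected_cost_strategy[OF i that])
      (simp add: topspace_stop)
  have "mixed_cost G i (return (borel_of stop) s) (return (borel_of (path_top G)) z) =
      (LINT z'|return (borel_of (path_top G)) z. J i s z')"
    unfolding mixed_cost_def
    by (intro Bochner_Integration.integral_cong refl inner) (simp add: path_top_eq)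
  also have "\<dots> = J i s z"
    using z continuous_expected_cost_path[OF i s]
    by (intro integral_return borel_measurable_borel_of) (simp_all add: path_top_eq)
  finally show ?thesis .
qed

lemma Dirac_mixed_strategy:
  assumes "s \<in> S"
  shows "return (borel_of stop) s \<in> \<Gamma>"
  using assms by (auto simp: borel_probs_def topspace_stop intro!: prob_space_return)

lemma Dirac_path_law:
  assumes "z \<in> Z"
  shows "return (borel_of (path_top G)) z \<in> borel_probs (path_top G)"
  using assms by (auto simp: borel_probs_def path_top_eq intro!: prob_space_return)

text \<open>A pure minimizer for the first decision maker is, as a Dirac measure, optimal among its
  mixed strategies; (B1) makes the same measure a best reply of \<open>i\<close>, and testing it
  against the Dirac measure at \<open>s'\<close> returns to pure strategies.\<close>

lemma common_pure_best_reply: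
  assumes i: "1 \<le> i" and z: "z \<in> Z" and s: "s \<in> S" and min: "\<And>s'. s' \<in> S \<Longrightarrow> J 1 s z \<le> J 1 s' z"
    and s': "s' \<in> S"
  shows "J i s z \<le> J i s' z"
proof -
  let ?\<zeta> = "return (borel_of (path_top G)) z" and ?d = "\<lambda>s. return (borel_of stop) s"
  have mixed: "mixed_cost G 1 \<gamma> ?\<zeta> = (LINT s|\<gamma>. J 1 s z)" if "\<gamma> \<in> \<Gamma>" for \<gamma>
    unfolding mixed_cost_def
    using z continuous_mixed_cost_path[OF order_refl that]
    by (intro integral_return borel_measurable_borel_of) (simp_all add: path_top_eq)
  have "?d s \<in> best_replies G 1 ?\<zeta>"
    unfolding best_replies_def mixed_strategies_eq[OF order_refl]
  proof (intro CollectI conjI ballI)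
    show "?d s \<in> \<Gamma>" by (rule Dirac_mixed_strategy[OF s])
    fix \<gamma>' assume \<gamma>': "\<gamma>' \<in> \<Gamma>"
    show "mixed_cost G 1 (?d s) ?\<zeta> \<le> mixed_cost G 1 \<gamma>' ?\<zeta>"
      unfolding mixed[OF \<gamma>'] mixed_cost_Dirac[OF order_refl s z]
      by (rule mixed_lower_bound[OF order_refl z \<gamma>' min])
  qed
  moreover have "best_replies G 1 ?\<zeta> = best_replies G i ?\<zeta>"
    using B1 i Dirac_path_law[OF z] unfolding cond_B1_def identical_dms_def by blast
  ultimately have "mixed_cost G i (?d s) ?\<zeta> \<le> mixed_cost G i (?d s') ?\<zeta>"
    using Dirac_mixed_strategy[OF s'] unfolding best_replies_def mixed_strategies_eq[OF i] by blast
  then show ?thesis by (simp only: mixed_cost_Dirac[OF i s z] mixed_cost_Dirac[OF i s' z])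
qed

subsection \<open>Mean-field dynamics\<close>

lemma zero_in_stages: "0 \<in> T"
  using game_seq by (simp add: game_sequence_def stages_def zero_enat_def)

text \<open>In an induction over time only the coordinates before \<open>t\<close> are known to lie
  in \<open>Y\<close>, while \<open>AD\<close> speaks of complete paths. Filling up with an
  arbitrary \<open>y0\<close> is invisible to a non-anticipating rule.\<close>

lemma feedback_aggregate_in_D:
  assumes nonant: "\<And>t z z'. (\<And>j. j < t \<Longrightarrow> z j = z' j) \<Longrightarrow> A t z = A t z'"
    and AD: "\<And>t z. t \<in> T \<Longrightarrow> z \<in> Z \<Longrightarrow> A t z \<in> D"
    and t: "t \<in> T" and z: "\<And>j. j < t \<Longrightarrow> z j \<in> Y"
  shows "A t z \<in> D"
proof -
  obtain y0 where "y0 \<in> Y" using compact_spaces by blast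
  define z' where "z' = (\<lambda>j\<in>T. if j < t then z j else y0)"
  have "z' \<in> Z" using z \<open>y0 \<in> Y\<close> by (auto simp: z'_def)
  moreover have "A t z = A t z'"
    using stages_downward[OF t] by (intro nonant) (auto simp: z'_def)
  ultimately show ?thesis using AD t by simp
qed

lemma driven_state_in_E:
  assumes "{..<t} \<subseteq> T" "\<And>j. j < t \<Longrightarrow> d j \<in> D"
  shows "driven_state G d t \<in> E"
  using assms
proof (induction t)
  case 0
  show ?case using game_parts(2) by simp
next
  case (Suc t)
  then have "{..<t} \<subseteq> T" "t \<in> T" by auto
  with Suc have "(driven_state G d t, d t) \<in> E \<times> D" by simp
  then show ?case using env_maps(3)[OF \<open>t \<in> T\<close>] by auto
qed

lemma feedback_path_in_Z:
  assumes nonant: "\<And>t z z'. (\<And>j. j < t \<Longrightarrow> z j = z' j) \<Longrightarrow> A t z = A t z'"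
    and AD: "\<And>t z. t \<in> T \<Longrightarrow> z \<in> Z \<Longrightarrow> A t z \<in> D"
  shows "feedback_path G A \<in> Z"
proof -
  define P where "P = feedback_path G A"
  have PP: "P = driven_path G (\<lambda>t. A t P)"
    unfolding P_def by (rule feedback_path_eq_driven_path[OF nonant])
  have "P t \<in> Y" if "t \<in> T" for t
    using that
  proof (induction t rule: less_induct)
    case (less t)
    have Y: "P j \<in> Y" if "j < t" for j
      using less.IH[OF that] stages_downward[OF less.prems, of j] that by simp
    have d: "A j P \<in> D" if "j \<le> t" for j
      using Y that by (intro feedback_aggregate_in_D[OF nonant AD stages_downward[OF less.prems
          that]]) auto
    have "driven_state G (\<lambda>t. A t P) t \<in> E"
      using stages_downward[OF less.prems] d by (intro driven_state_in_E) auto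
    then have "env_out G t (driven_state G (\<lambda>t. A t P) t, A t P) \<in> Y"
      using env_maps(4)[OF less.prems] d by auto
    moreover have "P t = env_out G t (driven_state G (\<lambda>t. A t P) t, A t P)"
      by (subst PP) (simp add: driven_path_def less.prems)
    ultimately show ?case by simp
  qed
  moreover have "P \<in> extensional T" by (simp add: P_def feedback_path_def)
  ultimately show ?thesis by (auto simp: P_def PiE_iff)
qed

text \<open>By \<open>step\<close>, aggregates agree asymptotically once the earlier environment
  variables do; continuity of \<open>env_step\<close> and \<open>env_out\<close> closes the loop.
  The bound \<open>n\<close> lets \<open>step\<close> be verified on a finite window only.\<close>

lemma tendsto_dist_driven_path:
  fixes F :: "'k filter"
  assumes D: "\<forall>\<^sub>F k in F. \<forall>t\<in>T. d k t \<in> D \<and> d' k t \<in> D"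
    and step: "\<And>t. t \<in> T \<Longrightarrow> t < n \<Longrightarrow>
      (\<And>j. j < t \<Longrightarrow> ((\<lambda>k. dist (driven_path G (d k) j) (driven_path G (d' k) j)) \<longlongrightarrow> 0) F) \<Longrightarrow>
      ((\<lambda>k. dist (d k t) (d' k t)) \<longlongrightarrow> 0) F"
    and t: "t \<in> T" "t < n"
  shows "((\<lambda>k. dist (driven_path G (d k) t) (driven_path G (d' k) t)) \<longlongrightarrow> 0) F"
proof -
  have "((\<lambda>k. dist (d k t) (d' k t)) \<longlongrightarrow> 0) F \<and>
    ((\<lambda>k. dist (driven_state G (d k) t) (driven_state G (d' k) t)) \<longlongrightarrow> 0) F \<and>
    ((\<lambda>k. dist (driven_path G (d k) t) (driven_path G (d' k) t)) \<longlongrightarrow> 0) F"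
    using t
  proof (induction t rule: less_induct)
    case (less t)
    have IH: "((\<lambda>k. dist (d k j) (d' k j)) \<longlongrightarrow> 0) F"
      "((\<lambda>k. dist (driven_state G (d k) j) (driven_state G (d' k) j)) \<longlongrightarrow> 0) F"
      "((\<lambda>k. dist (driven_path G (d k) j) (driven_path G (d' k) j)) \<longlongrightarrow> 0) F" if "j < t" for j
      using less.IH[OF that] stages_downward[OF less.prems(1), of j] less.prems(2) that by simp_all
    have dt: "((\<lambda>k. dist (d k t) (d' k t)) \<longlongrightarrow> 0) F"
      by (rule step[OF less.prems IH(3)])
    have mem: "\<forall>\<^sub>F k in F. (driven_state G (d k) j, d k j) \<in> E \<times> D \<and> (driven_state G (d' k) j, d'
        k j) \<in> E \<times> D"
      if "j \<le> t" for j
      using D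
    proof eventually_elim
      case (elim k)
      have "\<And>i. i \<le> j \<Longrightarrow> i \<in> T" using stages_downward[OF less.prems(1)] that by simp
      then show ?case using elim by (auto intro!: driven_state_in_E)
    qed
    have et: "((\<lambda>k. dist (driven_state G (d k) t) (driven_state G (d' k) t)) \<longlongrightarrow> 0) F"
    proof (cases t)
      case (Suc r)
      then have r: "r < t" "r \<le> t" "r \<in> T" using stages_downward[OF less.prems(1)] by auto
      have "((\<lambda>k. dist (env_step G r (driven_state G (d k) r, d k r)) (env_step G r (driven_state
          G (d' k) r, d' k r))) \<longlongrightarrow> 0) F"
        by (rule compact_continuous_tendsto[OF compact_Times[OF compact_spaces(5,6)]
            env_maps(1)[OF r(3)] mem[OF r(2)]])
          (intro tendsto_dist_Pair IH r)
      then show ?thesis by (simp add: Suc)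
    qed simp
    have "((\<lambda>k. dist (env_out G t (driven_state G (d k) t, d k t)) (env_out G t (driven_state G
        (d' k) t, d' k t))) \<longlongrightarrow> 0) F"
      by (rule compact_continuous_tendsto[OF compact_Times[OF compact_spaces(5,6)] env_maps(2)[OF
          less.prems(1)] mem[OF order_refl]])
        (intro tendsto_dist_Pair et dt)
    then show ?case using dt et less.prems(1) by (simp add: driven_path_def)
  qed
  then show ?thesis by blast
qed

section \<open>States and controls along a prescribed path\<close>

definition "state_control i s z t \<omega> =
  (dm_state G i s (init_state G i \<omega>) (noise_path i \<omega>) z t,
   dm_control G i s (init_state G i \<omega>) (noise_path i \<omega>) z t)"

definition "mean_state_control i s z t = (LINT \<omega>|M. state_control i s z t \<omega>)"

lemma state_control_in:
  assumes "1 \<le> i" "s \<in> S" "z \<in> Z" "t \<in> T" "\<omega> \<in> space M"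
  shows "state_control i s z t \<omega> \<in> X \<times> U"
proof -
  have "{..<t} \<subseteq> T" using stages_downward[OF assms(4)] by auto
  from admissible_ranges(1,3)[OF admissible_sample[OF assms(1,2,3,5)] this] assms(4)
  show ?thesis by (simp add: state_control_def)
qed

lemma state_control_bounded:
  obtains R where "0 < R" "\<And>a. a \<in> X \<times> U \<Longrightarrow> norm a \<le> R"
  using compact_imp_bounded[OF compact_Times[OF compact_spaces(1,2)]] unfolding bounded_pos by blast

lemma measurable_state_control:
  assumes "1 \<le> i" "s \<in> S" "z \<in> Z" "t \<in> T"
  shows "state_control i s z t \<in> borel_measurable M"
proof -
  have "{..<t} \<subseteq> T" using stages_downward[OF assms(4)] by auto
  then have "(\<lambda>\<omega>. state_control i s z t \<omega>) \<in> borel_measurable M"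
    unfolding state_control_def
    by (intro borel_measurable_Pair measurable_sample_trajectory assms)
  then show ?thesis .
qed

lemma integrable_state_control:
  assumes "1 \<le> i" "s \<in> S" "z \<in> Z" "t \<in> T"
  shows "integrable M (state_control i s z t)"
proof -
  interpret prob_space M by (rule prob_space_sample)
  obtain R where R: "0 < R" "\<And>a. a \<in> X \<times> U \<Longrightarrow> norm a \<le> R" by (rule state_control_bounded) blast
  show ?thesis
    by (rule integrable_const_bound[where B = R])
      (use R(2)[OF state_control_in[OF assms]] measurable_state_control[OF assms] in auto)
qed

lemma state_control_cong:
  assumes "\<And>j. j < t \<Longrightarrow> z j = z' j"
  shows "state_control i s z t \<omega> = state_control i s z' t \<omega>"
  unfolding state_control_def
  using dm_state_cong[of t z z' "noise_path i \<omega>" "noise_path i \<omega>" G i s "init_state G i \<omega>"]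
    dm_control_cong[of t z z' "noise_path i \<omega>" "noise_path i \<omega>" G i s "init_state G i \<omega>"] assms by simp

lemma state_control_modulus:
  assumes "t \<in> T" "e > 0"
  shows "\<exists>n. \<forall>i\<ge>1. \<forall>s\<in>S. \<forall>z\<in>Z. \<forall>z'\<in>Z. \<forall>\<omega>\<in>space M.
      (\<forall>j<t. dist (z j) (z' j) < 1 / real (Suc n)) \<longrightarrow>
      dist (state_control i s z t \<omega>) (state_control i s z' t \<omega>) \<le> e"
proof -
  \<comment> \<open>The distance of pairs is at most the sum of the two component distances.\<close>
  have "e / 2 > 0" using assms(2) by simp
  from trajectory_modulus[OF assms(1) this] obtain n where
    n: "\<forall>i s a v z z'. admissible i s a v z \<longrightarrow> admissible i s a v z' \<longrightarrow>
      (\<forall>j<t. dist (z j) (z' j) < 1 / real (Suc n)) \<longrightarrow>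
      dist (dm_state G i s a v z t) (dm_state G i s a v z' t) < e / 2 \<and>
      dist (dm_control G i s a v z t) (dm_control G i s a v z' t) < e / 2" ..
  show ?thesis
  proof (intro exI[of _ n] allI ballI impI)
    fix i :: nat and s z z' \<omega>
    assume i: "1 \<le> i" and s: "s \<in> S" and z: "z \<in> Z" "z' \<in> Z" and \<omega>: "\<omega> \<in> space M"
      and near: "\<forall>j<t. dist (z j) (z' j) < 1 / real (Suc n)"
    from n[rule_format, OF admissible_sample[OF i s z(1) \<omega>] admissible_sample[OF i s z(2) \<omega>]] near
    show "dist (state_control i s z t \<omega>) (state_control i s z' t \<omega>) \<le> e"
      unfolding state_control_def dist_Pair_Pair
      by (intro order_trans[OF sqrt_sum_squares_le_sum]) auto
  qed
qed

lemma mean_state_control_modulus: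
  assumes "t \<in> T" "e > 0"
  shows "\<exists>n. \<forall>i\<ge>1. \<forall>s\<in>S. \<forall>z\<in>Z. \<forall>z'\<in>Z.
      (\<forall>j<t. dist (z j) (z' j) < 1 / real (Suc n)) \<longrightarrow>
      dist (mean_state_control i s z t) (mean_state_control i s z' t) \<le> e"
proof -
  interpret prob_space M by (rule prob_space_sample)
  from state_control_modulus[OF assms] obtain n where
    n: "\<forall>i\<ge>1. \<forall>s\<in>S. \<forall>z\<in>Z. \<forall>z'\<in>Z. \<forall>\<omega>\<in>space M.
      (\<forall>j<t. dist (z j) (z' j) < 1 / real (Suc n)) \<longrightarrow>
      dist (state_control i s z t \<omega>) (state_control i s z' t \<omega>) \<le> e" ..
  show ?thesis
  proof (intro exI[of _ n] allI ballI impI)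
    fix i :: nat and s z z'
    assume i: "1 \<le> i" and s: "s \<in> S" and z: "z \<in> Z" "z' \<in> Z"
      and near: "\<forall>j<t. dist (z j) (z' j) < 1 / real (Suc n)"
    have int: "integrable M (\<lambda>\<omega>. state_control i s z t \<omega> - state_control i s z' t \<omega>)"
      by (intro Bochner_Integration.integrable_diff integrable_state_control i s z assms)
    have "dist (mean_state_control i s z t) (mean_state_control i s z' t)
        = norm (LINT \<omega>|M. state_control i s z t \<omega> - state_control i s z' t \<omega>)"
      unfolding mean_state_control_def dist_norm
      using integrable_state_control[OF i s _ assms(1)] z by simp
    also have "\<dots> \<le> (LINT \<omega>|M. norm (state_control i s z t \<omega> - state_control i s z' t \<omega>))"
      by (rule integral_norm_bound)
    also have "\<dots> \<le> (LINT \<omega>|M. e)"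
      using n[rule_format, OF i s z _ near[rule_format]]
      by (intro integral_mono integrable_norm int) (auto simp: dist_norm)
    finally show "dist (mean_state_control i s z t) (mean_state_control i s z' t) \<le> e"
      by (simp add: prob_space)
  qed
qed

lemma tendsto_mean_state_control:
  assumes "1 \<le> i" "s \<in> S" "t \<in> T" "z0 \<in> Z" "\<forall>\<^sub>F k in F. z k \<in> Z"
    and "\<And>j. j < t \<Longrightarrow> ((\<lambda>k. dist (z k j) (z0 j)) \<longlongrightarrow> 0) F"
  shows "((\<lambda>k. mean_state_control i s (z k) t) \<longlongrightarrow> mean_state_control i s z0 t) F"
proof (rule tendstoI)
  fix e :: real assume e: "e > 0"
  then have "e / 2 > 0" by simp
  from mean_state_control_modulus[OF assms(3) this] obtain n where
    n: "\<forall>i\<ge>1. \<forall>s\<in>S. \<forall>z\<in>Z. \<forall>z'\<in>Z.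
      (\<forall>j<t. dist (z j) (z' j) < 1 / real (Suc n)) \<longrightarrow>
      dist (mean_state_control i s z t) (mean_state_control i s z' t) \<le> e / 2" ..
  have "\<forall>\<^sub>F k in F. \<forall>j\<in>{..<t}. dist (z k j) (z0 j) < 1 / real (Suc n)"
    by (rule eventually_ball_finite) (auto intro!: order_tendstoD(2)[OF assms(6)])
  with assms(5) show "\<forall>\<^sub>F k in F. dist (mean_state_control i s (z k) t) (mean_state_control i s z0
      t) < e"
  proof eventually_elim
    case (elim k)
    then have "dist (mean_state_control i s (z k) t) (mean_state_control i s z0 t) \<le> e / 2"
      using n[rule_format, OF assms(1,2) elim(1) assms(4)] by simp
    then show ?case using e by simp
  qed
qed

lemma average_in_D:
  assumes "1 \<le> N" "t \<in> T" "\<And>i. i \<in> {1..N} \<Longrightarrow> p i \<in> X \<times> U"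
  shows "(1 / real N) *\<^sub>R (\<Sum>i\<in>{1..N}. p i) \<in> D"
    and "aggr G N t (\<lambda>i\<in>{1..N}. fst (p i)) (\<lambda>i\<in>{1..N}. snd (p i)) = (1 / real N) *\<^sub>R (\<Sum>i\<in>{1..N}. p i)"
proof -
  let ?x = "\<lambda>i\<in>{1..N}. fst (p i)" and ?u = "\<lambda>i\<in>{1..N}. snd (p i)"
  have x: "?x \<in> PiE {1..N} (states G)" and u: "?u \<in> PiE {1..N} (controls G)"
    using assms(3) by (auto simp: PiE_iff mem_Times_iff)
  then have "(?x, ?u) \<in> profiles G N" by (simp add: profiles_def)
  then have "aggr G N t ?x ?u = (1 / real N) *\<^sub>R (\<Sum>i\<in>{1..N}. (?x i, ?u i))"
    using B2 assms(1,2) unfolding cond_B2_def by blast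
  also have "(\<Sum>i\<in>{1..N}. (?x i, ?u i)) = (\<Sum>i\<in>{1..N}. p i)" by (intro sum.cong) auto
  finally show eq: "aggr G N t ?x ?u = (1 / real N) *\<^sub>R (\<Sum>i\<in>{1..N}. p i)" .
  have "aggr G N t ?x ?u \<in> D" using game_parts(5) assms(1,2) x u by blast
  then show "(1 / real N) *\<^sub>R (\<Sum>i\<in>{1..N}. p i) \<in> D" by (simp only: eq)
qed

text \<open>\<open>D\<close> is only known to contain the equally weighted averages of (B2), whereas
  the mean-field aggregate averages expectations with arbitrary weights. Maurey selection brings
  averages of \<open>N\<close> points within \<open>2 * R / sqrt N\<close> of any convex
  combination, and \<open>D\<close> is closed.\<close>

lemma convex_hull_subset_D: "convex hull (X \<times> U) \<subseteq> D"
proof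
  fix p assume "p \<in> convex hull (X \<times> U)"
  then obtain L u where L: "finite L" "L \<subseteq> X \<times> U" "\<forall>x\<in>L. 0 \<le> u x" "sum u L = 1" "(\<Sum>x\<in>L. u x *\<^sub>R x) = p"
    unfolding convex_hull_explicit by auto
  obtain R where R: "0 < R" "\<And>a. a \<in> X \<times> U \<Longrightarrow> norm a \<le> R" by (rule state_control_bounded) blast
  have "\<exists>d\<in>D. dist d p \<le> 2 * R / sqrt (Suc k)" for k
  proof -
    define N where "N = Suc k"
    then have N: "1 \<le> N" by simp
    have "\<exists>\<kappa>. (\<forall>i\<in>{1..N}. \<kappa> i \<in> L \<and> 0 < u (\<kappa> i)) \<and>
      (\<Sum>t\<in>{()}. (norm (\<Sum>i\<in>{1..N}. \<kappa> i - (\<Sum>l\<in>L. u l *\<^sub>R l)))\<^sup>2) \<le> card {1..N} * card {()} * (2 * R)\<^sup>2"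
      by (rule Maurey_selection) (use L R(2) in auto)
    then obtain \<kappa> where \<kappa>: "\<forall>i\<in>{1..N}. \<kappa> i \<in> L \<and> 0 < u (\<kappa> i)"
      "(\<Sum>t\<in>{()}. (norm (\<Sum>i\<in>{1..N}. \<kappa> i - (\<Sum>l\<in>L. u l *\<^sub>R l)))\<^sup>2) \<le> card {1..N} * card {()} * (2 * R)\<^sup>2"
      by blast
    define d where "d = (1 / real N) *\<^sub>R (\<Sum>i\<in>{1..N}. \<kappa> i)"
    \<comment> \<open>Membership is assumed stage by stage; stage 0 exists because the horizon is
      positive.\<close>
    have "d \<in> D" unfolding d_def using \<kappa>(1) L(2) by (intro average_in_D(1)[OF N zero_in_stages]) auto
    have "(norm (\<Sum>i\<in>{1..N}. \<kappa> i - p))\<^sup>2 \<le> real N * (2 * R)\<^sup>2" using \<kappa>(2) L(5) by simp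
    then have "norm (\<Sum>i\<in>{1..N}. \<kappa> i - p) \<le> sqrt (real N * (2 * R)\<^sup>2)" by (rule real_le_rsqrt)
    also have "\<dots> = sqrt N * (2 * R)" using R(1) by (simp add: real_sqrt_mult)
    finally have "norm (\<Sum>i\<in>{1..N}. \<kappa> i - p) / N \<le> sqrt N * (2 * R) / N" by (intro
        divide_right_mono) auto
    also have "sqrt N * (2 * R) / N = 2 * R / sqrt N"
      using N by (simp add: field_simps)
    also have "norm (\<Sum>i\<in>{1..N}. \<kappa> i - p) / N = dist d p"
    proof -
      have "d - p = (1 / real N) *\<^sub>R (\<Sum>i\<in>{1..N}. \<kappa> i - p)"
        using N by (simp add: d_def sum_subtractf scaleR_right_diff_distrib sum_constant_scaleR)
      then show ?thesis by (simp add: dist_norm)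
    qed
    finally show ?thesis using \<open>d \<in> D\<close> unfolding N_def by blast
  qed
  then obtain d where d: "\<And>k. d k \<in> D" "\<And>k. dist (d k) p \<le> 2 * R / sqrt (Suc k)" by metis
  have lim: "(\<lambda>k. 2 * R / sqrt (Suc k)) \<longlonglongrightarrow> 0"
    by real_asymp
  have "(\<lambda>k. dist (d k) p) \<longlonglongrightarrow> 0"
    by (rule tendsto_sandwich[OF _ _ tendsto_const lim]) (use d(2) in auto)
  then have "d \<longlonglongrightarrow> p" by (rule tendsto_dist_iff[THEN iffD2])
  then show "p \<in> D" by (rule closed_sequentially[OF compact_imp_closed[OF compact_spaces(6)] d(1)])
qed

text \<open>The average over \<open>i\<close> remains because dynamics and laws of primitives may
  differ between decision makers; it makes the mean-field path depend on \<open>N\<close>.\<close>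

definition "mean_field_aggregate N L sl lam t z =
  (1 / real N) *\<^sub>R (\<Sum>i\<in>{1..N}. \<Sum>l<L. lam l *\<^sub>R mean_state_control i (sl l) z t)"

definition "mean_field_path N L sl lam = feedback_path G (mean_field_aggregate N L sl lam)"

definition "weights L = {lam :: nat \<Rightarrow> real. (\<forall>l<L. 0 \<le> lam l) \<and> (\<Sum>l<L. lam l) = 1}"

lemma mean_field_aggregate_cong:
  assumes "\<And>j. j < t \<Longrightarrow> z j = z' j"
  shows "mean_field_aggregate N L sl lam t z = mean_field_aggregate N L sl lam t z'"
proof -
  have "state_control i s z t = state_control i s z' t" for i s
    using state_control_cong[of t z z'] assms by blast
  then show ?thesis by (simp add: mean_field_aggregate_def mean_state_control_def)
qed

text \<open>An expectation may leave \<open>X \<times> U\<close>, but not its convex hull, which is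
  compact in finite dimension.\<close>

lemma mean_state_control_in_convex_hull:
  assumes "1 \<le> i" "s \<in> S" "z \<in> Z" "t \<in> T"
  shows "mean_state_control i s z t \<in> convex hull (X \<times> U)"
proof -
  interpret prob_space M by (rule prob_space_sample)
  have "compact (convex hull (X \<times> U))"
    by (intro compact_convex_hull compact_Times compact_spaces)
  then show ?thesis unfolding mean_state_control_def
    using state_control_in[OF assms] hull_subset[of "X \<times> U" convex]
    by (intro expectation_in_closed_convex integrable_state_control assms convex_convex_hull)
      (auto intro: compact_imp_closed)
qed

lemma mean_field_aggregate_in_D:
  assumes N: "1 \<le> N" and sl: "\<And>l. l < L \<Longrightarrow> sl l \<in> S" and lam: "lam \<in> weights L"
    and t: "t \<in> T" and z: "z \<in> Z"
  shows "mean_field_aggregate N L sl lam t z \<in> D"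
proof -
  let ?C = "convex hull (X \<times> U)"
  have in_C: "(\<Sum>l<L. lam l *\<^sub>R mean_state_control i (sl l) z t) \<in> ?C" if "i \<in> {1..N}" for i
    using lam that sl t z
    by (intro convex_sum convex_convex_hull mean_state_control_in_convex_hull) (auto simp: weights_def)
  have "(\<Sum>i\<in>{1..N}. (1 / real N) *\<^sub>R (\<Sum>l<L. lam l *\<^sub>R mean_state_control i (sl l) z t)) \<in> ?C"
  proof (rule convex_sum[OF _ convex_convex_hull])
    show "(\<Sum>i\<in>{1..N}. 1 / real N) = 1" using N by simp
  qed (use in_C in simp_all)
  then show ?thesis
    using convex_hull_subset_D by (auto simp: mean_field_aggregate_def scaleR_sum_right)
qed

lemma mean_field_path_props:
  assumes "1 \<le> N" "\<And>l. l < L \<Longrightarrow> sl l \<in> S" "lam \<in> weights L"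
  shows "mean_field_path N L sl lam \<in> Z"
    and "mean_field_path N L sl lam = driven_path G (\<lambda>t. mean_field_aggregate N L sl lam t
        (mean_field_path N L sl lam))"
proof -
  let ?A = "mean_field_aggregate N L sl lam"
  have AD: "?A t z \<in> D" if "t \<in> T" "z \<in> Z" for t z
    by (rule mean_field_aggregate_in_D[OF assms that])
  show "mean_field_path N L sl lam \<in> Z"
    unfolding mean_field_path_def by (rule feedback_path_in_Z[OF mean_field_aggregate_cong AD])
  show "mean_field_path N L sl lam = driven_path G (\<lambda>t. ?A t (mean_field_path N L sl lam))"
    unfolding mean_field_path_def by (rule feedback_path_eq_driven_path[OF mean_field_aggregate_cong])
qed

text \<open>Weights enter the aggregate linearly, and the path enters through
  \<open>mean_state_control\<close>, which depends continuously on earlier coordinates;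
  \<open>tendsto_dist_driven_path\<close> supplies the induction over time.\<close>

lemma tendsto_mean_field_path:
  fixes F :: "'k filter"
  assumes N: "1 \<le> N" and sl: "\<And>l. l < L \<Longrightarrow> sl l \<in> S"
    and lam: "\<And>k. \<Lambda> k \<in> weights L" "lam \<in> weights L"
    and lim: "\<And>l. l < L \<Longrightarrow> ((\<lambda>k. \<Lambda> k l) \<longlongrightarrow> lam l) F"
    and t: "t \<in> T"
  shows "((\<lambda>k. mean_field_path N L sl (\<Lambda> k) t) \<longlongrightarrow> mean_field_path N L sl lam t) F"
proof -
  let ?P = "mean_field_path N L sl"
  let ?d = "\<lambda>lam t. mean_field_aggregate N L sl lam t (?P lam)"
  have P: "?P lam \<in> Z" "?P lam = driven_path G (?d lam)" if "lam \<in> weights L" for lam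
    using mean_field_path_props[OF N sl that] by auto
  have step: "((\<lambda>k. dist (?d (\<Lambda> k) t) (?d lam t)) \<longlongrightarrow> 0) F"
    if t: "t \<in> T" and IH: "\<And>j. j < t \<Longrightarrow> ((\<lambda>k. dist (?P (\<Lambda> k) j) (?P lam j)) \<longlongrightarrow> 0) F" for t
  proof -
    have "((\<lambda>k. mean_state_control i (sl l) (?P (\<Lambda> k)) t) \<longlongrightarrow> mean_state_control i (sl l) (?P lam) t) F"
      if "1 \<le> i" "l < L" for i l
      using that sl t P(1) lam IH by (intro tendsto_mean_state_control) auto
    then have "((\<lambda>k. ?d (\<Lambda> k) t) \<longlongrightarrow> ?d lam t) F"
      unfolding mean_field_aggregate_def by (intro tendsto_intros lim) auto
    then show ?thesis by (rule tendsto_dist_iff[THEN iffD1])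
  qed
  have "((\<lambda>k. dist (driven_path G (?d (\<Lambda> k)) t) (driven_path G (?d lam) t)) \<longlongrightarrow> 0) F"
  proof (rule tendsto_dist_driven_path[where n = "Suc t", OF _ _ t])
    show "\<forall>\<^sub>F k in F. \<forall>t\<in>T. ?d (\<Lambda> k) t \<in> D \<and> ?d lam t \<in> D"
      using mean_field_aggregate_in_D[OF N sl] lam P(1) by (intro always_eventually) auto
    show "((\<lambda>k. dist (?d (\<Lambda> k) r) (?d lam r)) \<longlongrightarrow> 0) F"
      if "r \<in> T" "\<And>j. j < r \<Longrightarrow> ((\<lambda>k. dist (driven_path G (?d (\<Lambda> k)) j) (driven_path G (?d lam) j))
          \<longlongrightarrow> 0) F" for r
      using that(2) by (intro step[OF that(1)]) (simp add: P(2)[OF lam(1), symmetric] P(2)[OF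
          lam(2), symmetric])
  qed simp
  then have "((\<lambda>k. dist (?P (\<Lambda> k) t) (?P lam t)) \<longlongrightarrow> 0) F"
    by (simp add: P(2)[OF lam(1), symmetric] P(2)[OF lam(2), symmetric])
  then show ?thesis by (rule tendsto_dist_iff[THEN iffD2])
qed

section \<open>Fixed point of the mean-field map\<close>

text \<open>A continuous substitute for \<open>near\<close>: the sum dominates each distance in the
  window, and its continuity is inherited by the bump functions built from it.\<close>

definition "path_gap n z z' = (\<Sum>j\<in>T \<inter> {..<n}. dist (z j) (z' j))"

lemma path_gap_near: "path_gap n z z' < 1 / real (Suc n) \<Longrightarrow> near n z z'"
  unfolding near_def
proof (intro ballI impI)
  fix j assume j: "j \<in> T" "j < n" and gap: "path_gap n z z' < 1 / real (Suc n)"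
  have "dist (z j) (z' j) \<le> path_gap n z z'"
    unfolding path_gap_def using j by (intro member_le_sum) auto
  with gap show "dist (z j) (z' j) < 1 / real (Suc n)" by simp
qed

lemma finite_path_net:
  obtains L :: nat and zl where "\<And>l. l < L \<Longrightarrow> zl l \<in> Z"
    "\<And>z. z \<in> Z \<Longrightarrow> \<exists>l<L. path_gap n z (zl l) < 1 / real (Suc n)"
proof -
  have "compact Z" by (intro compact_PiE_fun compact_spaces)
  have open_ball: "open {z. path_gap n z z0 < 1 / real (Suc n)}" for z0
    unfolding path_gap_def
    by (intro open_Collect_less continuous_intros continuous_on_product_coordinates)
  have cover: "Z \<subseteq> (\<Union>z0\<in>Z. {z. path_gap n z z0 < 1 / real (Suc n)})"
    by (auto simp: path_gap_def)
  obtain K where K: "K \<subseteq> Z" "finite K" "Z \<subseteq> (\<Union>z0\<in>K. {z. path_gap n z z0 < 1 / real (Suc n)})"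
    by (rule compactE_image[OF \<open>compact Z\<close> open_ball cover])
  obtain L :: nat and zl where zl: "K = zl ` {i. i < L}"
    using finite_imp_nat_seg_image_inj_on[OF K(2)] by blast
  show ?thesis
  proof (rule that[of L zl])
    show "zl l \<in> Z" if "l < L" for l using K(1) zl that by auto
    show "\<exists>l<L. path_gap n z (zl l) < 1 / real (Suc n)" if "z \<in> Z" for z using K(3) zl that by auto
  qed
qed

text \<open>A partition of unity subordinate to the net replaces the discontinuous choice of a best
  reply by a continuous map of weights: \<open>bump l\<close> is positive only where the path is
  close to \<open>zl l\<close>, and at a fixed point positive weight means positive bump.\<close>

lemma mean_field_equilibrium:
  assumes N: "1 \<le> N" and sl: "\<And>l. l < L \<Longrightarrow> sl l \<in> S"
    and net: "\<And>z. z \<in> Z \<Longrightarrow> \<exists>l<L. path_gap n z (zl l) < 1 / real (Suc n)"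
  shows "\<exists>lam\<in>weights L. \<forall>l<L. 0 < lam l \<longrightarrow> near n (mean_field_path N L sl lam) (zl l)"
proof -
  define P where "P = mean_field_path N L sl"
  define bump where "bump l z = max 0 (1 / real (Suc n) - path_gap n z (zl l))" for l z
  define total where "total z = (\<Sum>l<L. bump l z)" for z
  have bump_nonneg: "0 \<le> bump l z" for l z by (simp add: bump_def)
  have total_pos: "0 < total z" if z: "z \<in> Z" for z
  proof -
    obtain l where "l < L" "path_gap n z (zl l) < 1 / real (Suc n)" using net[OF z] by blast
    then show ?thesis unfolding total_def
      by (intro sum_pos2[of _ l]) (auto simp: bump_def)
  qed
  obtain y0 where "y0 \<in> Y" using compact_spaces by blast
  then have "(\<lambda>_\<in>T. y0) \<in> Z" by auto
  from net[OF this] have L: "0 < L" by auto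
  \<comment> \<open>A retraction onto the simplex: missing mass is spread evenly, excess mass is
    divided out. Brouwer's theorem can thus be used on a cube, and since the values of
    \<open>w\<close> sum to 1 the fixed point already lies in the simplex.\<close>
  define \<Lambda> where "\<Lambda> p l = (p l + max 0 (1 - (\<Sum>l<L. p l)) / L) / max 1 (\<Sum>l<L. p l)" for p :: "nat \<Rightarrow>
      real" and l
  define Q where "Q = {x :: nat \<Rightarrow> real. (\<forall>i<L. 0 \<le> x i \<and> x i \<le> 1) \<and> (\<forall>i\<ge>L. x i = 0)}"
  have \<Lambda>_weights: "\<Lambda> p \<in> weights L" if "\<And>l. l < L \<Longrightarrow> 0 \<le> p l" for p
  proof -
    have "(\<Sum>l<L. \<Lambda> p l) = ((\<Sum>l<L. p l) + max 0 (1 - (\<Sum>l<L. p l))) / max 1 (\<Sum>l<L. p l)"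
      using L by (simp add: \<Lambda>_def sum.distrib flip: sum_divide_distrib)
    also have "\<dots> = 1" by (auto simp: max_def)
    finally show ?thesis using that by (auto simp: weights_def \<Lambda>_def)
  qed
  define w where "w p l = bump l (P (\<Lambda> p)) / total (P (\<Lambda> p))" for p l
  have cont: "continuous_on Q (\<lambda>p. w p l)" if "l < L" for l
    unfolding continuous_on_def
  proof
    fix p0 assume p0: "p0 \<in> Q"
    let ?F = "at p0 within Q"
    \<comment> \<open>Clamping only serves to have weights for every argument, not just eventually.\<close>
    define clamp where "clamp p = (\<lambda>l. max 0 (p l))" for p :: "nat \<Rightarrow> real"
    have clamp_Q: "clamp p l = p l" if "p \<in> Q" for p l
      using that by (cases "l < L") (auto simp: clamp_def Q_def not_less)
    have coord: "((\<lambda>p. clamp p l) \<longlongrightarrow> clamp p0 l) ?F" for l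
    proof -
      have "((\<lambda>p. p l) \<longlongrightarrow> p0 l) ?F"
        using tendsto_ident_at[of p0 Q] by (simp add: tendsto_fun_iff)
      then show ?thesis unfolding clamp_def by (intro tendsto_intros)
    qed
    have "((\<lambda>p. \<Lambda> (clamp p) l) \<longlongrightarrow> \<Lambda> (clamp p0) l) ?F" for l
      unfolding \<Lambda>_def using L by (intro tendsto_intros coord) auto
    then have "((\<lambda>p. P (\<Lambda> (clamp p)) t) \<longlongrightarrow> P (\<Lambda> (clamp p0)) t) ?F" if "t \<in> T" for t
      unfolding P_def using \<Lambda>_weights that
      by (intro tendsto_mean_field_path N sl) (auto simp: clamp_def)
    then have "((\<lambda>p. bump l (P (\<Lambda> (clamp p)))) \<longlongrightarrow> bump l (P (\<Lambda> (clamp p0)))) ?F" for l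
      unfolding bump_def path_gap_def by (intro tendsto_intros) auto
    moreover have "total (P (\<Lambda> (clamp p0))) \<noteq> 0"
    proof -
      have "P (\<Lambda> (clamp p0)) \<in> Z" unfolding P_def
        by (intro mean_field_path_props(1) N sl \<Lambda>_weights) (auto simp: clamp_def)
      then show ?thesis using total_pos by force
    qed
    ultimately have "((\<lambda>p. w (clamp p) l) \<longlongrightarrow> w (clamp p0) l) ?F"
      unfolding w_def total_def by (intro tendsto_intros) auto
    moreover have "clamp p = p" if "p \<in> Q" for p using clamp_Q[OF that] by auto
    ultimately show "((\<lambda>p. w p l) \<longlongrightarrow> w p0 l) ?F"
      using p0 by (subst tendsto_cong[where g = "\<lambda>p. w (clamp p) l"]) (auto simp: eventually_at_filter)
  qed
  have PZ: "P (\<Lambda> p) \<in> Z" if "p \<in> Q" for p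
    unfolding P_def using that by (intro mean_field_path_props(1) N sl \<Lambda>_weights) (auto simp: Q_def)
  have range: "0 \<le> w p l \<and> w p l \<le> 1" if "p \<in> Q" "l < L" for p l
  proof -
    have "bump l (P (\<Lambda> p)) \<le> total (P (\<Lambda> p))"
      unfolding total_def using that bump_nonneg by (intro member_le_sum) auto
    then show ?thesis using total_pos[OF PZ[OF that(1)]] bump_nonneg by (simp add: w_def)
  qed
  obtain p where p: "p \<in> Q" "\<And>l. l < L \<Longrightarrow> w p l = p l"
    using Brouwer_finite_cube[of L w, folded Q_def, OF cont range] by blast
  have "(\<Sum>l<L. p l) = (\<Sum>l<L. w p l)" by (intro sum.cong) (auto simp: p(2))
  also have "\<dots> = 1"
    using total_pos[OF PZ[OF p(1)]] by (simp add: w_def total_def flip: sum_divide_distrib)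
  finally have sum_p: "(\<Sum>l<L. p l) = 1" .
  have \<Lambda>p: "\<Lambda> p l = p l" for l by (simp add: \<Lambda>_def sum_p)
  show ?thesis
  proof (intro bexI[of _ "\<Lambda> p"] allI impI)
    show "\<Lambda> p \<in> weights L" using p(1) by (intro \<Lambda>_weights) (auto simp: Q_def)
    fix l assume l: "l < L" "0 < \<Lambda> p l"
    have "bump l (P (\<Lambda> p)) = p l * total (P (\<Lambda> p))"
      using p(2)[OF l(1)] total_pos[OF PZ[OF p(1)]] by (simp add: w_def field_simps)
    then have "0 < bump l (P (\<Lambda> p))"
      using l(2) \<Lambda>p[of l] total_pos[OF PZ[OF p(1)]] by simp
    then have "path_gap n (P (\<Lambda> p)) (zl l) < 1 / real (Suc n)" by (simp add: bump_def max_def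
        split: if_splits)
    then show "near n (mean_field_path N L sl (\<Lambda> p)) (zl l)" unfolding P_def by (rule path_gap_near)
  qed
qed

subsection \<open>The finite population\<close>

definition "population_average N s z t \<omega> =
  (1 / real N) *\<^sub>R (\<Sum>i\<in>{1..N}. state_control i (s i) z t \<omega>)"

lemma population_aggregate_eq:
  assumes "1 \<le> N" "\<And>i. i \<in> {1..N} \<Longrightarrow> s i \<in> S" "z \<in> Z" "t \<in> T" "\<omega> \<in> space M"
  shows "population_aggregate G N s \<omega> t z = population_average N s z t \<omega>"
    and "population_aggregate G N s \<omega> t z \<in> D"
proof -
  have p: "state_control i (s i) z t \<omega> \<in> X \<times> U" if "i \<in> {1..N}" for i
    using that assms by (intro state_control_in) auto
  show eq: "population_aggregate G N s \<omega> t z = population_average N s z t \<omega>"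
    using average_in_D(2)[where p = "\<lambda>i. state_control i (s i) z t \<omega>", OF assms(1,4) p]
    unfolding population_aggregate_def population_average_def by (simp only: state_control_def
        fst_conv snd_conv)
  show "population_aggregate G N s \<omega> t z \<in> D"
    unfolding eq population_average_def by (rule average_in_D(1)[OF assms(1,4) p])
qed

lemma env_path_in_Z:
  assumes "1 \<le> N" "\<And>i. i \<in> {1..N} \<Longrightarrow> s i \<in> S" "\<omega> \<in> space M"
  shows "env_path G N s \<omega> \<in> Z"
  unfolding env_path_eq_feedback_path
  by (rule feedback_path_in_Z[OF population_aggregate_cong population_aggregate_eq(2)[OF
      assms(1,2) _ _ assms(3)]])

text \<open>Nearness to \<open>d\<close> is demanded only along the given path \<open>z\<close>,
  along which decision makers do not interact. The feedback through the realized path is controlled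
  time by time: averages along \<open>env_path\<close> and along \<open>z\<close> differ little as
  long as the paths have been close so far. One \<open>k\<close> works for all population sizes
  because the modulus of \<open>state_control\<close> is uniform in \<open>i\<close> and averaging
  does not amplify it.\<close>

lemma env_path_stability:
  "\<exists>k. \<forall>N s \<omega> d z. 1 \<le> N \<longrightarrow> (\<forall>i\<in>{1..N}. s i \<in> S) \<longrightarrow> \<omega> \<in> space M \<longrightarrow> z \<in> Z \<longrightarrow> z = driven_path G d \<longrightarrow>
     (\<forall>t\<in>T. d t \<in> D) \<longrightarrow> (\<forall>t\<in>T. t < n \<longrightarrow> dist (population_average N s z t \<omega>) (d t) < 1 / real (Suc k)) \<longrightarrow>
     near n (env_path G N s \<omega>) z"
proof (rule ccontr)
  define bad where "bad k N s \<omega> d z \<longleftrightarrow> 1 \<le> N \<and> (\<forall>i\<in>{1..N}. s i \<in> S) \<and> \<omega> \<in> space M \<and> z \<in> Z \<and> z =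
      driven_path G d \<and>
     (\<forall>t\<in>T. d t \<in> D) \<and> (\<forall>t\<in>T. t < n \<longrightarrow> dist (population_average N s z t \<omega>) (d t) < 1 / real (Suc k)) \<and>
     \<not> near n (env_path G N s \<omega>) z" for k N s \<omega> d z
  assume "\<not> ?thesis"
  then have "\<forall>k. \<exists>N s \<omega> d z. bad k N s \<omega> d z"
    by (simp only: bad_def not_ex not_all not_imp simp_thms)
  then obtain N s \<omega> d z where bad: "\<And>k. bad k (N k) (s k) (\<omega> k) (d k) (z k)" by metis
  have N: "1 \<le> N k" and s: "\<forall>i\<in>{1..N k}. s k i \<in> S" and \<omega>: "\<omega> k \<in> space M"
    and z: "z k \<in> Z" "z k = driven_path G (d k)" and d: "\<forall>t\<in>T. d k t \<in> D"
    and close: "\<forall>t\<in>T. t < n \<longrightarrow> dist (population_average (N k) (s k) (z k) t (\<omega> k)) (d k t) < 1 /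
        real (Suc k)"
    and far: "\<not> near n (env_path G (N k) (s k) (\<omega> k)) (z k)" for k
    using bad[of k] unfolding bad_def by - (elim conjE, assumption)+
  define y where "y k = env_path G (N k) (s k) (\<omega> k)" for k
  define a where "a k t = population_aggregate G (N k) (s k) (\<omega> k) t (y k)" for k t
  have y: "y k \<in> Z" "y k = driven_path G (a k)" for k
    unfolding a_def y_def by (rule env_path_in_Z[OF N bspec[OF s] \<omega>]) (assumption, rule
        env_path_eq_driven_path)
  have a: "a k t = population_average (N k) (s k) (y k) t (\<omega> k)" "a k t \<in> D" if "t \<in> T" for k t
    unfolding a_def
    using population_aggregate_eq[of "N k" "s k" "y k" t "\<omega> k", OF N bspec[OF s] y(1) that \<omega>] by blast+
  have step: "(\<lambda>k. dist (a k t) (d k t)) \<longlonglongrightarrow> 0"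
    if t: "t \<in> T" "t < n" and IH: "\<And>j. j < t \<Longrightarrow> (\<lambda>k. dist (y k j) (z k j)) \<longlonglongrightarrow> 0" for t
  proof -
    have 1: "(\<lambda>k. dist (population_average (N k) (s k) (y k) t (\<omega> k)) (population_average (N k) (s
        k) (z k) t (\<omega> k))) \<longlonglongrightarrow> 0"
    proof (rule tendstoI)
      fix e :: real assume e: "e > 0"
      then have "e / 2 > 0" by simp
      from state_control_modulus[OF t(1) this] obtain m where m: "\<forall>i\<ge>1. \<forall>s\<in>S. \<forall>z\<in>Z. \<forall>z'\<in>Z. \<forall>\<omega>\<in>space M.
        (\<forall>j<t. dist (z j) (z' j) < 1 / real (Suc m)) \<longrightarrow>
        dist (state_control i s z t \<omega>) (state_control i s z' t \<omega>) \<le> e / 2" ..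
      have "\<forall>\<^sub>F k in sequentially. \<forall>j\<in>{..<t}. dist (y k j) (z k j) < 1 / real (Suc m)"
        by (rule eventually_ball_finite) (auto intro!: order_tendstoD(2)[OF IH])
      then show "\<forall>\<^sub>F k in sequentially. dist (dist (population_average (N k) (s k) (y k) t (\<omega> k))
          (population_average (N k) (s k) (z k) t (\<omega> k))) 0 < e"
      proof eventually_elim
        case (elim k)
        have "dist (population_average (N k) (s k) (y k) t (\<omega> k)) (population_average (N k) (s k)
            (z k) t (\<omega> k)) \<le> e / 2"
          unfolding population_average_def
        proof (rule dist_average_le[OF N])
          fix i assume i: "i \<in> {1..N k}"
          then have "1 \<le> i" by simp
          from m[rule_format, OF this bspec[OF s i] y(1) z(1) \<omega>] elim
          show "dist (state_control i (s k i) (y k) t (\<omega> k)) (state_control i (s k i) (z k) t (\<omega>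
              k)) \<le> e / 2" by blast
        qed
        then show ?case using e by simp
      qed
    qed
    have 2: "(\<lambda>k. dist (population_average (N k) (s k) (z k) t (\<omega> k)) (d k t)) \<longlonglongrightarrow> 0"
    proof (rule tendsto_sandwich[OF _ _ tendsto_const LIMSEQ_inverse_real_of_nat])
      have "dist (population_average (N k) (s k) (z k) t (\<omega> k)) (d k t) \<le> inverse (real (Suc k))" for k
        using less_imp_le[OF close[of k, rule_format, OF t]] by (simp only: inverse_eq_divide)
      then show "\<forall>\<^sub>F k in sequentially. dist (population_average (N k) (s k) (z k) t (\<omega> k)) (d k
          t) \<le> inverse (real (Suc k))"
        by (intro always_eventually allI)
    qed simp
    show ?thesis unfolding a(1)[OF t(1)]
      by (rule tendsto_sandwich[OF _ _ tendsto_const])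
        (use tendsto_add[OF 1 2] in \<open>auto intro!: always_eventually dist_triangle\<close>)
  qed
  have "(\<lambda>k. dist (driven_path G (a k) t) (driven_path G (d k) t)) \<longlonglongrightarrow> 0" if "t \<in> T" "t < n" for t
  proof (rule tendsto_dist_driven_path[OF _ _ that])
    show "\<forall>\<^sub>F k in sequentially. \<forall>t\<in>T. a k t \<in> D \<and> d k t \<in> D"
      using a(2) d by (intro always_eventually) blast
    show "(\<lambda>k. dist (a k t) (d k t)) \<longlonglongrightarrow> 0"
      if "t \<in> T" "t < n" "\<And>j. j < t \<Longrightarrow> (\<lambda>k. dist (driven_path G (a k) j) (driven_path G (d k) j)) \<longlonglongrightarrow>
          0" for t
      using that(3) unfolding y(2)[symmetric] z(2)[symmetric] by (rule step[OF that(1,2)])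
  qed
  then have lim: "(\<lambda>k. dist (y k t) (z k t)) \<longlonglongrightarrow> 0" if "t \<in> T" "t < n" for t
    using that unfolding y(2)[symmetric] z(2)[symmetric] by blast
  have "\<forall>\<^sub>F k in sequentially. \<forall>t\<in>T \<inter> {..<n}. dist (y k t) (z k t) < 1 / real (Suc n)"
    by (rule eventually_ball_finite) (auto intro!: order_tendstoD(2)[OF lim])
  then obtain k where "\<forall>t\<in>T \<inter> {..<n}. dist (y k t) (z k t) < 1 / real (Suc n)"
    by (auto simp: eventually_sequentially)
  then have "near n (y k) (z k)" by (simp add: near_def)
  then show False using far[of k] by (simp add: y_def)
qed

text \<open>Induction over time: the variables before \<open>t\<close> enter the trajectories as
  random inputs, and the aggregate they produce determines the variable at \<open>t\<close>
  continuously.\<close>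

lemma measurable_env_path:
  assumes N: "1 \<le> N" and s: "\<And>i. i \<in> {1..N} \<Longrightarrow> s i \<in> S"
  shows "env_path G N s \<in> M \<rightarrow>\<^sub>M borel_of (path_top G)"
proof -
  define y where "y = env_path G N s"
  define a where "a \<omega> t = population_aggregate G N s \<omega> t (y \<omega>)" for \<omega> t
  have y: "y \<omega> \<in> Z" if "\<omega> \<in> space M" for \<omega>
    unfolding y_def by (rule env_path_in_Z[OF N s that])
  have y_eq: "y \<omega> = driven_path G (a \<omega>)" for \<omega>
    unfolding a_def y_def by (rule env_path_eq_driven_path)
  have a: "a \<omega> t = population_average N s (y \<omega>) t \<omega>" "a \<omega> t \<in> D" if "t \<in> T" "\<omega> \<in> space M" for \<omega> t
    unfolding a_def using population_aggregate_eq[OF N s y[OF that(2)] that] by auto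
  have "(\<lambda>\<omega>. driven_state G (a \<omega>) t) \<in> borel_measurable M \<and> (\<lambda>\<omega>. a \<omega> t) \<in> borel_measurable M \<and>
      (\<lambda>\<omega>. y \<omega> t) \<in> borel_measurable M"
    if "t \<in> T" for t
    using that
  proof (induction t rule: less_induct)
    case (less t)
    have sub: "{..<t} \<subseteq> T" using stages_downward[OF less.prems] by auto
    have IH: "(\<lambda>\<omega>. driven_state G (a \<omega>) j) \<in> borel_measurable M" "(\<lambda>\<omega>. a \<omega> j) \<in> borel_measurable M"
      "(\<lambda>\<omega>. y \<omega> j) \<in> borel_measurable M" if "j < t" for j
      using less.IH[OF that] sub that by auto
    have yY: "y \<omega> k \<in> Y" if "k < t" "\<omega> \<in> space M" for k \<omega> using y[OF that(2)] sub that(1) by auto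
    have mem: "(driven_state G (a \<omega>) j, a \<omega> j) \<in> E \<times> D" if "j \<le> t" "\<omega> \<in> space M" for j \<omega>
    proof -
      have "\<And>i. i \<le> j \<Longrightarrow> i \<in> T" using stages_downward[OF less.prems] that(1) by simp
      then show ?thesis using a(2) that(2) by (auto intro!: driven_state_in_E)
    qed
    have "(\<lambda>\<omega>. state_control i (s i) (y \<omega>) t \<omega>) \<in> borel_measurable M" if i: "i \<in> {1..N}" for i
    proof -
      have i1: "1 \<le> i" using i by simp
      show ?thesis unfolding state_control_def
        using primitives[OF i1] sub IH(3) yY less.prems
        by (intro borel_measurable_Pair measurable_trajectory i1 s[OF i]) auto
    qed
    then have "(\<lambda>\<omega>. population_average N s (y \<omega>) t \<omega>) \<in> borel_measurable M"
      unfolding population_average_def by (intro borel_measurable_scaleR borel_measurable_sum) auto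
    then have at: "(\<lambda>\<omega>. a \<omega> t) \<in> borel_measurable M"
      by (subst measurable_cong[where g = "\<lambda>\<omega>. population_average N s (y \<omega>) t \<omega>"]) (use a(1)[OF
          less.prems] in auto)
    have et: "(\<lambda>\<omega>. driven_state G (a \<omega>) t) \<in> borel_measurable M"
    proof (cases t)
      case (Suc r)
      then have r: "r < t" "r \<le> t" "r \<in> T" using sub by auto
      have "(\<lambda>\<omega>. env_step G r (driven_state G (a \<omega>) r, a \<omega> r)) \<in> borel_measurable M"
        by (rule borel_measurable_continuous_on_compose[OF env_maps(1)[OF r(3)]])
          (intro borel_measurable_Pair IH r(1) mem[OF r(2)], assumption?)+
      then show ?thesis by (simp add: Suc)
    qed simp
    have "(\<lambda>\<omega>. env_out G t (driven_state G (a \<omega>) t, a \<omega> t)) \<in> borel_measurable M"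
      by (rule borel_measurable_continuous_on_compose[OF env_maps(2)[OF less.prems]])
        (intro borel_measurable_Pair et at mem[OF order_refl], assumption?)+
    moreover have "y \<omega> t = env_out G t (driven_state G (a \<omega>) t, a \<omega> t)" for \<omega>
      by (subst y_eq) (simp add: driven_path_def less.prems)
    ultimately show ?case using et at by simp
  qed
  moreover have "y \<omega> t = undefined" if "t \<notin> T" for \<omega> t
    using that by (subst y_eq) (simp add: driven_path_def)
  ultimately have "(\<lambda>\<omega>. y \<omega> t) \<in> borel_measurable M" for t by (cases "t \<in> T") auto
  then have "y \<in> borel_measurable M" by (rule measurable_coordinatewise_then_product)
  then show ?thesis unfolding path_top_eq y_def[symmetric]
    using y by (rule measurable_borel_of_top_of_set)
qed

text \<open>With \<open>z\<close> fixed, state and control of \<open>i\<close> are a measurable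
  function of the primitives of \<open>i\<close> alone, so (A3) applies. The inner product with
  \<open>b\<close> extracts the scalar that Hoeffding's inequality needs.\<close>

lemma indep_state_control:
  assumes s: "\<And>i. i \<in> {1..N} \<Longrightarrow> s i \<in> S" and z: "z \<in> Z" and t: "t \<in> T"
  shows "prob_space.indep_vars M (\<lambda>_. borel) (\<lambda>i \<omega>. state_control i (s i) z t \<omega> \<bullet> b) {1..N}"
proof -
  interpret prob_space M by (rule prob_space_sample)
  let ?P = "\<lambda>i. restrict_space borel (states G i) \<Otimes>\<^sub>M (\<Pi>\<^sub>M t\<in>T. restrict_space borel (disturbances
      G i))"
  let ?\<omega> = "\<lambda>i \<omega>. (init_state G i \<omega>, \<lambda>t\<in>T. noise G i t \<omega>)"
  define f where "f i p = (dm_state G i (s i) (fst p) (snd p) z t, dm_control G i (s i) (fst p)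
      (snd p) z t) \<bullet> b" for i p
  have sub: "{..<t} \<subseteq> T" using stages_downward[OF t] by auto
  have "indep_vars ?P ?\<omega> {1..}" using A3 unfolding cond_A3_def .
  then have "indep_vars ?P ?\<omega> {1..N}" by (rule indep_vars_subset) auto
  then have "indep_vars (\<lambda>_. borel) (\<lambda>i \<omega>. f i (?\<omega> i \<omega>)) {1..N}"
  proof (rule indep_vars_compose2)
    fix i assume i: "i \<in> {1..N}"
    then have i1: "1 \<le> i" by simp
    have P: "?P i = restrict_space borel X \<Otimes>\<^sub>M (\<Pi>\<^sub>M t\<in>T. restrict_space borel W)"
      by (simp only: same_spaces[OF i1])
    let ?Q = "restrict_space borel X \<Otimes>\<^sub>M (\<Pi>\<^sub>M t\<in>T. restrict_space borel W)"
    have fst: "fst \<in> borel_measurable ?Q" "\<And>p. p \<in> space ?Q \<Longrightarrow> fst p \<in> X"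
      using measurable_fst[of "restrict_space borel X" "\<Pi>\<^sub>M t\<in>T. restrict_space borel W"]
      unfolding measurable_restrict_space2_iff by (auto simp: space_pair_measure space_restrict_space)
    have snd: "(\<lambda>p. snd p k) \<in> borel_measurable ?Q" "\<And>p. p \<in> space ?Q \<Longrightarrow> snd p k \<in> W" if "k \<in> T" for k
    proof -
      have "(\<lambda>p. snd p k) \<in> ?Q \<rightarrow>\<^sub>M restrict_space borel W"
        by (rule measurable_compose[OF measurable_snd measurable_component_singleton[OF that]])
      then show "(\<lambda>p. snd p k) \<in> borel_measurable ?Q" "\<And>p. p \<in> space ?Q \<Longrightarrow> snd p k \<in> W"
        unfolding measurable_restrict_space2_iff by blast+
    qed
    show "f i \<in> ?P i \<rightarrow>\<^sub>M borel"
      unfolding P f_def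
      using fst snd sub z t
      by (intro borel_measurable_inner borel_measurable_Pair measurable_trajectory i1 s[OF i]
          borel_measurable_const) auto
  qed
  moreover have "f i (?\<omega> i \<omega>) = state_control i (s i) z t \<omega> \<bullet> b" for i \<omega>
  proof -
    \<comment> \<open>On the product space the noise is cut off outside \<open>T\<close>; times
      before \<open>t\<close> are unaffected.\<close>
    have "dm_state G i (s i) (init_state G i \<omega>) (\<lambda>t\<in>T. noise G i t \<omega>) z t = dm_state G i (s i)
        (init_state G i \<omega>) (noise_path i \<omega>) z t"
      "dm_control G i (s i) (init_state G i \<omega>) (\<lambda>t\<in>T. noise G i t \<omega>) z t = dm_control G i (s i)
          (init_state G i \<omega>) (noise_path i \<omega>) z t"
      using sub by (auto intro!: dm_state_cong dm_control_cong)
    then show ?thesis by (simp add: f_def state_control_def)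
  qed
  ultimately show ?thesis by simp
qed

text \<open>Hoeffding's inequality in each of the \<open>q\<close> coordinates, followed by a union
  bound. A deviation of size \<open>\<delta>\<close> forces some coordinate to reach
  \<open>\<delta> / q\<close>, as the norm is at most the sum of the moduli of the coordinates. The
  rate \<open>c\<close> does not depend on the profile, the path or the stage.\<close>

lemma population_average_deviation:
  assumes \<delta>: "\<delta> > 0"
  defines "q \<equiv> real DIM((real ^ 'n) \<times> (real ^ 'm))"
  shows "\<exists>c>0. \<forall>N s z t. 1 \<le> N \<longrightarrow> (\<forall>i\<in>{1..N}. s i \<in> S) \<longrightarrow> z \<in> Z \<longrightarrow> t \<in> T \<longrightarrow>
    measure M {\<omega> \<in> space M. \<delta> \<le> dist (population_average N s z t \<omega>)
        ((1 / real N) *\<^sub>R (\<Sum>i\<in>{1..N}. mean_state_control i (s i) z t))} \<le> 2 * q * exp (- c * real N)"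
proof -
  interpret prob_space M by (rule prob_space_sample)
  obtain R where R: "0 < R" "\<And>a. a \<in> X \<times> U \<Longrightarrow> norm a \<le> R" by (rule state_control_bounded) blast
  have q: "q > 0" by (simp only: q_def of_nat_0_less_iff DIM_positive)
  \<comment> \<open>With threshold \<open>N * \<delta> / q\<close> and \<open>N\<close> summands
    ranging over \<open>{- R..R}\<close>, Hoeffding's exponent equals
    \<open>- c * N\<close>.\<close>
  define c where "c = 2 * (\<delta> / q)\<^sup>2 / (2 * R)\<^sup>2"
  have "c > 0" using \<delta> q R by (simp add: c_def)
  moreover have "prob {\<omega> \<in> space M. \<delta> \<le> dist (population_average N s z t \<omega>)
        ((1 / real N) *\<^sub>R (\<Sum>i\<in>{1..N}. mean_state_control i (s i) z t))} \<le> 2 * q * exp (- c * real N)"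
    if N: "1 \<le> N" and s: "\<forall>i\<in>{1..N}. s i \<in> S" and z: "z \<in> Z" and t: "t \<in> T" for N s z t
  proof -
    define \<mu> where "\<mu> = (1 / real N) *\<^sub>R (\<Sum>i\<in>{1..N}. mean_state_control i (s i) z t)"
    define A where "A \<omega> = population_average N s z t \<omega>" for \<omega>
    have sc: "state_control i (s i) z t \<in> borel_measurable M" "integrable M (state_control i (s i) z t)"
      "\<And>\<omega>. \<omega> \<in> space M \<Longrightarrow> norm (state_control i (s i) z t \<omega>) \<le> R" if "i \<in> {1..N}" for i
    proof -
      have "1 \<le> i" "s i \<in> S" using that s by auto
      note i = this z t
      show "state_control i (s i) z t \<in> borel_measurable M" by (rule measurable_state_control[OF i])
      show "integrable M (state_control i (s i) z t)" by (rule integrable_state_control[OF i])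
      show "norm (state_control i (s i) z t \<omega>) \<le> R" if "\<omega> \<in> space M" for \<omega>
        by (rule R(2)[OF state_control_in[OF i that]])
    qed
    have A_meas: "A \<in> borel_measurable M"
      unfolding A_def population_average_def using sc(1) by (intro borel_measurable_scaleR
          borel_measurable_sum) auto
    have tail: "prob {\<omega> \<in> space M. \<delta> / q \<le> \<bar>(A \<omega> - \<mu>) \<bullet> b\<bar>} \<le> 2 * exp (- c * real N)" if b: "b \<in>
        Basis" for b
    proof -
      define Xb where "Xb i \<omega> = state_control i (s i) z t \<omega> \<bullet> b" for i \<omega>
      have Xb_le: "\<bar>Xb i \<omega>\<bar> \<le> R" if "i \<in> {1..N}" "\<omega> \<in> space M" for i \<omega>
        unfolding Xb_def using Basis_le_norm[OF b, of "state_control i (s i) z t \<omega>"] sc(3)[OF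
            that] by linarith
      interpret H: Hoeffding_ineq M "{1..N}" Xb "\<lambda>_. - R" "\<lambda>_. R" "\<Sum>i\<in>{1..N}. expectation (Xb i)"
      proof unfold_locales
        show "indep_vars (\<lambda>_. borel) Xb {1..N}"
          unfolding Xb_def using s by (intro indep_state_control z t) auto
        fix i assume i: "i \<in> {1..N}"
        have "- R \<le> Xb i \<omega>" "Xb i \<omega> \<le> R" if "\<omega> \<in> space M" for \<omega>
          using Xb_le[OF i that] by linarith+
        then show "AE \<omega> in M. Xb i \<omega> \<in> {- R..R}" by (intro AE_I2) simp
      qed simp_all
      have "expectation (Xb i) = mean_state_control i (s i) z t \<bullet> b" if "i \<in> {1..N}" for i
        unfolding Xb_def mean_state_control_def using sc(2)[OF that] by (simp add: integral_inner_left)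
      then have mean: "(\<Sum>i\<in>{1..N}. expectation (Xb i)) = real N * (\<mu> \<bullet> b)"
        using N by (simp add: \<mu>_def inner_sum_left)
      have sum: "(\<Sum>i\<in>{1..N}. Xb i \<omega>) = real N * (A \<omega> \<bullet> b)" for \<omega>
        using N by (simp add: Xb_def A_def population_average_def inner_sum_left)
      have "{\<omega> \<in> space M. \<delta> / q \<le> \<bar>(A \<omega> - \<mu>) \<bullet> b\<bar>} =
          {\<omega> \<in> space M. \<bar>(\<Sum>i\<in>{1..N}. Xb i \<omega>) - (\<Sum>i\<in>{1..N}. expectation (Xb i))\<bar> \<ge> real N * (\<delta> / q)}"
      proof -
        have "\<bar>real N * (A \<omega> \<bullet> b) - real N * (\<mu> \<bullet> b)\<bar> = real N * \<bar>(A \<omega> - \<mu>) \<bullet> b\<bar>" for \<omega>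
          by (simp add: inner_diff_left abs_mult flip: right_diff_distrib)
        moreover have "real N * (\<delta> / q) \<le> real N * r \<longleftrightarrow> \<delta> / q \<le> r" for r
          using N by (intro mult_le_cancel_left_pos) simp
        ultimately show ?thesis unfolding mean sum by (simp only:)
      qed
      also have "prob \<dots> \<le> 2 * exp (-2 * (real N * (\<delta> / q))\<^sup>2 / (\<Sum>i\<in>{1..N}. (R - - R)\<^sup>2))"
        by (rule H.Hoeffding_ineq_abs_ge) (use \<delta> q R N in auto)
      also have "-2 * (real N * (\<delta> / q))\<^sup>2 / (\<Sum>i\<in>{1..N}. (R - - R)\<^sup>2) = - c * real N"
        using N R(1) q by (simp add: c_def power_mult_distrib field_simps power2_eq_square)
      finally show ?thesis .
    qed
    have "{\<omega> \<in> space M. \<delta> \<le> dist (A \<omega>) \<mu>} \<subseteq> (\<Union>b\<in>Basis. {\<omega> \<in> space M. \<delta> / q \<le> \<bar>(A \<omega> - \<mu>) \<bullet> b\<bar>})"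
    proof
      fix \<omega> assume \<omega>: "\<omega> \<in> {\<omega> \<in> space M. \<delta> \<le> dist (A \<omega>) \<mu>}"
      have "\<exists>b\<in>Basis. \<delta> / q \<le> \<bar>(A \<omega> - \<mu>) \<bullet> b\<bar>"
      proof (rule ccontr)
        assume "\<not> ?thesis"
        then have less: "\<bar>(A \<omega> - \<mu>) \<bullet> b\<bar> < \<delta> / q" if "b \<in> Basis" for b using that by (meson not_le)
        have "norm (A \<omega> - \<mu>) \<le> (\<Sum>b\<in>Basis. \<bar>(A \<omega> - \<mu>) \<bullet> b\<bar>)" by (rule norm_le_l1)
        also have "\<dots> < (\<Sum>b\<in>(Basis :: ((real ^ 'n) \<times> (real ^ 'm)) set). \<delta> / q)"
          by (rule sum_strict_mono) (simp, metis nonempty_Basis, rule less)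
        also have "\<dots> = \<delta>" using q by (simp add: q_def)
        finally show False using \<omega> by (simp add: dist_norm)
      qed
      then show "\<omega> \<in> (\<Union>b\<in>Basis. {\<omega> \<in> space M. \<delta> / q \<le> \<bar>(A \<omega> - \<mu>) \<bullet> b\<bar>})" using \<omega> by auto
    qed
    moreover have ev: "{\<omega> \<in> space M. \<delta> / q \<le> \<bar>(A \<omega> - \<mu>) \<bullet> b\<bar>} \<in> events" for b
      using A_meas by measurable
    ultimately have "prob {\<omega> \<in> space M. \<delta> \<le> dist (A \<omega>) \<mu>} \<le> prob (\<Union>b\<in>Basis. {\<omega> \<in> space M. \<delta> / q \<le>
        \<bar>(A \<omega> - \<mu>) \<bullet> b\<bar>})"
      by (intro finite_measure_mono sets.finite_UN) auto
    also have "\<dots> \<le> (\<Sum>b\<in>Basis. prob {\<omega> \<in> space M. \<delta> / q \<le> \<bar>(A \<omega> - \<mu>) \<bullet> b\<bar>})"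
      using ev by (intro finite_measure_subadditive_finite) auto
    also have "\<dots> \<le> (\<Sum>b\<in>(Basis :: ((real ^ 'n) \<times> (real ^ 'm)) set). 2 * exp (- c * real N))"
      by (intro sum_mono tail)
    also have "\<dots> = 2 * q * exp (- c * real N)" by (simp add: q_def)
    finally show ?thesis unfolding A_def \<mu>_def .
  qed
  ultimately show ?thesis by (intro exI[of _ c] conjI allI impI) simp_all
qed

subsection \<open>Pure approximate equilibria\<close>

lemma norm_mean_state_control_le:
  assumes "\<And>a. a \<in> X \<times> U \<Longrightarrow> norm a \<le> R" "1 \<le> i" "s \<in> S" "z \<in> Z" "t \<in> T"
  shows "norm (mean_state_control i s z t) \<le> R"
proof -
  have "convex hull (X \<times> U) \<subseteq> cball 0 R"
    using assms(1) by (intro hull_minimal convex_cball) auto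
  then show ?thesis using mean_state_control_in_convex_hull[OF assms(2-5)] by auto
qed

text \<open>A decision maker keeps one index for all stages, so the squared errors of all stages in
  the window are summed before Maurey selection is applied; the total is at most
  \<open>N * n * (2 * R)\<^sup>2\<close>, and division by \<open>N\<^sup>2\<close> leaves the
  quantity in \<open>small\<close>. Holding the path \<open>z\<close> fixed makes the candidate
  contributions independent of the choices of others.\<close>

lemma pure_selection:
  assumes R: "0 < R" "\<And>a. a \<in> X \<times> U \<Longrightarrow> norm a \<le> R"
    and N: "1 \<le> N" and sl: "\<And>l. l < L \<Longrightarrow> sl l \<in> S" and lam: "lam \<in> weights L" and z: "z \<in> Z"
    and small: "real n * (2 * R)\<^sup>2 / real N < \<delta>\<^sup>2" and \<delta>: "\<delta> > 0"
  shows "\<exists>\<kappa>. (\<forall>i\<in>{1..N}. \<kappa> i < L \<and> 0 < lam (\<kappa> i)) \<and> (\<forall>t\<in>T. t < n \<longrightarrow>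
      dist ((1 / real N) *\<^sub>R (\<Sum>i\<in>{1..N}. mean_state_control i (sl (\<kappa> i)) z t))
          (mean_field_aggregate N L sl lam t z) < \<delta>)"
proof -
  let ?Tn = "T \<inter> {..<n}"
  let ?v = "\<lambda>i l t. mean_state_control i (sl l) z t"
  let ?e = "\<lambda>\<kappa> t. \<Sum>i\<in>{1..N}. ?v i (\<kappa> i) t - (\<Sum>l\<in>{..<L}. lam l *\<^sub>R ?v i l t)"
  have "\<exists>\<kappa>. (\<forall>i\<in>{1..N}. \<kappa> i \<in> {..<L} \<and> 0 < lam (\<kappa> i)) \<and>
    (\<Sum>t\<in>?Tn. (norm (?e \<kappa> t))\<^sup>2) \<le> card {1..N} * card ?Tn * (2 * R)\<^sup>2"
    using lam by (intro Maurey_selection) (auto simp: weights_def intro!: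
        norm_mean_state_control_le[OF R(2)] sl z)
  then obtain \<kappa> where \<kappa>: "\<forall>i\<in>{1..N}. \<kappa> i \<in> {..<L} \<and> 0 < lam (\<kappa> i)"
    "(\<Sum>t\<in>?Tn. (norm (?e \<kappa> t))\<^sup>2) \<le> card {1..N} * card ?Tn * (2 * R)\<^sup>2" by blast
  have card: "card ?Tn \<le> n" using card_mono[of "{..<n}" ?Tn] by simp
  have "dist ((1 / real N) *\<^sub>R (\<Sum>i\<in>{1..N}. ?v i (\<kappa> i) t)) (mean_field_aggregate N L sl lam t z) < \<delta>"
    if t: "t \<in> T" "t < n" for t
  proof -
    have "(norm (?e \<kappa> t))\<^sup>2 \<le> (\<Sum>t\<in>?Tn. (norm (?e \<kappa> t))\<^sup>2)"
      using t by (intro member_le_sum) auto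
    also have "\<dots> \<le> real N * real (card ?Tn) * (2 * R)\<^sup>2" using \<kappa>(2) by simp
    also have "\<dots> \<le> real N * real n * (2 * R)\<^sup>2" using card by (intro mult_right_mono
        mult_left_mono) auto
    also have "\<dots> < (real N * \<delta>)\<^sup>2" using small N by (simp add: field_simps power2_eq_square)
    finally have "norm (?e \<kappa> t) < real N * \<delta>"
      by (rule power_less_imp_less_base) (use \<delta> in simp)
    then have "norm (?e \<kappa> t) / real N < \<delta>" using N by (simp add: field_simps)
    moreover have "(1 / real N) *\<^sub>R (\<Sum>i\<in>{1..N}. ?v i (\<kappa> i) t) - mean_field_aggregate N L sl lam t
        z = (1 / real N) *\<^sub>R ?e \<kappa> t"
      by (simp add: mean_field_aggregate_def sum_subtractf scaleR_right_diff_distrib)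
    ultimately show ?thesis by (simp add: dist_norm)
  qed
  then show ?thesis using \<kappa>(1) by (intro exI[of _ \<kappa>]) simp
qed

lemma mixed_cost_bounds:
  assumes "1 \<le> i" "z \<in> Z" "\<gamma> \<in> \<Gamma>" "\<And>s. s \<in> S \<Longrightarrow> \<bar>J i s z\<bar> \<le> B"
  shows "\<bar>LINT s|\<gamma>. J i s z\<bar> \<le> B"
proof -
  interpret prob_space \<gamma> by (rule mixed_strategiesD[OF assms(3)])
  have "\<bar>LINT s|\<gamma>. J i s z\<bar> \<le> (LINT s|\<gamma>. \<bar>J i s z\<bar>)" by (rule integral_abs_bound)
  also have "\<dots> \<le> (LINT s|\<gamma>. B)"
    using assms(4) mixed_strategiesD(2)[OF assms(3)]
    by (intro integral_mono integrable_abs integrable_expected_cost_strategy assms(1-3)) auto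
  finally show ?thesis by (simp add: prob_space)
qed

text \<open>Half of \<open>\<epsilon>\<close> pays for nearness of paths on the good event, the
  other half for the exceptional event, where costs can differ by \<open>2 * B\<close>. All
  tolerances are fixed before the population size.\<close>

lemma approximate_equilibrium:
  assumes \<epsilon>: "\<epsilon> > 0"
  shows "\<exists>N\<^sub>0\<ge>1. \<forall>N\<ge>N\<^sub>0. \<exists>s\<in>PiE {1..N} (strategies G). \<forall>i\<in>{1..N}. \<forall>\<gamma>\<in>\<Gamma>.
    (LINT z|env_law G N s. J i (s i) z) \<le> mixed_cost G i \<gamma> (env_law G N s) + \<epsilon>"
proof -
  interpret prob_space M by (rule prob_space_sample)
  \<comment> \<open>Four comparisons, two for the strategy played and two for the deviation, add up
    to \<open>\<epsilon> / 2\<close>.\<close>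
  define e where "e = \<epsilon> / 8"
  have "e > 0" using \<epsilon> by (simp add: e_def)
  from expected_cost_modulus[OF this] obtain n where "\<forall>i\<ge>1. \<forall>s\<in>S. \<forall>s'\<in>S. \<forall>z\<in>Z. \<forall>z'\<in>Z.
      strategies_near n s s' \<longrightarrow> near n z z' \<longrightarrow> \<bar>J i s z - J i s' z'\<bar> \<le> e" ..
  then have n: "\<bar>J i s z - J i s z'\<bar> \<le> e" if "1 \<le> i" "s \<in> S" "z \<in> Z" "z' \<in> Z" "near n z z'" for i s z z'
    using that by simp
  obtain B where B: "B > 0" "\<forall>i\<ge>1. \<forall>s\<in>S. \<forall>z\<in>Z. \<bar>J i s z\<bar> \<le> B"
    using expected_cost_bounded by blast
  obtain L :: nat and zl where zl: "\<And>l. l < L \<Longrightarrow> zl l \<in> Z"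
    "\<And>z. z \<in> Z \<Longrightarrow> \<exists>l<L. path_gap n z (zl l) < 1 / real (Suc n)"
    using finite_path_net[of n] by metis
  have "\<exists>s\<in>S. \<forall>s'\<in>S. J 1 s (zl l) \<le> J 1 s' (zl l)" if "l < L" for l
    using expected_cost_minimizer[OF order_refl zl(1)[OF that]] by metis
  then obtain sl where sl: "\<And>l. l < L \<Longrightarrow> sl l \<in> S"
    and sl_min: "\<And>l s'. l < L \<Longrightarrow> s' \<in> S \<Longrightarrow> J 1 (sl l) (zl l) \<le> J 1 s' (zl l)" by metis
  have sl_best: "J i (sl l) (zl l) \<le> J i s' (zl l)" if "1 \<le> i" "l < L" "s' \<in> S" for i l s'
    by (rule common_pure_best_reply[OF that(1) zl(1)[OF that(2)] sl[OF that(2)] sl_min[OF that(2)]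
        that(3)])
  from env_path_stability[of n] obtain k where k:
    "\<forall>N s \<omega> d z. 1 \<le> N \<longrightarrow> (\<forall>i\<in>{1..N}. s i \<in> S) \<longrightarrow> \<omega> \<in> space M \<longrightarrow> z \<in> Z \<longrightarrow> z = driven_path G d \<longrightarrow>
     (\<forall>t\<in>T. d t \<in> D) \<longrightarrow> (\<forall>t\<in>T. t < n \<longrightarrow> dist (population_average N s z t \<omega>) (d t) < 1 / real (Suc k)) \<longrightarrow>
     near n (env_path G N s \<omega>) z" ..
  \<comment> \<open>Half of the tolerance is for random fluctuation, half for passing from mixed
    weights to a pure profile.\<close>
  define \<delta> where "\<delta> = 1 / real (Suc k) / 2"
  have \<delta>: "\<delta> > 0" by (simp add: \<delta>_def)
  define q where "q = real DIM((real ^ 'n) \<times> (real ^ 'm))"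
  from population_average_deviation[OF \<delta>] obtain c where c: "c > 0"
    "\<forall>N s z t. 1 \<le> N \<longrightarrow> (\<forall>i\<in>{1..N}. s i \<in> S) \<longrightarrow> z \<in> Z \<longrightarrow> t \<in> T \<longrightarrow>
    prob {\<omega> \<in> space M. \<delta> \<le> dist (population_average N s z t \<omega>)
        ((1 / real N) *\<^sub>R (\<Sum>i\<in>{1..N}. mean_state_control i (s i) z t))} \<le> 2 * q * exp (- c * real N)"
    unfolding q_def by blast
  obtain R where R: "0 < R" "\<And>a. a \<in> X \<times> U \<Longrightarrow> norm a \<le> R" by (rule state_control_bounded) blast
  have "(\<lambda>N. real n * (2 * R)\<^sup>2 / real N) \<longlonglongrightarrow> 0"
    by real_asymp
  then have ev1: "\<forall>\<^sub>F N in sequentially. real n * (2 * R)\<^sup>2 / real N < \<delta>\<^sup>2"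
    by (rule order_tendstoD(2)) (use \<delta> in simp)
  have "(\<lambda>N. 2 * B * (real n * (2 * q * exp (- c * real N)))) \<longlonglongrightarrow> 0"
    using c(1) by real_asymp
  then have ev2: "\<forall>\<^sub>F N in sequentially. 2 * B * (real n * (2 * q * exp (- c * real N))) < \<epsilon> / 2"
    by (rule order_tendstoD(2)) (use \<epsilon> in simp)
  from eventually_conj[OF eventually_ge_at_top[of 1] eventually_conj[OF ev1 ev2]]
  obtain N0 where N0: "\<And>N. N0 \<le> N \<Longrightarrow> 1 \<le> N \<and> real n * (2 * R)\<^sup>2 / real N < \<delta>\<^sup>2 \<and>
      2 * B * (real n * (2 * q * exp (- c * real N))) < \<epsilon> / 2"
    unfolding eventually_sequentially by blast
  have "\<exists>s\<in>PiE {1..N} (strategies G). \<forall>i\<in>{1..N}. \<forall>\<gamma>\<in>\<Gamma>.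
    (LINT z|env_law G N s. J i (s i) z) \<le> mixed_cost G i \<gamma> (env_law G N s) + \<epsilon>" if "N0 \<le> N" for N
  proof -
    have N: "1 \<le> N" "real n * (2 * R)\<^sup>2 / real N < \<delta>\<^sup>2" "2 * B * (real n * (2 * q * exp (- c *
        real N))) < \<epsilon> / 2"
      using N0[OF that] by auto
    obtain lam where lam: "lam \<in> weights L" "\<forall>l<L. 0 < lam l \<longrightarrow> near n (mean_field_path N L sl lam)
        (zl l)"
      using mean_field_equilibrium[of N L sl n zl, OF N(1) sl zl(2)] by blast
    define zb where "zb = mean_field_path N L sl lam"
    define d where "d t = mean_field_aggregate N L sl lam t zb" for t
    have zb: "zb \<in> Z" "zb = driven_path G d"
      using mean_field_path_props[where sl = sl, OF N(1) sl lam(1)] unfolding zb_def d_def by blast+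
    have dD: "\<forall>t\<in>T. d t \<in> D"
      unfolding d_def using mean_field_aggregate_in_D[where sl = sl, OF N(1) sl lam(1) _ zb(1)] by blast
    \<comment> \<open>Selected indices have positive weight, hence each
      \<open>zl (\<kappa> i)\<close> is near \<open>zb\<close>; this is what makes the assigned
      strategies nearly best replies to \<open>zb\<close>.\<close>
    obtain \<kappa> where \<kappa>: "\<forall>i\<in>{1..N}. \<kappa> i < L \<and> 0 < lam (\<kappa> i)"
      "\<forall>t\<in>T. t < n \<longrightarrow> dist ((1 / real N) *\<^sub>R (\<Sum>i\<in>{1..N}. mean_state_control i (sl (\<kappa> i)) zb t)) (d
          t) < \<delta>"
      using pure_selection[where sl = sl, OF R N(1) sl lam(1) zb(1) N(2) \<delta>] unfolding d_def by blast
    define s where "s = (\<lambda>i\<in>{1..N}. sl (\<kappa> i))"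
    have s_eq: "s i = sl (\<kappa> i)" if "i \<in> {1..N}" for i using that by (simp add: s_def)
    have sS: "s i \<in> S" if "i \<in> {1..N}" for i using s_eq[OF that] sl bspec[OF \<kappa>(1) that] by simp
    have s_PiE: "s \<in> PiE {1..N} (strategies G)"
      using sS by (auto simp: s_def PiE_iff)
    define m where "m t = (1 / real N) *\<^sub>R (\<Sum>i\<in>{1..N}. mean_state_control i (s i) zb t)" for t
    have m: "dist (m t) (d t) < \<delta>" if "t \<in> T" "t < n" for t
    proof -
      have "(\<Sum>i\<in>{1..N}. mean_state_control i (s i) zb t) = (\<Sum>i\<in>{1..N}. mean_state_control i (sl (\<kappa>
          i)) zb t)"
        by (rule sum.cong) (simp_all only: s_eq)
      then show ?thesis unfolding m_def using \<kappa>(2) that by presburger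
    qed
    define y where "y = env_path G N s"
    have yZ: "y \<omega> \<in> Z" if "\<omega> \<in> space M" for \<omega>
      unfolding y_def by (rule env_path_in_Z[OF N(1) sS that])
    have y_meas: "y \<in> M \<rightarrow>\<^sub>M borel_of (path_top G)"
      unfolding y_def by (rule measurable_env_path[OF N(1) sS])
    \<comment> \<open>The union is over at most \<open>n\<close> stages, and the averages are taken
      along the deterministic \<open>zb\<close>, not along \<open>y\<close>, so that the
      concentration bound applies.\<close>
    define Bad where "Bad = (\<Union>t\<in>T \<inter> {..<n}. {\<omega> \<in> space M. \<delta> \<le> dist (population_average N s zb t \<omega>)
        (m t)})"
    have pa_meas: "(\<lambda>\<omega>. population_average N s zb t \<omega>) \<in> borel_measurable M" if "t \<in> T" for t
      unfolding population_average_def using sS zb(1) that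
      by (intro borel_measurable_scaleR borel_measurable_sum measurable_state_control) auto
    have ev: "{\<omega> \<in> space M. \<delta> \<le> dist (population_average N s zb t \<omega>) (m t)} \<in> events" if "t \<in> T" for t
      using pa_meas[OF that] by measurable
    have Bad_ev: "Bad \<in> events" unfolding Bad_def using ev by (intro sets.finite_UN) auto
    have "prob Bad \<le> (\<Sum>t\<in>T \<inter> {..<n}. prob {\<omega> \<in> space M. \<delta> \<le> dist (population_average N s zb t \<omega>)
        (m t)})"
      unfolding Bad_def using ev by (intro finite_measure_subadditive_finite) auto
    also have "\<dots> \<le> (\<Sum>t\<in>T \<inter> {..<n}. 2 * q * exp (- c * real N))"
      unfolding m_def using c(2)[rule_format, where s = s, OF N(1) sS zb(1)] by (intro sum_mono) auto
    also have "\<dots> \<le> real n * (2 * q * exp (- c * real N))"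
      using card_mono[of "{..<n}" "T \<inter> {..<n}"] by (simp add: q_def mult_right_mono)
    finally have prob_Bad: "prob Bad \<le> real n * (2 * q * exp (- c * real N))" .
    have good: "near n (y \<omega>) zb" if \<omega>: "\<omega> \<in> space M" "\<omega> \<notin> Bad" for \<omega>
    proof -
      have "dist (population_average N s zb t \<omega>) (d t) < 1 / real (Suc k)" if t: "t \<in> T" "t < n" for t
      proof -
        have "dist (population_average N s zb t \<omega>) (m t) < \<delta>"
          using \<omega> t unfolding Bad_def by (auto simp: not_le)
        then have "dist (population_average N s zb t \<omega>) (d t) < \<delta> + \<delta>"
          using m[OF t] dist_triangle[of "population_average N s zb t \<omega>" "d t" "m t"] by linarith
        moreover have "\<delta> + \<delta> = 1 / real (Suc k)" unfolding \<delta>_def by (rule field_sum_of_halves)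
        ultimately show ?thesis by (simp only:)
      qed
      then show ?thesis unfolding y_def
        using k[rule_format, where s = s and d = d, OF N(1) sS \<omega>(1) zb dD[rule_format]] by blast
    qed
    have "(LINT z|env_law G N s. J i (s i) z) \<le> mixed_cost G i \<gamma> (env_law G N s) + \<epsilon>"
      if i: "i \<in> {1..N}" and \<gamma>: "\<gamma> \<in> \<Gamma>" for i \<gamma>
    proof -
      have i1: "1 \<le> i" using i by simp
      define H where "H z = (LINT s'|\<gamma>. J i s' z)" for z
      have path_meas: "f \<in> borel_measurable (borel_of (path_top G))" if "continuous_on Z f" for f
          :: "(nat \<Rightarrow> 'y) \<Rightarrow> real"
        using that by (intro borel_measurable_borel_of) (simp add: path_top_eq)
      have J_meas: "J i (s i) \<in> borel_measurable (borel_of (path_top G))"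
        by (rule path_meas[OF continuous_expected_cost_path[OF i1 sS[OF i]]])
      have H_meas: "H \<in> borel_measurable (borel_of (path_top G))"
        unfolding H_def by (rule path_meas[OF continuous_mixed_cost_path[OF i1 \<gamma>]])
      have J_law: "(LINT z|env_law G N s. J i (s i) z) = (LINT \<omega>|M. J i (s i) (y \<omega>))"
        unfolding env_law_def y_def[symmetric] by (rule integral_distr[OF y_meas J_meas])
      have H_law: "mixed_cost G i \<gamma> (env_law G N s) = (LINT \<omega>|M. H (y \<omega>))"
        unfolding mixed_cost_def H_def[symmetric] env_law_def y_def[symmetric] by (rule
            integral_distr[OF y_meas H_meas])
      have J_le: "\<bar>J i (s i) (y \<omega>)\<bar> \<le> B" if "\<omega> \<in> space M" for \<omega>
        using B(2) i1 sS[OF i] yZ[OF that] by blast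
      have H_le: "\<bar>H (y \<omega>)\<bar> \<le> B" if "\<omega> \<in> space M" for \<omega>
        unfolding H_def using B(2) i1 by (intro mixed_cost_bounds[OF i1 yZ[OF that] \<gamma>]) (use yZ[OF
            that] in blast)
      have J_int: "integrable M (\<lambda>\<omega>. J i (s i) (y \<omega>))"
        by (rule integrable_const_bound[where B = B])
          (use J_le measurable_compose[OF y_meas J_meas] in auto)
      have H_int: "integrable M (\<lambda>\<omega>. H (y \<omega>))"
        by (rule integrable_const_bound[where B = B])
          (use H_le measurable_compose[OF y_meas H_meas] in auto)
      have pointwise: "J i (s i) (y \<omega>) \<le> H (y \<omega>) + \<epsilon> / 2 + 2 * B * indicator Bad \<omega>" if \<omega>: "\<omega> \<in>
          space M" for \<omega>
      proof (cases "\<omega> \<in> Bad")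
        case True
        then show ?thesis using J_le[OF \<omega>] H_le[OF \<omega>] \<epsilon> by simp
      next
        case False
        define l where "l = \<kappa> i"
        have l: "l < L" "near n zb (zl l)" "s i = sl l"
          using bspec[OF \<kappa>(1) i] lam(2) s_eq[OF i] by (auto simp: l_def zb_def)
        have near_y: "near n (y \<omega>) zb" by (rule good[OF \<omega> False])
        have "J i (s i) (y \<omega>) - \<epsilon> / 2 \<le> J i s' (y \<omega>)" if s': "s' \<in> S" for s'
        proof -
          \<comment> \<open>The chain runs from \<open>y \<omega>\<close> via \<open>zb\<close> to
            the net point \<open>zl l\<close>, where \<open>sl l\<close> is exactly optimal for
            every decision maker.\<close>
          have "\<bar>J i (sl l) (y \<omega>) - J i (sl l) zb\<bar> \<le> e" "\<bar>J i (sl l) zb - J i (sl l) (zl l)\<bar> \<le> e"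
            "\<bar>J i s' (y \<omega>) - J i s' zb\<bar> \<le> e" "\<bar>J i s' zb - J i s' (zl l)\<bar> \<le> e"
            by (rule n[OF i1]; fact sl[OF l(1)] s' yZ[OF \<omega>] zb(1) zl(1)[OF l(1)] near_y l(2))+
          with sl_best[OF i1 l(1) s'] show ?thesis unfolding l(3) e_def by linarith
        qed
        then have "J i (s i) (y \<omega>) - \<epsilon> / 2 \<le> H (y \<omega>)"
          unfolding H_def by (rule mixed_lower_bound[OF i1 yZ[OF \<omega>] \<gamma>])
        then show ?thesis using False by simp
      qed
      have "(LINT \<omega>|M. J i (s i) (y \<omega>)) \<le> (LINT \<omega>|M. H (y \<omega>) + \<epsilon> / 2 + 2 * B * indicator Bad \<omega>)"
        using Bad_ev by (intro integral_mono J_int pointwise Bochner_Integration.integrable_add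
            H_int integrable_mult_right)
          (auto simp: emeasure_eq_measure)
      also have "\<dots> = (LINT \<omega>|M. H (y \<omega>)) + \<epsilon> / 2 + 2 * B * prob Bad"
        using Bad_ev H_int by (simp add: emeasure_eq_measure prob_space)
      also have "\<dots> \<le> (LINT \<omega>|M. H (y \<omega>)) + \<epsilon> / 2 + \<epsilon> / 2"
        using mult_left_mono[OF prob_Bad, of "2 * B"] B(1) N(3) by linarith
      finally show ?thesis unfolding J_law H_law by simp
    qed
    with s_PiE show ?thesis by blast
  qed
  then show ?thesis
    by (intro exI[of _ "max 1 N0"]) simp
qed

end

theorem theorem4p3:
  fixes G :: "(real ^ 'n, real ^ 'm, 'w::{metric_space, second_countable_topology},
      'y::{metric_space, second_countable_topology},
      'e::{metric_space, second_countable_topology},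
      (real ^ 'n) \<times> (real ^ 'm), 'p) game_seq"
    and \<epsilon> :: real
  assumes "game_sequence G"
    and "cond_A1 G" and "cond_A2 G" and "cond_A3 G"
    and "cond_B1 G" and "cond_B2 G"
    and "\<epsilon> > 0"
  shows "\<exists>N\<^sub>\<epsilon>\<ge>1. \<forall>N\<ge>N\<^sub>\<epsilon>. \<exists>s \<in> PiE {1..N} (strategies G).
    \<forall>i\<in>{1..N}. \<forall>\<gamma>\<in>mixed_strategies G 1.
      (LINT z|env_law G N s. expected_cost G i (s i) z) \<le> mixed_cost G i \<gamma> (env_law G N s) + \<epsilon>"
proof -
  interpret mean_field_game G
    by unfold_locales (fact assms)+
  show ?thesis
    unfolding mixed_strategies_eq[OF order_refl] by (rule approximate_equilibrium[OF assms(7)])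
qed

end
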